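(* Let $0<\alpha<\beta$, let $L$, $(\mu_n)$, $A$, $m_1,m_2$ and $\langle\cdot,\cdot\rangle_{G_i}$ be as in the context, and let $\mathcal{H}_i$ be any of the four spaces $\mathcal{H}_1,\dots,\mathcal{H}_4$ given there. Let $$\sigma_{max}=\sup\{\operatorname{Re}\lambda:\ \alpha\lambda^3+\lambda^2+\beta\mu_n\lambda+\mu_n=0\ \text{for some } n\ge1\}$$ (a supremum which is sometimes, but not always, a maximum). Then $\sigma_{max}<0$ and the following hold. (i) Suppose that $\mu_n\neq m_1,m_2$ for all $n$, so that $A$ is a normal operator in the scalar product $\langle\cdot,\cdot\rangle_{G}=\langle\cdot,\cdot\rangle_{G_i}$. Then any solution $U(t)$ of $\frac{dU}{dt}=AU$ in $\mathcal{H}_i$ satisfies $$\|U(t)\|_G\le e^{\sigma_{max}t}\|U(0)\|_G\quad\text{for all } t\ge0 .$$ (ii) In the situation of (i) this decay is optimal in the sense that for each $\omega<\sigma_{max}$ there exist solutions $U(t)$ such that $\|U(t)\|_G\,e^{-\omega t}\to\infty$ as $t\to\infty$. (iii) If, on the other hand, $\mu_n\in\{m_1,m_2\}$ for some $n$ (so that there is no scalar product in which $A$ is normal), then there is another norm $\|\cdot\|'$ on $\mathcal{H}_i$, equivalent to the natural one, for which the same optimal decay result holds: every solution satisfies $\|U(t)\|'\le e^{\sigma_{max}t}\|U(0)\|'$ for all $t\ge0$, and for each $\omega<\sigma_{max}$ there exist solutions with $\|U(t)\|'e^{-\omega t}\to\infty$ as $t\to\infty$.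
   Context: $H$ is an (infinite-dimensional, complex) Hilbert space and $L$ is a self-adjoint, strictly positive operator in $H$ with compact resolvent. Its eigenvalues, repeated according to multiplicity, are $0<\mu_1\le\mu_2\le\dots\to\infty$, with an orthonormal basis of eigenfunctions $\phi_n$, $L\phi_n=\mu_n\phi_n$. The equation $(u+\alpha u_t)_{tt}+L(u+\beta u_t)=0$ is written, with $U=(u,v,w)^T=(u,u_t,u_{tt})^T$, as $\frac{dU}{dt}=AU$, where $$A(u,v,w)^T=\Big(v,\; w,\; -\tfrac1\alpha L(u+\beta v)-\tfrac1\alpha w\Big)^T .$$ The operator $A$ is considered in each of the Hilbert spaces $$\mathcal{H}_1=D(L^{1/2})\times D(L^{1/2})\times H,\quad \mathcal{H}_2=D(L)\times D(L)\times D(L^{1/2}),$$ $$\mathcal{H}_3=D(L)\times D(L^{1/2})\times H,\quad \mathcal{H}_4=D(L^{3/2})\times D(L)\times D(L^{1/2}),$$ where $D(L^s)$ carries the norm $\|L^s\cdot\|_H$. The domain is $D(A)=\{U\in\mathcal{H}_i: AU\in\mathcal{H}_i\}$ (with $L(u+\beta v)$ understood through the expansion in $\phi_n$). In each of these spaces $A$ generates a $C^0$-group $e^{At}$, and solutions are $U(t)=e^{At}U(0)$ with $U(0)\in\mathcal{H}_i$. The number $\sigma_{max}$ is the highest real part of the points of the spectrum of $A$ (the real part of the dominant spectrum). The numbers $m_1,m_2$ (possibly nonreal) are $$m_1=\alpha\frac{-C_1-\sqrt{C_2}}{8\beta^3},\quad m_2=\alpha\frac{-C_1+\sqrt{C_2}}{8\beta^3},$$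 $$C_1=27-18\frac{\beta}{\alpha}-\Big(\frac{\beta}{\alpha}\Big)^2,\quad C_2=C_1^2-64\Big(\frac{\beta}{\alpha}\Big)^3 .$$ Definition of $\langle\cdot,\cdot\rangle_{G_i}$ (when $\mu_n\ne m_1,m_2$ for all $n$). Let $E_n$ be the three-dimensional space spanned by $(\phi_n,0,0),(0,\phi_n,0),(0,0,\phi_n)$, so that $\mathcal{H}_i=\bigoplus_{n\ge1}E_n$ (orthogonal sum for the natural scalar product). In this basis the natural scalar product of $\mathcal{H}_i$ restricted to $E_n$ has matrix $O_{n,i}$ with $O_{n,1}=\mathrm{diag}(\mu_n,\mu_n,1)$, $O_{n,3}=\mathrm{diag}(\mu_n^2,\mu_n,1)$, $O_{n,2}=\mu_nO_{n,1}$, $O_{n,4}=\mu_nO_{n,3}$. Let $\lambda_1^n,\lambda_2^n,\lambda_3^n$ be the three (distinct) roots of $\alpha\lambda^3+\lambda^2+\beta\mu_n\lambda+\mu_n=0$; put $\Psi^{n,i}_j=(1,\lambda^n_j,(\lambda^n_j)^2)^T/c^{n,i}_j$ (coordinates in the basis $(\phi_n,0,0),(0,\phi_n,0),(0,0,\phi_n)$ of $E_n$), where $c_j^{n,i}>0$ normalizes $\Psi^{n,i}_j$ to norm one in the norm given by $O_{n,i}$. Let $C_{n,i}$ be the matrix with columns $\Psi^{n,i}_1,\Psi^{n,i}_2,\Psi^{n,i}_3$ and $G_{n,i}=(\overline{C_{n,i}^{-1}})^T C_{n,i}^{-1}$. The scalar product $\langle\cdot,\cdot\rangle_{G_i}$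 is the one for which the spaces $E_n$ are mutually orthogonal and whose restriction to $E_n$ has matrix $G_{n,i}$, i.e. $\|(x,y,z)\|^2_{G_{n,i}}=(\bar x,\bar y,\bar z)\,G_{n,i}\,(x,y,z)^T$; its norm is equivalent to the natural norm of $\mathcal{H}_i$. *)

theory Defs
  imports "HOL-Analysis.Analysis"
begin

text \<open>Complex Hilbert spaces. The real scalar product is the real part of the complex one, so that
  norm, topology and completeness are those of the real classes. Scalar products are conjugate
  linear in the first and linear in the second argument.\<close>

class complex_vector = real_vector +
  fixes scaleC :: "complex \<Rightarrow> 'a \<Rightarrow> 'a" (infixr "*\<^sub>C" 75)
  assumes scaleC_add_right: "a *\<^sub>C (x + y) = a *\<^sub>C x + a *\<^sub>C y"
    and scaleC_add_left: "(a + b) *\<^sub>C x = a *\<^sub>C x + b *\<^sub>C x"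
    and scaleC_scaleC: "a *\<^sub>C b *\<^sub>C x = (a * b) *\<^sub>C x"
    and scaleC_of_real: "complex_of_real r *\<^sub>C x = r *\<^sub>R x"

class chilbert_space = complex_vector + real_inner + complete_space +
  fixes cinner :: "'a \<Rightarrow> 'a \<Rightarrow> complex"
  assumes cinner_commute: "cinner x y = cnj (cinner y x)"
    and cinner_add_right: "cinner x (y + z) = cinner x y + cinner x z"
    and cinner_scaleC_right: "cinner x (a *\<^sub>C y) = a * cinner x y"
    and inner_eq_Re_cinner: "inner x y = Re (cinner x y)"

instantiation prod :: (complex_vector, complex_vector) complex_vector
begin

definition scaleC_prod_def: "a *\<^sub>C p = (a *\<^sub>C fst p, a *\<^sub>C snd p)"

instance
  by standard
    (simp_all add: scaleC_prod_def scaleC_add_right scaleC_add_left scaleC_scaleC scaleC_of_real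
      scaleR_prod_def)

end


section \<open>Linear operators on a carrier set\<close>

definition csubspace :: "'v::complex_vector set \<Rightarrow> bool" where
  "csubspace X \<longleftrightarrow> 0 \<in> X \<and> (\<forall>x\<in>X. \<forall>y\<in>X. x + y \<in> X) \<and> (\<forall>a. \<forall>x\<in>X. a *\<^sub>C x \<in> X)"

definition clinear_on :: "'v::complex_vector set \<Rightarrow> ('v \<Rightarrow> 'w::complex_vector) \<Rightarrow> bool" where
  "clinear_on D f \<longleftrightarrow> csubspace D \<and> (\<forall>x\<in>D. \<forall>y\<in>D. f (x + y) = f x + f y) \<and>
    (\<forall>a. \<forall>x\<in>D. f (a *\<^sub>C x) = a *\<^sub>C f x)"

definition norm_on :: "'v::complex_vector set \<Rightarrow> ('v \<Rightarrow> real) \<Rightarrow> bool" where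
  "norm_on X N \<longleftrightarrow> csubspace X \<and> (\<forall>x\<in>X. 0 \<le> N x) \<and> (\<forall>x\<in>X. N x = 0 \<longleftrightarrow> x = 0) \<and>
    (\<forall>x\<in>X. \<forall>y\<in>X. N (x + y) \<le> N x + N y) \<and> (\<forall>a. \<forall>x\<in>X. N (a *\<^sub>C x) = cmod a * N x)"

definition equivalent_norms :: "'v set \<Rightarrow> ('v \<Rightarrow> real) \<Rightarrow> ('v \<Rightarrow> real) \<Rightarrow> bool" where
  "equivalent_norms X N N' \<longleftrightarrow>
    (\<exists>c>0. \<exists>C>0. \<forall>x\<in>X. c * N x \<le> N' x \<and> N' x \<le> C * N x)"

definition scalar_product_on ::
    "'v::complex_vector set \<Rightarrow> ('v \<Rightarrow> 'v \<Rightarrow> complex) \<Rightarrow> bool" where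
  "scalar_product_on X ip \<longleftrightarrow> csubspace X \<and>
    (\<forall>x\<in>X. \<forall>y\<in>X. ip x y = cnj (ip y x)) \<and>
    (\<forall>x\<in>X. \<forall>y\<in>X. \<forall>z\<in>X. ip x (y + z) = ip x y + ip x z) \<and>
    (\<forall>a. \<forall>x\<in>X. \<forall>y\<in>X. ip x (a *\<^sub>C y) = a * ip x y) \<and>
    (\<forall>x\<in>X. x \<noteq> 0 \<longrightarrow> 0 < Re (ip x x))"

definition ip_norm :: "('v \<Rightarrow> 'v \<Rightarrow> complex) \<Rightarrow> 'v \<Rightarrow> real" where
  "ip_norm ip x = sqrt (Re (ip x x))"

definition adjoint_graph ::
    "'v set \<Rightarrow> ('v \<Rightarrow> 'v \<Rightarrow> complex) \<Rightarrow> 'v set \<Rightarrow> ('v \<Rightarrow> 'v) \<Rightarrow> ('v \<times> 'v) set" where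
  "adjoint_graph X ip D A = {(y, z). y \<in> X \<and> z \<in> X \<and> (\<forall>x\<in>D. ip y (A x) = ip z x)}"

text \<open>Unbounded normal operators: densely defined, with \<open>D(A*) = D(A)\<close> and \<open>\<parallel>A* y\<parallel> = \<parallel>A y\<parallel>\<close>
  on this common domain.\<close>

definition normal_operator ::
    "'v::complex_vector set \<Rightarrow> ('v \<Rightarrow> 'v \<Rightarrow> complex) \<Rightarrow> 'v set \<Rightarrow> ('v \<Rightarrow> 'v) \<Rightarrow> bool" where
  "normal_operator X ip D A \<longleftrightarrow>
    scalar_product_on X ip \<and> D \<subseteq> X \<and> A ` D \<subseteq> X \<and> clinear_on D A \<and>
    (\<forall>x\<in>X. \<forall>e>0. \<exists>y\<in>D. ip_norm ip (x - y) < e) \<and>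
    Domain (adjoint_graph X ip D A) = D \<and>
    (\<forall>(y, z) \<in> adjoint_graph X ip D A. ip_norm ip z = ip_norm ip (A y))"

definition self_adjoint :: "'h::chilbert_space set \<Rightarrow> ('h \<Rightarrow> 'h) \<Rightarrow> bool" where
  "self_adjoint D L \<longleftrightarrow> clinear_on D L \<and> closure D = UNIV \<and>
    adjoint_graph UNIV cinner D L = {(x, L x) |x. x \<in> D}"

definition strictly_positive :: "'h::chilbert_space set \<Rightarrow> ('h \<Rightarrow> 'h) \<Rightarrow> bool" where
  "strictly_positive D L \<longleftrightarrow> (\<forall>x\<in>D. x \<noteq> 0 \<longrightarrow> 0 < Re (cinner x (L x)))"

definition compact_resolvent :: "'h::chilbert_space set \<Rightarrow> ('h \<Rightarrow> 'h) \<Rightarrow> bool" where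
  "compact_resolvent D L \<longleftrightarrow>
    (\<exists>z. bij_betw (\<lambda>x. L x - z *\<^sub>C x) D UNIV \<and>
      compact (closure (inv_into D (\<lambda>x. L x - z *\<^sub>C x) ` ball 0 1)))"

definition orthonormal_basis :: "(nat \<Rightarrow> 'h::chilbert_space) \<Rightarrow> bool" where
  "orthonormal_basis \<phi> \<longleftrightarrow>
    (\<forall>m n. cinner (\<phi> m) (\<phi> n) = (if m = n then 1 else 0)) \<and>
    (\<forall>u. (\<lambda>n. cinner (\<phi> n) u *\<^sub>C \<phi> n) sums u)"


section \<open>Strongly continuous groups\<close>

definition bounded_operator_on ::
    "'v::complex_vector set \<Rightarrow> ('v \<Rightarrow> real) \<Rightarrow> ('v \<Rightarrow> 'v) \<Rightarrow> bool" where
  "bounded_operator_on X N S \<longleftrightarrow>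
    clinear_on X S \<and> S ` X \<subseteq> X \<and> (\<exists>M. \<forall>x\<in>X. N (S x) \<le> M * N x)"

definition C0_group ::
    "'v::complex_vector set \<Rightarrow> ('v \<Rightarrow> real) \<Rightarrow> (real \<Rightarrow> 'v \<Rightarrow> 'v) \<Rightarrow> bool" where
  "C0_group X N T \<longleftrightarrow>
    (\<forall>t. bounded_operator_on X N (T t)) \<and>
    (\<forall>x\<in>X. T 0 x = x) \<and>
    (\<forall>s t. \<forall>x\<in>X. T (s + t) x = T s (T t x)) \<and>
    (\<forall>x\<in>X. ((\<lambda>t. N (T t x - x)) \<longlongrightarrow> 0) (at 0))"

definition generator_graph ::
    "'v::complex_vector set \<Rightarrow> ('v \<Rightarrow> real) \<Rightarrow> (real \<Rightarrow> 'v \<Rightarrow> 'v) \<Rightarrow> ('v \<times> 'v) set" where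
  "generator_graph X N T =
    {(x, y). x \<in> X \<and> y \<in> X \<and> ((\<lambda>t. N ((1 / t) *\<^sub>R (T t x - x) - y)) \<longlongrightarrow> 0) (at 0)}"

definition generates_C0_group ::
    "'v::complex_vector set \<Rightarrow> ('v \<Rightarrow> real) \<Rightarrow> 'v set \<Rightarrow> ('v \<Rightarrow> 'v) \<Rightarrow> (real \<Rightarrow> 'v \<Rightarrow> 'v) \<Rightarrow> bool" where
  "generates_C0_group X N D A T \<longleftrightarrow>
    C0_group X N T \<and> generator_graph X N T = {(x, A x) |x. x \<in> D}"

text \<open>Solutions of \<open>dU/dt = A U\<close> are the orbits of the group generated by \<open>A\<close>. Existence of the
  group is part of the definition, so every existence claim about solutions includes it.\<close>

definition solution ::
    "'v::complex_vector set \<Rightarrow> ('v \<Rightarrow> real) \<Rightarrow> 'v set \<Rightarrow> ('v \<Rightarrow> 'v) \<Rightarrow> (real \<Rightarrow> 'v) \<Rightarrow> bool" where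
  "solution X N D A U \<longleftrightarrow>
    (\<exists>T. generates_C0_group X N D A T \<and> U 0 \<in> X \<and> (\<forall>t. U t = T t (U 0)))"


section \<open>The phase spaces and the operator\<close>

text \<open>The eigenvalues \<open>\<mu>\<close> and eigenfunctions \<open>\<phi>\<close> of \<open>L\<close> are indexed from 0. The powers of \<open>L\<close> are
  given by the eigenfunction expansion.\<close>

definition dom_power :: "(nat \<Rightarrow> real) \<Rightarrow> (nat \<Rightarrow> 'h::chilbert_space) \<Rightarrow> real \<Rightarrow> 'h set" where
  "dom_power \<mu> \<phi> s = {u. summable (\<lambda>n. (\<mu> n powr s * cmod (cinner (\<phi> n) u))\<^sup>2)}"

definition L_power :: "(nat \<Rightarrow> real) \<Rightarrow> (nat \<Rightarrow> 'h::chilbert_space) \<Rightarrow> real \<Rightarrow> 'h \<Rightarrow> 'h" where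
  "L_power \<mu> \<phi> s u = (\<Sum>n. (complex_of_real (\<mu> n powr s) * cinner (\<phi> n) u) *\<^sub>C \<phi> n)"

datatype space_index = H1 | H2 | H3 | H4

fun exponents :: "space_index \<Rightarrow> real \<times> real \<times> real" where
  "exponents H1 = (1/2, 1/2, 0)"
| "exponents H2 = (1, 1, 1/2)"
| "exponents H3 = (1, 1/2, 0)"
| "exponents H4 = (3/2, 1, 1/2)"

definition phase_space ::
    "(nat \<Rightarrow> real) \<Rightarrow> (nat \<Rightarrow> 'h::chilbert_space) \<Rightarrow> space_index \<Rightarrow> ('h \<times> 'h \<times> 'h) set" where
  "phase_space \<mu> \<phi> i = (case exponents i of (p, q, r) \<Rightarrow>
    dom_power \<mu> \<phi> p \<times> dom_power \<mu> \<phi> q \<times> dom_power \<mu> \<phi> r)"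

definition phase_norm ::
    "(nat \<Rightarrow> real) \<Rightarrow> (nat \<Rightarrow> 'h::chilbert_space) \<Rightarrow> space_index \<Rightarrow> 'h \<times> 'h \<times> 'h \<Rightarrow> real" where
  "phase_norm \<mu> \<phi> i = (\<lambda>(u, v, w). case exponents i of (p, q, r) \<Rightarrow>
    sqrt ((norm (L_power \<mu> \<phi> p u))\<^sup>2 + (norm (L_power \<mu> \<phi> q v))\<^sup>2 + (norm (L_power \<mu> \<phi> r w))\<^sup>2))"

definition op_A :: "real \<Rightarrow> real \<Rightarrow> (nat \<Rightarrow> real) \<Rightarrow> (nat \<Rightarrow> 'h::chilbert_space) \<Rightarrow>
    'h \<times> 'h \<times> 'h \<Rightarrow> 'h \<times> 'h \<times> 'h" where
  "op_A \<alpha> \<beta> \<mu> \<phi> = (\<lambda>(u, v, w).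
    (v, w, - ((1 / \<alpha>) *\<^sub>R L_power \<mu> \<phi> 1 (u + \<beta> *\<^sub>R v)) - (1 / \<alpha>) *\<^sub>R w))"

text \<open>The last component of every phase space consists of elements of \<open>H\<close>. Hence the expansion of
  \<open>L(u + \<beta> v)\<close> can only contribute to an element of the phase space if its coefficients are square
  summable, that is, if \<open>u + \<beta> v \<in> D(L)\<close>.\<close>

definition dom_A :: "real \<Rightarrow> real \<Rightarrow> (nat \<Rightarrow> real) \<Rightarrow> (nat \<Rightarrow> 'h::chilbert_space) \<Rightarrow> space_index \<Rightarrow>
    ('h \<times> 'h \<times> 'h) set" where
  "dom_A \<alpha> \<beta> \<mu> \<phi> i = {(u, v, w). (u, v, w) \<in> phase_space \<mu> \<phi> i \<and>
    u + \<beta> *\<^sub>R v \<in> dom_power \<mu> \<phi> 1 \<and> op_A \<alpha> \<beta> \<mu> \<phi> (u, v, w) \<in> phase_space \<mu> \<phi> i}"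


section \<open>Characteristic roots\<close>

definition char_root :: "real \<Rightarrow> real \<Rightarrow> real \<Rightarrow> complex \<Rightarrow> bool" where
  "char_root \<alpha> \<beta> m z \<longleftrightarrow>
    complex_of_real \<alpha> * z ^ 3 + z ^ 2 + complex_of_real (\<beta> * m) * z + complex_of_real m = 0"

definition sigma_max :: "real \<Rightarrow> real \<Rightarrow> (nat \<Rightarrow> real) \<Rightarrow> real" where
  "sigma_max \<alpha> \<beta> \<mu> = Sup {Re z |z n. char_root \<alpha> \<beta> (\<mu> n) z}"

definition const_C1 :: "real \<Rightarrow> real \<Rightarrow> real" where
  "const_C1 \<alpha> \<beta> = 27 - 18 * (\<beta> / \<alpha>) - (\<beta> / \<alpha>)\<^sup>2"

definition const_C2 :: "real \<Rightarrow> real \<Rightarrow> real" where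
  "const_C2 \<alpha> \<beta> = (const_C1 \<alpha> \<beta>)\<^sup>2 - 64 * (\<beta> / \<alpha>) ^ 3"

definition const_m1 :: "real \<Rightarrow> real \<Rightarrow> complex" where
  "const_m1 \<alpha> \<beta> = complex_of_real \<alpha> *
    (- complex_of_real (const_C1 \<alpha> \<beta>) - csqrt (complex_of_real (const_C2 \<alpha> \<beta>))) /
    complex_of_real (8 * \<beta> ^ 3)"

definition const_m2 :: "real \<Rightarrow> real \<Rightarrow> complex" where
  "const_m2 \<alpha> \<beta> = complex_of_real \<alpha> *
    (- complex_of_real (const_C1 \<alpha> \<beta>) + csqrt (complex_of_real (const_C2 \<alpha> \<beta>))) /
    complex_of_real (8 * \<beta> ^ 3)"


section \<open>The scalar product making the operator normal\<close>

definition weight_O :: "space_index \<Rightarrow> real \<Rightarrow> real ^ 3" where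
  "weight_O i m = (case i of
      H1 \<Rightarrow> vector [m, m, 1]
    | H2 \<Rightarrow> m *\<^sub>R vector [m, m, 1]
    | H3 \<Rightarrow> vector [m\<^sup>2, m, 1]
    | H4 \<Rightarrow> m *\<^sub>R vector [m\<^sup>2, m, 1])"

text \<open>An enumeration of the three roots, meaningful only if these are distinct. Permuting the roots
  permutes the columns of \<open>mat_C\<close> and leaves \<open>mat_G\<close> unchanged.\<close>

definition roots_enum :: "real \<Rightarrow> real \<Rightarrow> real \<Rightarrow> 3 \<Rightarrow> complex" where
  "roots_enum \<alpha> \<beta> m = (SOME l. inj l \<and> range l = {z. char_root \<alpha> \<beta> m z})"

definition eigvec :: "space_index \<Rightarrow> real \<Rightarrow> complex \<Rightarrow> complex ^ 3" where
  "eigvec i m z = (let x = vector [1, z, z\<^sup>2] :: complex ^ 3;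
      c = sqrt (\<Sum>k\<in>UNIV. weight_O i m $ k * (cmod (x $ k))\<^sup>2)
    in (\<chi> k. x $ k / complex_of_real c))"

definition mat_C :: "real \<Rightarrow> real \<Rightarrow> space_index \<Rightarrow> real \<Rightarrow> complex ^ 3 ^ 3" where
  "mat_C \<alpha> \<beta> i m = (\<chi> k j. eigvec i m (roots_enum \<alpha> \<beta> m j) $ k)"

definition mat_G :: "real \<Rightarrow> real \<Rightarrow> space_index \<Rightarrow> real \<Rightarrow> complex ^ 3 ^ 3" where
  "mat_G \<alpha> \<beta> i m = (let B = matrix_inv (mat_C \<alpha> \<beta> i m)
    in transpose (\<chi> k j. cnj (B $ k $ j)) ** B)"

text \<open>The component in \<open>E\<^sub>n\<close>, in coordinates.\<close>

definition coords :: "'h::chilbert_space \<Rightarrow> 'h \<times> 'h \<times> 'h \<Rightarrow> complex ^ 3" where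
  "coords e = (\<lambda>(u, v, w). vector [cinner e u, cinner e v, cinner e w])"

definition ip_G :: "real \<Rightarrow> real \<Rightarrow> (nat \<Rightarrow> real) \<Rightarrow> (nat \<Rightarrow> 'h::chilbert_space) \<Rightarrow> space_index \<Rightarrow>
    'h \<times> 'h \<times> 'h \<Rightarrow> 'h \<times> 'h \<times> 'h \<Rightarrow> complex" where
  "ip_G \<alpha> \<beta> \<mu> \<phi> i U V =
    (\<Sum>n. \<Sum>k\<in>UNIV. cnj (coords (\<phi> n) U $ k) * (mat_G \<alpha> \<beta> i (\<mu> n) *v coords (\<phi> n) V) $ k)"

abbreviation norm_G :: "real \<Rightarrow> real \<Rightarrow> (nat \<Rightarrow> real) \<Rightarrow> (nat \<Rightarrow> 'h::chilbert_space) \<Rightarrow> space_index \<Rightarrow>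
    'h \<times> 'h \<times> 'h \<Rightarrow> real" where
  "norm_G \<alpha> \<beta> \<mu> \<phi> i \<equiv> ip_norm (ip_G \<alpha> \<beta> \<mu> \<phi> i)"

abbreviation solution_A :: "real \<Rightarrow> real \<Rightarrow> (nat \<Rightarrow> real) \<Rightarrow> (nat \<Rightarrow> 'h::chilbert_space) \<Rightarrow>
    space_index \<Rightarrow> (real \<Rightarrow> 'h \<times> 'h \<times> 'h) \<Rightarrow> bool" where
  "solution_A \<alpha> \<beta> \<mu> \<phi> i \<equiv>
    solution (phase_space \<mu> \<phi> i) (phase_norm \<mu> \<phi> i) (dom_A \<alpha> \<beta> \<mu> \<phi> i) (op_A \<alpha> \<beta> \<mu> \<phi>)"

abbreviation normal_A :: "real \<Rightarrow> real \<Rightarrow> (nat \<Rightarrow> real) \<Rightarrow> (nat \<Rightarrow> 'h::chilbert_space) \<Rightarrow>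
    space_index \<Rightarrow> ('h \<times> 'h \<times> 'h \<Rightarrow> 'h \<times> 'h \<times> 'h \<Rightarrow> complex) \<Rightarrow> bool" where
  "normal_A \<alpha> \<beta> \<mu> \<phi> i ip \<equiv>
    normal_operator (phase_space \<mu> \<phi> i) ip (dom_A \<alpha> \<beta> \<mu> \<phi> i) (op_A \<alpha> \<beta> \<mu> \<phi>)"

end

theory Submission
  imports Defs "HOL-Complex_Analysis.Cauchy_Integral_Theorem"
begin

text \<open>In the coordinates of the basis \<open>\<phi>\<close> the operator \<open>A\<close> is block diagonal; the block of index \<open>n\<close> is
  the companion matrix of \<open>\<alpha> z\<^sup>3 + z\<^sup>2 + \<beta> (\<mu> n) z + \<mu> n\<close>. It suffices to renorm all blocks,
  uniformly in \<open>n\<close>, so that in each block the numerical range of the companion matrix has real parts at most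
  \<open>\<sigma>\<close>, the spectral bound \<open>sigma_max \<alpha> \<beta> \<mu>\<close>. The energy estimate \<open>energy_estimate\<close> then gives the decay
  block by block, without any constant in front of the exponential. Optimality holds because \<open>\<sigma>\<close> is a supremum of real parts of
  eigenvalues, and an eigenvector is the initial value of a solution that decays exactly with the real part of
  its eigenvalue (\<open>growing_solution\<close>).

  A block with distinct roots is diagonal in eigenvector coordinates. Their norm is the norm of the
  scalar product \<open>ip_G\<close>, and there the numerical range is the convex hull of the roots. When all blocks
  are of this kind, \<open>A\<close> is unitarily equivalent to a diagonal operator and therefore normal
  (\<open>normal_diagonal\<close>).

  A repeated root forces all three roots of its block to be real. Every real root lies in the open
  interval from \<open>-1/\<alpha>\<close> to \<open>-1/\<beta>\<close>, whereas the real roots of the blocks converge to \<open>-1/\<beta>\<close> as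
  \<open>n\<close> tends to infinity, so that \<open>-1/\<beta> \<le> \<sigma>\<close> (\<open>sigma_max_lower\<close>). Hence a repeated root is never dominant: there
  is a gap between the roots of its block and \<open>\<sigma>\<close>. In suitably scaled Newton coordinates the block is
  bidiagonal with an off-diagonal entry at most as large as the gap, which is enough for the energy estimate
  (\<open>block_exists\<close>). On the other hand such a block contains a Jordan block, which a normal operator cannot
  have (\<open>normal_operator_no_jordan_block\<close>).

  Equivalence of the new norm with the natural one has to be checked only for large \<open>n\<close>
  (\<open>uniform_block_bounds\<close>). There Vieta's formulas locate the roots explicitly: one of them is real and
  bounded, the other two are conjugate and of size \<open>sqrt (\<mu> n)\<close> with imaginary parts of the same size
  (\<open>large_root\<close>). So the eigenvectors stay uniformly linearly independent in the weighted norms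
  (\<open>eigen_coordinate_bound\<close>).

  The abstract part on block diagonal operators is the locale \<open>block_system\<close>. It also contains the
  construction of the group, which is part of the notion of a solution.\<close>

section \<open>Square-summable sequences\<close>

lemma summable_norm_square_add:
  fixes f g :: "nat \<Rightarrow> 'a::real_normed_vector"
  assumes "summable (\<lambda>n. (norm (f n))\<^sup>2)" and "summable (\<lambda>n. (norm (g n))\<^sup>2)"
  shows "summable (\<lambda>n. (norm (f n + g n))\<^sup>2)"
proof (rule summable_comparison_test')
  show "summable (\<lambda>n. 2 * (norm (f n))\<^sup>2 + 2 * (norm (g n))\<^sup>2)"
    by (intro summable_add summable_mult assms)
  fix n
  have "(norm (f n + g n))\<^sup>2 \<le> (norm (f n) + norm (g n))\<^sup>2"
    by (intro power_mono norm_triangle_ineq) auto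
  also have "\<dots> \<le> 2 * (norm (f n))\<^sup>2 + 2 * (norm (g n))\<^sup>2"
    using sum_squares_bound[of "norm (f n)" "norm (g n)"] by (simp add: power2_sum)
  finally show "norm ((norm (f n + g n))\<^sup>2) \<le> 2 * (norm (f n))\<^sup>2 + 2 * (norm (g n))\<^sup>2"
    by simp
qed

lemma summable_norm_square_le:
  fixes f :: "nat \<Rightarrow> 'a::real_normed_vector" and g :: "nat \<Rightarrow> 'b::real_normed_vector"
  assumes "summable (\<lambda>n. (norm (g n))\<^sup>2)" and "\<And>n. norm (f n) \<le> C * norm (g n)"
  shows "summable (\<lambda>n. (norm (f n))\<^sup>2)"
proof (rule summable_comparison_test')
  show "summable (\<lambda>n. C\<^sup>2 * (norm (g n))\<^sup>2)"
    by (intro summable_mult assms)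
  show "norm ((norm (f n))\<^sup>2) \<le> C\<^sup>2 * (norm (g n))\<^sup>2" for n
    using power_mono[OF assms(2)[of n], of 2] by (simp add: power_mult_distrib)
qed

text \<open>Minkowski's inequality, obtained from the finite one by passing to the limit.\<close>

lemma sqrt_suminf_norm_square_add:
  fixes f g :: "nat \<Rightarrow> 'a::real_normed_vector"
  assumes "summable (\<lambda>n. (norm (f n))\<^sup>2)" and "summable (\<lambda>n. (norm (g n))\<^sup>2)"
  shows "sqrt (\<Sum>n. (norm (f n + g n))\<^sup>2)
    \<le> sqrt (\<Sum>n. (norm (f n))\<^sup>2) + sqrt (\<Sum>n. (norm (g n))\<^sup>2)"
proof (rule LIMSEQ_le)
  show "(\<lambda>k. sqrt (\<Sum>n<k. (norm (f n + g n))\<^sup>2)) \<longlonglongrightarrow> sqrt (\<Sum>n. (norm (f n + g n))\<^sup>2)"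
    by (intro tendsto_real_sqrt summable_LIMSEQ summable_norm_square_add assms)
  show "(\<lambda>k. sqrt (\<Sum>n<k. (norm (f n))\<^sup>2) + sqrt (\<Sum>n<k. (norm (g n))\<^sup>2))
    \<longlonglongrightarrow> sqrt (\<Sum>n. (norm (f n))\<^sup>2) + sqrt (\<Sum>n. (norm (g n))\<^sup>2)"
    by (intro tendsto_add tendsto_real_sqrt summable_LIMSEQ assms)
  have "sqrt (\<Sum>n<k. (norm (f n + g n))\<^sup>2)
      \<le> sqrt (\<Sum>n<k. (norm (f n))\<^sup>2) + sqrt (\<Sum>n<k. (norm (g n))\<^sup>2)" for k
  proof -
    have "L2_set (\<lambda>n. norm (f n + g n)) {..<k} \<le> L2_set (\<lambda>n. norm (f n) + norm (g n)) {..<k}"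
      by (intro L2_set_mono norm_triangle_ineq) auto
    also have "\<dots> \<le> L2_set (\<lambda>n. norm (f n)) {..<k} + L2_set (\<lambda>n. norm (g n)) {..<k}"
      by (rule L2_set_triangle_ineq)
    finally show ?thesis by (simp add: L2_set_def)
  qed
  then show "\<exists>N. \<forall>n\<ge>N. sqrt (\<Sum>n<n. (norm (f n + g n))\<^sup>2)
      \<le> sqrt (\<Sum>n<n. (norm (f n))\<^sup>2) + sqrt (\<Sum>n<n. (norm (g n))\<^sup>2)" by blast
qed

text \<open>Dominated convergence: \<open>g\<close> controls the tail of the series uniformly in \<open>t\<close>, and the finitely many
  remaining terms tend to zero one by one.\<close>

lemma tendsto_suminf_zero_dominated:
  fixes f :: "'a \<Rightarrow> nat \<Rightarrow> real"
  assumes g: "summable g"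
    and dom: "\<forall>\<^sub>F t in F. \<forall>n. 0 \<le> f t n \<and> f t n \<le> g n"
    and lim: "\<And>n. ((\<lambda>t. f t n) \<longlongrightarrow> 0) F"
  shows "((\<lambda>t. \<Sum>n. f t n) \<longlongrightarrow> 0) F"
proof (rule tendstoI)
  fix e :: real assume "0 < e"
  then obtain k where k: "\<bar>\<Sum>n. g (n + k)\<bar> < e / 2"
    using suminf_exist_split[of "e / 2" g] g by auto
  have "((\<lambda>t. \<Sum>n<k. f t n) \<longlongrightarrow> (\<Sum>n<k. 0)) F"
    by (intro tendsto_sum lim)
  then have "\<forall>\<^sub>F t in F. \<bar>\<Sum>n<k. f t n\<bar> < e / 2"
    using \<open>0 < e\<close> by (auto simp: tendsto_iff dist_real_def dest: spec[of _ "e / 2"])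
  with dom show "\<forall>\<^sub>F t in F. dist (\<Sum>n. f t n) 0 < e"
  proof eventually_elim
    case (elim t)
    have s: "summable (f t)"
      by (rule summable_comparison_test'[OF g, of 0]) (use elim in auto)
    have "(\<Sum>n. f t n) = (\<Sum>n. f t (n + k)) + (\<Sum>n<k. f t n)"
      by (rule suminf_split_initial_segment[OF s])
    moreover have "(\<Sum>n. f t (n + k)) \<le> (\<Sum>n. g (n + k))"
      by (intro suminf_le summable_ignore_initial_segment s g) (use elim in auto)
    moreover have "0 \<le> (\<Sum>n. f t n)" using elim s by (intro suminf_nonneg) auto
    ultimately show ?case using elim k by (simp add: dist_real_def)
  qed
qed


section \<open>Complex Hilbert spaces\<close>

lemma scaleC_zero_left [simp]: "0 *\<^sub>C (x::'a::complex_vector) = 0"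
  using scaleC_of_real[of 0 x] by simp

lemma scaleC_minus_one: "(-1) *\<^sub>C (x::'a::complex_vector) = - x"
  using scaleC_of_real[of "-1" x] by simp

lemma cinner_zero_right [simp]: "cinner x (0::'h::chilbert_space) = 0"
  using cinner_add_right[of x 0 0] by simp

lemma cinner_minus_right [simp]: "cinner x (- y::'h::chilbert_space) = - cinner x y"
  using cinner_scaleC_right[of x "-1" y] by (simp add: scaleC_minus_one)

lemma cinner_diff_right: "cinner x (y - z::'h::chilbert_space) = cinner x y - cinner x z"
  using cinner_add_right[of x y "- z"] by simp

lemma cinner_scaleR_right [simp]: "cinner x (r *\<^sub>R y::'h::chilbert_space) = of_real r * cinner x y"
  using cinner_scaleC_right[of x "of_real r" y] by (simp add: scaleC_of_real)

lemma cinner_scaleC_left: "cinner (a *\<^sub>C x) (y::'h::chilbert_space) = cnj a * cinner x y"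
  by (metis cinner_commute cinner_scaleC_right complex_cnj_mult)

lemma cinner_sum_right: "cinner x (sum f A) = (\<Sum>a\<in>A. cinner x (f a::'h::chilbert_space))"
  by (induction A rule: infinite_finite_induct) (auto simp: cinner_add_right)

instance chilbert_space \<subseteq> banach ..

text \<open>Continuity of the complex scalar product is inherited from the real one, since
  \<open>Im (cinner x y)\<close> is the real scalar product of \<open>\<i> x\<close> and \<open>y\<close>.\<close>

lemma bounded_linear_cinner_right: "bounded_linear (cinner (x::'h::chilbert_space))"
proof -
  have "cinner x = (\<lambda>y. complex_of_real (inner x y) + \<i> * complex_of_real (inner (\<i> *\<^sub>C x) y))"
    by (auto simp: fun_eq_iff complex_eq_iff inner_eq_Re_cinner cinner_scaleC_left)
  moreover have "bounded_linear \<dots>"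
    by (intro bounded_linear_add bounded_linear_const_mult bounded_linear_compose[OF bounded_linear_of_real]
        bounded_linear_inner_right)
  ultimately show ?thesis by simp
qed

context
  fixes \<phi> :: "nat \<Rightarrow> 'h::chilbert_space"
  assumes onb: "orthonormal_basis \<phi>"
begin

lemma cinner_basis: "cinner (\<phi> m) (\<phi> n) = (if m = n then 1 else 0)"
  using onb by (simp add: orthonormal_basis_def)

lemma onb_expansion: "(\<lambda>n. cinner (\<phi> n) u *\<^sub>C \<phi> n) sums u"
  using onb by (simp add: orthonormal_basis_def)

lemma norm_square_sum_basis:
  assumes "finite S"
  shows "(norm (\<Sum>n\<in>S. a n *\<^sub>C \<phi> n))\<^sup>2 = (\<Sum>n\<in>S. (cmod (a n))\<^sup>2)"
proof -
  have c: "cinner (\<phi> m) (\<Sum>n\<in>S. a n *\<^sub>C \<phi> n) = (if m \<in> S then a m else 0)" for m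
    using assms by (simp add: cinner_sum_right cinner_scaleC_right cinner_basis if_distrib cong: if_cong)
  let ?s = "\<Sum>n\<in>S. a n *\<^sub>C \<phi> n"
  have "cinner ?s ?s = (\<Sum>n\<in>S. a n * cinner ?s (\<phi> n))"
    by (simp add: cinner_sum_right cinner_scaleC_right)
  also have "\<dots> = (\<Sum>n\<in>S. a n * cnj (a n))"
    by (intro sum.cong refl) (subst cinner_commute, simp add: c)
  also have "\<dots> = (\<Sum>n\<in>S. complex_of_real ((cmod (a n))\<^sup>2))"
    by (intro sum.cong refl) (metis complex_norm_square)
  finally show ?thesis
    by (simp add: power2_norm_eq_inner inner_eq_Re_cinner)
qed

lemma parseval:
  "(\<lambda>n. (cmod (cinner (\<phi> n) u))\<^sup>2) sums (norm u)\<^sup>2"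
proof -
  have "(\<lambda>k. (norm (\<Sum>n<k. cinner (\<phi> n) u *\<^sub>C \<phi> n))\<^sup>2) \<longlonglongrightarrow> (norm u)\<^sup>2"
    using onb_expansion[of u] unfolding sums_def by (intro tendsto_intros)
  then show ?thesis by (simp add: norm_square_sum_basis sums_def)
qed

lemma basis_eqI:
  assumes "\<And>n. cinner (\<phi> n) u = cinner (\<phi> n) v"
  shows "u = v"
  using onb_expansion[of u] onb_expansion[of v] assms sums_unique2 by simp

lemma riesz_fischer:
  assumes "summable (\<lambda>n. (cmod (a n))\<^sup>2)"
  shows "cinner (\<phi> n) (\<Sum>k. a k *\<^sub>C \<phi> k) = a n"
proof -
  have "summable (\<lambda>k. a k *\<^sub>C \<phi> k)"
  proof (subst summable_Cauchy, intro allI impI)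
    fix e :: real assume e: "0 < e"
    then obtain N where N: "\<And>m n. m \<ge> N \<Longrightarrow> norm (\<Sum>k=m..<n. (cmod (a k))\<^sup>2) < e\<^sup>2"
      using assms unfolding summable_Cauchy by (meson zero_less_power)
    have "norm (\<Sum>k=m..<n. a k *\<^sub>C \<phi> k) < e" if "m \<ge> N" for m n
    proof -
      have "(norm (\<Sum>k=m..<n. a k *\<^sub>C \<phi> k))\<^sup>2 < e\<^sup>2"
        using N[OF that, of n] by (simp add: norm_square_sum_basis)
      then show ?thesis using e by (simp add: power2_less_imp_less)
    qed
    then show "\<exists>N. \<forall>m\<ge>N. \<forall>n. norm (\<Sum>k=m..<n. a k *\<^sub>C \<phi> k) < e" by blast
  qed
  then have "(\<lambda>k. cinner (\<phi> n) (a k *\<^sub>C \<phi> k)) sums cinner (\<phi> n) (\<Sum>k. a k *\<^sub>C \<phi> k)"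
    by (intro bounded_linear.sums[OF bounded_linear_cinner_right] summable_sums)
  moreover have "(\<lambda>k. cinner (\<phi> n) (a k *\<^sub>C \<phi> k)) sums a n"
    using sums_single[of n a] 
    by (simp add: cinner_scaleC_right cinner_basis if_distrib eq_commute cong: if_cong)
  ultimately show ?thesis by (rule sums_unique2)
qed

lemma cinner_L_power:
  assumes "u \<in> dom_power \<mu> \<phi> s"
  shows "cinner (\<phi> n) (L_power \<mu> \<phi> s u) = complex_of_real (\<mu> n powr s) * cinner (\<phi> n) u"
  unfolding L_power_def
  by (rule riesz_fischer) (use assms in \<open>simp add: dom_power_def norm_mult\<close>)

lemma norm_L_power:
  assumes "u \<in> dom_power \<mu> \<phi> s"
  shows "(\<lambda>n. (\<mu> n powr s * cmod (cinner (\<phi> n) u))\<^sup>2) sums (norm (L_power \<mu> \<phi> s u))\<^sup>2"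
  using parseval[of "L_power \<mu> \<phi> s u"] by (simp add: cinner_L_power[OF assms] norm_mult)

end


section \<open>The roots of the characteristic equation\<close>

text \<open>The three roots with their multiplicities, which the set of zeros does not record.\<close>

definition vieta :: "real \<Rightarrow> real \<Rightarrow> real \<Rightarrow> complex \<Rightarrow> complex \<Rightarrow> complex \<Rightarrow> bool" where
  "vieta \<alpha> \<beta> m a b c \<longleftrightarrow> a + b + c = of_real (- 1 / \<alpha>) \<and> a * b + a * c + b * c = of_real (\<beta> * m / \<alpha>) \<and>
    a * b * c = of_real (- m / \<alpha>)"

context
  fixes \<alpha> \<beta> m :: real
  assumes \<alpha>: "0 < \<alpha>" and \<beta>: "\<alpha> < \<beta>" and m: "0 < m"
begin

lemma real_char_root_iff:
  "char_root \<alpha> \<beta> m (of_real r) \<longleftrightarrow> r\<^sup>2 * (\<alpha> * r + 1) + m * (\<beta> * r + 1) = 0"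
proof -
  have "complex_of_real \<alpha> * of_real r ^ 3 + of_real r ^ 2 + of_real (\<beta> * m) * of_real r + of_real m
      = of_real (r\<^sup>2 * (\<alpha> * r + 1) + m * (\<beta> * r + 1))"
    by (simp add: algebra_simps power2_eq_square power3_eq_cube)
  then show ?thesis unfolding char_root_def by (simp only: of_real_eq_0_iff)
qed

text \<open>Outside the interval the terms \<open>\<alpha> r + 1\<close> and \<open>\<beta> r + 1\<close> have the same sign, so they
  cannot balance.\<close>

lemma real_char_root_bounds:
  assumes "char_root \<alpha> \<beta> m (of_real r)"
  shows "-1/\<alpha> < r" "r < -1/\<beta>"
proof -
  have eq: "r\<^sup>2 * (\<alpha> * r + 1) + m * (\<beta> * r + 1) = 0" using assms by (simp add: real_char_root_iff)
  show "-1/\<alpha> < r"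
  proof (rule ccontr)
    assume "\<not> ?thesis"
    then have 1: "\<alpha> * r + 1 \<le> 0" using \<alpha> by (simp add: field_simps)
    then have "r < 0" using \<alpha> by (smt (verit) mult_nonneg_nonneg)
    then have "\<beta> * r + 1 < \<alpha> * r + 1" using \<beta> by simp
    then have "m * (\<beta> * r + 1) < 0" using 1 m by (simp add: mult_less_0_iff)
    moreover have "r\<^sup>2 * (\<alpha> * r + 1) \<le> 0" using 1 by (simp add: mult_le_0_iff)
    ultimately show False using eq by linarith
  qed
  show "r < -1/\<beta>"
  proof (rule ccontr)
    assume "\<not> ?thesis"
    then have 1: "0 \<le> \<beta> * r + 1" using \<alpha> \<beta> by (simp add: field_simps)
    have 2: "0 < \<alpha> * r + 1"
    proof (cases "r < 0")
      case True
      then have "\<beta> * r < \<alpha> * r" using \<beta> by simp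
      then show ?thesis using 1 by linarith
    next
      case False
      then have "0 \<le> \<alpha> * r" using \<alpha> by simp
      then show ?thesis by linarith
    qed
    have "r \<noteq> 0" using eq m by auto
    then have "0 < r\<^sup>2 * (\<alpha> * r + 1)" using 2 by simp
    moreover have "0 \<le> m * (\<beta> * r + 1)" using 1 m by simp
    ultimately show False using eq by linarith
  qed
qed

lemma real_char_root_exists: "\<exists>r. char_root \<alpha> \<beta> m (of_real r)"
proof -
  let ?f = "\<lambda>r. r\<^sup>2 * (\<alpha> * r + 1) + m * (\<beta> * r + 1)"
  have "\<exists>r. -1/\<alpha> \<le> r \<and> r \<le> -1/\<beta> \<and> ?f r = 0"
  proof (rule IVT')
    have "1 \<le> \<beta> / \<alpha>" using \<alpha> \<beta> by simp
    then have "m * (1 - \<beta> / \<alpha>) \<le> 0" using m by (simp add: mult_le_0_iff)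
    then show "?f (-1/\<alpha>) \<le> 0" using \<alpha> by simp
    have "\<alpha> / \<beta> \<le> 1" using \<alpha> \<beta> by simp
    then show "0 \<le> ?f (-1/\<beta>)" using \<alpha> \<beta> by simp
    show "-1/\<alpha> \<le> -1/\<beta>" using \<alpha> \<beta> by (simp add: field_simps)
    show "continuous_on {-1/\<alpha>..-1/\<beta>} ?f" by (intro continuous_intros)
  qed
  then show ?thesis by (auto simp: real_char_root_iff)
qed

lemma vieta_factor:
  assumes "vieta \<alpha> \<beta> m a b c"
  shows "of_real \<alpha> * z ^ 3 + z ^ 2 + of_real (\<beta> * m) * z + of_real m
    = of_real \<alpha> * ((z - a) * (z - b) * (z - c))"
proof -
  have "(z - a) * (z - b) * (z - c)
      = z ^ 3 - (a + b + c) * z\<^sup>2 + (a * b + a * c + b * c) * z - a * b * c"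
    by (simp add: algebra_simps power2_eq_square power3_eq_cube)
  also have "\<dots> = z ^ 3 - of_real (- 1 / \<alpha>) * z\<^sup>2 + of_real (\<beta> * m / \<alpha>) * z - of_real (- m / \<alpha>)"
    using assms by (simp only: vieta_def)
  also have "of_real \<alpha> * \<dots> = of_real \<alpha> * z ^ 3 + z ^ 2 + of_real (\<beta> * m) * z + of_real m"
    using \<alpha> by (simp add: field_simps)
  finally show ?thesis by simp
qed

lemma vieta_char_root:
  assumes "vieta \<alpha> \<beta> m a b c"
  shows "char_root \<alpha> \<beta> m z \<longleftrightarrow> z = a \<or> z = b \<or> z = c"
  using \<alpha> unfolding char_root_def vieta_factor[OF assms] by simp

text \<open>Dividing by the linear factor of a real root leaves a real quadratic polynomial.\<close>

lemma vieta_exists: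
  assumes r: "char_root \<alpha> \<beta> m (of_real r)"
  shows "\<exists>z w. vieta \<alpha> \<beta> m (of_real r) z w \<and> (z \<in> \<real> \<and> w \<in> \<real> \<or> Im z \<noteq> 0 \<and> w = cnj z)"
proof -
  have "r \<noteq> 0" using real_char_root_bounds[OF r] \<alpha> \<beta> by auto
  define p where "p = - (1 / \<alpha> + r)"
  define q where "q = - m / (\<alpha> * r)"
  define d where "d = p\<^sup>2 / 4 - q"
  define s where "s = csqrt (of_real d)"
  define z where "z = of_real (p / 2) + s"
  define w where "w = of_real (p / 2) - s"
  have s2: "s\<^sup>2 = of_real d" by (simp add: s_def)
  have zw: "z + w = of_real p" by (simp add: z_def w_def)
  have "z * w = of_real (p/2) ^ 2 - s\<^sup>2"
    by (simp add: z_def w_def power2_eq_square algebra_simps)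
  also have "\<dots> = of_real q" by (simp add: s2 d_def power_divide)
  finally have zw': "z * w = of_real q" .
  have eq: "r\<^sup>2 * (\<alpha> * r + 1) + m * (\<beta> * r + 1) = 0" using r by (simp add: real_char_root_iff)
  have "r * p + q = \<beta> * m / \<alpha>"
  proof -
    have "\<alpha> * r * (r * p + q) = - (r\<^sup>2 * (\<alpha> * r + 1) + m * (\<beta> * r + 1)) + \<beta> * m * r"
      using \<alpha> \<open>r \<noteq> 0\<close> by (simp add: p_def q_def field_simps power2_eq_square)
    then have "\<alpha> * r * (r * p + q) = \<beta> * m * r" by (simp only: eq)
    then have "(r * p + q) * \<alpha> * r = \<beta> * m * r" by (simp only: mult.commute mult.left_commute)
    then have "(r * p + q) * \<alpha> = \<beta> * m" using \<open>r \<noteq> 0\<close> by simp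
    then show ?thesis using \<alpha> by (simp add: eq_divide_eq)
  qed
  moreover have "r + p = - 1 / \<alpha>" by (simp add: p_def)
  moreover have "r * q = - m / \<alpha>" using \<open>r \<noteq> 0\<close> \<alpha> by (simp add: q_def field_simps)
  ultimately have "vieta \<alpha> \<beta> m (of_real r) z w"
    unfolding vieta_def using zw zw'
    by (metis (no_types, lifting) add.assoc distrib_left mult.assoc of_real_add of_real_mult)
  moreover have "z \<in> \<real> \<and> w \<in> \<real> \<or> Im z \<noteq> 0 \<and> w = cnj z"
  proof (cases "0 \<le> d")
    case True
    then have "s = of_real (sqrt d)" by (simp add: s_def csqrt_of_real_nonneg)
    then show ?thesis by (simp add: z_def w_def)
  next
    case False
    then have "s = \<i> * of_real (sqrt (- d))" by (simp add: s_def csqrt_of_real_nonpos)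
    then show ?thesis using False by (simp add: z_def w_def complex_eq_iff)
  qed
  ultimately show ?thesis by blast
qed

lemma nonreal_char_root:
  assumes z: "char_root \<alpha> \<beta> m z" and im: "Im z \<noteq> 0"
  obtains r where "char_root \<alpha> \<beta> m (of_real r)" "vieta \<alpha> \<beta> m (of_real r) z (cnj z)"
    "2 * Re z = - 1 / \<alpha> - r" "(cmod z)\<^sup>2 * r = - m / \<alpha>"
proof -
  obtain r where r: "char_root \<alpha> \<beta> m (of_real r)" using real_char_root_exists by blast
  obtain a b where ab: "vieta \<alpha> \<beta> m (of_real r) a b" "a \<in> \<real> \<and> b \<in> \<real> \<or> Im a \<noteq> 0 \<and> b = cnj a"
    using vieta_exists[OF r] by blast
  have "z = of_real r \<or> z = a \<or> z = b" using vieta_char_root[OF ab(1)] z by simp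
  moreover have "z \<notin> \<real>" using im complex_is_Real_iff by blast
  ultimately have "z = a \<or> z = b" "b = cnj a" using ab(2) by (metis Reals_of_real)+
  moreover have "vieta \<alpha> \<beta> m (of_real r) b a" using ab(1) by (simp add: vieta_def algebra_simps)
  ultimately have v: "vieta \<alpha> \<beta> m (of_real r) z (cnj z)" using ab(1) by (metis complex_cnj_cnj)
  have "Re (of_real r + z + cnj z) = - 1 / \<alpha>" using v by (simp add: vieta_def)
  then have 1: "2 * Re z = - 1 / \<alpha> - r" by simp
  have "of_real r * z * cnj z = of_real (- m / \<alpha>)" using v by (simp add: vieta_def)
  moreover have "of_real r * z * cnj z = of_real ((cmod z)\<^sup>2 * r)"
    by (metis complex_norm_square mult.assoc mult.commute of_real_mult of_real_power)
  ultimately have 2: "(cmod z)\<^sup>2 * r = - m / \<alpha>" using of_real_eq_iff by metis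
  show thesis by (rule that[OF r v 1 2])
qed

lemma char_root_Re_bounds:
  assumes z: "char_root \<alpha> \<beta> m z"
  shows "- 1 / \<alpha> < Re z" "Re z < 0"
proof -
  have neg: "- 1 / \<beta> < 0" "- 1 / \<alpha> < 0" using \<alpha> \<beta> by auto
  have "- 1 / \<alpha> < Re z \<and> Re z < 0"
  proof (cases "Im z = 0")
    case True
    then obtain r where r: "z = of_real r" by (metis complex_is_Real_iff Reals_cases)
    note b = real_char_root_bounds[OF z[unfolded r]]
    have "r < 0" using b(2) neg(1) by (rule less_trans)
    then show ?thesis using b(1) by (simp add: r)
  next
    case False
    then obtain r where r: "char_root \<alpha> \<beta> m (of_real r)" "2 * Re z = - 1 / \<alpha> - r"
      using nonreal_char_root[OF z] by metis
    show ?thesis using real_char_root_bounds[OF r(1)] r(2) neg by linarith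
  qed
  then show "- 1 / \<alpha> < Re z" "Re z < 0" by auto
qed

text \<open>Multiplying out the equation of a real root \<open>r\<close> shows that \<open>\<alpha> r + 1\<close> is bounded
  below, and by Vieta \<open>-(\<alpha> r + 1) / (2 \<alpha>)\<close> is the real part of the nonreal roots.\<close>

lemma char_root_Re_upper:
  assumes z: "char_root \<alpha> \<beta> m z"
  shows "Re z \<le> max (- 1 / \<beta>) (- (m * (\<beta> - \<alpha>) / (1 + m * \<alpha> * \<beta>) / 2))"
proof (cases "Im z = 0")
  case True
  then obtain r where r: "z = of_real r" by (metis complex_is_Real_iff Reals_cases)
  from real_char_root_bounds(2)[OF z[unfolded r]] show ?thesis unfolding r by simp
next
  case False
  then obtain r where r: "char_root \<alpha> \<beta> m (of_real r)" "2 * Re z = - 1 / \<alpha> - r"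
    using nonreal_char_root[OF z] by metis
  define k where "k = \<alpha> * r + 1"
  note b = real_char_root_bounds[OF r(1)]
  have "r < 0" using b(2) \<alpha> \<beta> by (smt (verit) divide_neg_pos)
  have "0 < k" using b(1) \<alpha> by (simp add: k_def field_simps)
  have "\<alpha> * \<bar>r\<bar> \<le> 1" using b(1) \<open>r < 0\<close> \<alpha> by (simp add: field_simps)
  then have "(\<alpha> * \<bar>r\<bar>)\<^sup>2 \<le> 1" using \<alpha> by (simp add: power_le_one)
  then have "(\<alpha> * r)\<^sup>2 * k \<le> k" using \<open>0 < k\<close> by (simp add: power_mult_distrib)
  moreover have "r\<^sup>2 * k = - m * (\<beta> * r + 1)" using r(1) by (simp add: real_char_root_iff k_def)
  then have "\<alpha>\<^sup>2 * (r\<^sup>2 * k) = \<alpha>\<^sup>2 * (- m * (\<beta> * r + 1))" by (simp only:)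
  then have "(\<alpha> * r)\<^sup>2 * k = \<alpha> * m * (- \<beta> * (\<alpha> * r) - \<alpha>)"
    by (simp add: algebra_simps power2_eq_square)
  moreover have "\<dots> = \<alpha> * m * (\<beta> - \<alpha>) - m * \<alpha> * \<beta> * k" by (simp add: k_def algebra_simps)
  ultimately have le: "\<alpha> * (m * (\<beta> - \<alpha>)) \<le> k * (1 + m * \<alpha> * \<beta>)" by (simp add: algebra_simps)
  have pos: "0 < 1 + m * \<alpha> * \<beta>" using \<alpha> \<beta> m by (simp add: add_pos_pos)
  define c where "c = m * (\<beta> - \<alpha>) / (1 + m * \<alpha> * \<beta>)"
  have "\<alpha> * c = \<alpha> * (m * (\<beta> - \<alpha>)) / (1 + m * \<alpha> * \<beta>)" by (simp add: c_def)
  also have "\<dots> \<le> k" using le pos by (simp only: pos_divide_le_eq)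
  also have "k = 2 * \<alpha> * - Re z" using r(2) \<alpha> by (simp add: k_def field_simps)
  finally have "\<alpha> * c \<le> \<alpha> * (2 * - Re z)" by simp
  then have "c \<le> 2 * - Re z" using \<alpha> by (rule mult_left_le_imp_le)
  then have "Re z \<le> - (c / 2)" by simp
  then show ?thesis unfolding c_def by (rule max.coboundedI2)
qed

lemma real_char_root_lower:
  assumes r: "char_root \<alpha> \<beta> m (of_real r)"
  shows "- 1 / \<beta> - 1 / (\<alpha>\<^sup>2 * \<beta>) / m \<le> r"
proof -
  note b = real_char_root_bounds[OF r]
  have "r < 0" using b(2) \<alpha> \<beta> by (smt (verit) divide_neg_pos)
  have k: "0 < \<alpha> * r + 1" using b(1) \<alpha> by (simp add: field_simps)
  have "\<alpha> * r + 1 \<le> 1" using \<open>r < 0\<close> \<alpha> by (simp add: mult_le_0_iff)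
  have "\<alpha> * \<bar>r\<bar> \<le> 1" using b(1) \<open>r < 0\<close> \<alpha> by (simp add: field_simps)
  then have "(\<alpha> * \<bar>r\<bar>)\<^sup>2 \<le> 1" using \<alpha> by (simp add: power_le_one)
  then have "(\<alpha> * \<bar>r\<bar>)\<^sup>2 * (\<alpha> * r + 1) \<le> 1 * 1"
    using k \<open>\<alpha> * r + 1 \<le> 1\<close> by (intro mult_mono) auto
  then have "\<alpha>\<^sup>2 * (r\<^sup>2 * (\<alpha> * r + 1)) \<le> 1" by (simp add: power_mult_distrib mult.assoc)
  moreover have "r\<^sup>2 * (\<alpha> * r + 1) = - m * (\<beta> * r + 1)" using r by (simp add: real_char_root_iff)
  ultimately have "\<alpha>\<^sup>2 * (- m * (\<beta> * r + 1)) \<le> 1" by simp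
  then have 1: "- 1 \<le> \<alpha>\<^sup>2 * m * (\<beta> * r + 1)" by (simp add: algebra_simps)
  have "0 < \<alpha>\<^sup>2 * m" "0 < \<beta>" using \<alpha> \<beta> m by simp_all
  then have "- 1 / (\<alpha>\<^sup>2 * m) \<le> \<beta> * r + 1" using 1 by (simp only: pos_divide_le_eq mult.commute)
  then have "- 1 / (\<alpha>\<^sup>2 * m) - 1 \<le> r * \<beta>" by (simp add: mult.commute)
  then have "(- 1 / (\<alpha>\<^sup>2 * m) - 1) / \<beta> \<le> r" using \<open>0 < \<beta>\<close> by (simp only: pos_divide_le_eq)
  moreover have "(- 1 / (\<alpha>\<^sup>2 * m) - 1) / \<beta> = - 1 / \<beta> - 1 / (\<alpha>\<^sup>2 * \<beta>) / m"
    using \<alpha> \<beta> m by (simp add: field_simps)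
  ultimately show ?thesis by simp
qed

text \<open>As a function of \<open>m\<close> the discriminant of the cubic is, up to a factor, a quadratic polynomial with the
  zeros \<open>const_m1\<close> and \<open>const_m2\<close>; in the next lemma it is multiplied out.\<close>

lemma const_m_product:
  "(of_real m - const_m1 \<alpha> \<beta>) * (of_real m - const_m2 \<alpha> \<beta>)
    = of_real (m\<^sup>2 + (27 * \<alpha>\<^sup>2 - 18 * \<alpha> * \<beta> - \<beta>\<^sup>2) / (4 * \<alpha> * \<beta> ^ 3) * m + 1 / (\<alpha> * \<beta> ^ 3))"
proof -
  let ?C1 = "const_C1 \<alpha> \<beta>" and ?C2 = "const_C2 \<alpha> \<beta>"
  have \<beta>0: "\<beta> \<noteq> 0" "\<alpha> \<noteq> 0" using \<alpha> \<beta> by auto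
  define s where "s = csqrt (of_real ?C2)"
  have s2: "s\<^sup>2 = of_real ?C2" by (simp add: s_def)
  define k where "k = complex_of_real (\<alpha> / (8 * \<beta> ^ 3))"
  have m1: "const_m1 \<alpha> \<beta> = k * (- of_real ?C1 - s)" and m2: "const_m2 \<alpha> \<beta> = k * (- of_real ?C1 + s)"
    by (simp_all add: const_m1_def const_m2_def k_def s_def)
  have "(of_real m - const_m1 \<alpha> \<beta>) * (of_real m - const_m2 \<alpha> \<beta>)
     = (of_real m)\<^sup>2 + 2 * k * of_real ?C1 * of_real m + k\<^sup>2 * ((of_real ?C1)\<^sup>2 - s\<^sup>2)"
    unfolding m1 m2 by (simp add: algebra_simps power2_eq_square)
  also have "\<dots> = of_real (m\<^sup>2 + 2 * (\<alpha> / (8 * \<beta> ^ 3)) * ?C1 * m + (\<alpha> / (8 * \<beta> ^ 3))\<^sup>2 * (?C1\<^sup>2 - ?C2))"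
    by (simp add: s2 k_def)
  also have "2 * (\<alpha> / (8 * \<beta> ^ 3)) * ?C1 = (27 * \<alpha>\<^sup>2 - 18 * \<alpha> * \<beta> - \<beta>\<^sup>2) / (4 * \<alpha> * \<beta> ^ 3)"
    using \<beta>0 by (simp add: const_C1_def field_simps power2_eq_square)
  also have "(\<alpha> / (8 * \<beta> ^ 3))\<^sup>2 * (?C1\<^sup>2 - ?C2) = 1 / (\<alpha> * \<beta> ^ 3)"
    using \<beta>0 by (simp add: const_C2_def field_simps power2_eq_square power3_eq_cube)
  finally show ?thesis .
qed

lemma discriminant:
  assumes v: "vieta \<alpha> \<beta> m a b c"
  shows "((a - b) * (a - c) * (b - c))\<^sup>2
    = of_real (- 4 * \<beta> ^ 3 * m / \<alpha> ^ 3) * ((of_real m - const_m1 \<alpha> \<beta>) * (of_real m - const_m2 \<alpha> \<beta>))"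
proof -
  have \<beta>0: "\<beta> \<noteq> 0" "\<alpha> \<noteq> 0" using \<alpha> \<beta> by auto
  have "((a - b) * (a - c) * (b - c))\<^sup>2
    = (a + b + c)\<^sup>2 * (a * b + a * c + b * c)\<^sup>2 - 4 * (a * b + a * c + b * c) ^ 3
      - 4 * (a + b + c) ^ 3 * (a * b * c) - 27 * (a * b * c)\<^sup>2
      + 18 * (a + b + c) * (a * b + a * c + b * c) * (a * b * c)"
    by algebra
  also have "\<dots> = of_real ((- 1 / \<alpha>)\<^sup>2 * (\<beta> * m / \<alpha>)\<^sup>2 - 4 * (\<beta> * m / \<alpha>) ^ 3
      - 4 * (- 1 / \<alpha>) ^ 3 * (- m / \<alpha>) - 27 * (- m / \<alpha>)\<^sup>2 + 18 * (- 1 / \<alpha>) * (\<beta> * m / \<alpha>) * (- m / \<alpha>))"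
    using v unfolding vieta_def by (simp only: of_real_add of_real_diff of_real_mult of_real_power of_real_numeral)
  also have "(- 1 / \<alpha>)\<^sup>2 * (\<beta> * m / \<alpha>)\<^sup>2 - 4 * (\<beta> * m / \<alpha>) ^ 3
      - 4 * (- 1 / \<alpha>) ^ 3 * (- m / \<alpha>) - 27 * (- m / \<alpha>)\<^sup>2 + 18 * (- 1 / \<alpha>) * (\<beta> * m / \<alpha>) * (- m / \<alpha>)
    = (- 4 * \<beta> ^ 3 * m / \<alpha> ^ 3) *
      (m\<^sup>2 + (27 * \<alpha>\<^sup>2 - 18 * \<alpha> * \<beta> - \<beta>\<^sup>2) / (4 * \<alpha> * \<beta> ^ 3) * m + 1 / (\<alpha> * \<beta> ^ 3))"
    using \<beta>0 by (simp add: field_simps power2_eq_square power3_eq_cube) 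
  finally show ?thesis by (simp only: const_m_product of_real_mult)
qed

lemma vieta_distinct_iff:
  assumes v: "vieta \<alpha> \<beta> m a b c"
  shows "a \<noteq> b \<and> a \<noteq> c \<and> b \<noteq> c \<longleftrightarrow> of_real m \<noteq> const_m1 \<alpha> \<beta> \<and> of_real m \<noteq> const_m2 \<alpha> \<beta>"
proof -
  have "of_real (- 4 * \<beta> ^ 3 * m / \<alpha> ^ 3) \<noteq> (0::complex)" using \<alpha> \<beta> m by (simp only: of_real_eq_0_iff) simp
  then have "(a - b) * (a - c) * (b - c) = 0 \<longleftrightarrow>
      of_real m = const_m1 \<alpha> \<beta> \<or> of_real m = const_m2 \<alpha> \<beta>"
    using discriminant[OF v]
    by (metis (no_types, lifting) mult_eq_0_iff power_eq_0_iff right_minus_eq zero_power2)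
  then show ?thesis by auto
qed

text \<open>A repeated root excludes a pair of conjugate nonreal roots.\<close>

lemma double_root_real:
  assumes d: "of_real m = const_m1 \<alpha> \<beta> \<or> of_real m = const_m2 \<alpha> \<beta>"
  obtains a b where "vieta \<alpha> \<beta> m (of_real a) (of_real a) (of_real b)"
proof -
  obtain r where r: "char_root \<alpha> \<beta> m (of_real r)" using real_char_root_exists by blast
  obtain z w where zw: "vieta \<alpha> \<beta> m (of_real r) z w" "z \<in> \<real> \<and> w \<in> \<real> \<or> Im z \<noteq> 0 \<and> w = cnj z"
    using vieta_exists[OF r] by blast
  have eq: "of_real r = z \<or> of_real r = w \<or> z = w" using vieta_distinct_iff[OF zw(1)] d by blast
  have "Im z = 0 \<or> w \<noteq> cnj z"
  proof (rule disjCI)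
    assume "\<not> w \<noteq> cnj z"
    then have "Im w = - Im z" by simp
    with eq show "Im z = 0" by (metis Im_complex_of_real add.inverse_inverse add.inverse_neutral neg_equal_zero)
  qed
  with zw(2) have "z \<in> \<real> \<and> w \<in> \<real>" by blast
  then obtain x y where xy: "z = of_real x" "w = of_real y" by (auto elim!: Reals_cases)
  have v: "vieta \<alpha> \<beta> m (of_real r) (of_real x) (of_real y)" using zw(1) xy by simp
  have "r = x \<or> r = y \<or> x = y" using eq xy by auto
  then show thesis
  proof (elim disjE)
    assume "r = x"
    with v that[of r y] show thesis by simp
  next
    assume "r = y"
    with v have "vieta \<alpha> \<beta> m (of_real r) (of_real r) (of_real x)" by (simp add: vieta_def algebra_simps)
    then show thesis by (rule that)
  next
    assume "x = y"
    with v have "vieta \<alpha> \<beta> m (of_real x) (of_real x) (of_real r)" by (simp add: vieta_def algebra_simps)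
    then show thesis by (rule that)
  qed
qed

lemma all_real_bound:
  assumes v: "vieta \<alpha> \<beta> m (of_real a) (of_real b) (of_real c)"
  shows "m < 1 / \<alpha>\<^sup>2"
proof -
  have "char_root \<alpha> \<beta> m (of_real a)" "char_root \<alpha> \<beta> m (of_real b)" "char_root \<alpha> \<beta> m (of_real c)"
    using vieta_char_root[OF v] by auto
  then have b: "\<bar>x\<bar> < 1 / \<alpha>" if "x \<in> {a, b, c}" for x
    using that real_char_root_bounds[of x] \<alpha> \<beta> by (auto simp: abs_less_iff) (smt (verit) divide_neg_pos divide_pos_pos)+
  have "complex_of_real (a * b * c) = of_real (- m / \<alpha>)" using v by (simp add: vieta_def)
  then have "a * b * c = - m / \<alpha>" by (simp only: of_real_eq_iff)
  then have "m / \<alpha> = - (a * b * c)" by simp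
  also have "\<dots> \<le> \<bar>a\<bar> * \<bar>b\<bar> * \<bar>c\<bar>" by (metis abs_ge_minus_self abs_mult)
  also have "\<dots> < (1 / \<alpha>) * (1 / \<alpha>) * (1 / \<alpha>)"
    using b \<alpha> by (intro mult_strict_mono) auto
  finally show ?thesis using \<alpha> by (simp add: field_simps power2_eq_square)
qed

text \<open>For large \<open>m\<close> a root is either real and bounded or nonreal of size \<open>sqrt m\<close>. In both cases the
  derivative of the monic cubic at the root, whose modulus is the product of the distances to the other two
  roots, is at least of size \<open>m\<close>: any two roots differ at least by the imaginary part of the nonreal ones,
  which is of size \<open>sqrt m\<close>.\<close>

lemma large_root:
  assumes large: "1 / \<alpha>\<^sup>2 \<le> m" and a: "char_root \<alpha> \<beta> m a"
  shows "3 / 4 * m \<le> cmod (3 * a\<^sup>2 + of_real (2 / \<alpha>) * a + of_real (\<beta> * m / \<alpha>))"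
    and "cmod a \<le> 1 / \<alpha> \<and> 1 / \<beta> \<le> cmod a \<or> m \<le> (cmod a)\<^sup>2 \<and> (cmod a)\<^sup>2 \<le> m * (\<beta> / \<alpha>)"
proof -
  let ?q = "3 * a\<^sup>2 + of_real (2 / \<alpha>) * a + of_real (\<beta> * m / \<alpha>)"
  have q: "?q = (a - b) * (a - c)" if v: "vieta \<alpha> \<beta> m a b c" for b c
  proof -
    have "?q = 3 * a\<^sup>2 - 2 * (a + b + c) * a + (a * b + a * c + b * c)"
      using v by (simp add: vieta_def)
    also have "\<dots> = (a - b) * (a - c)" by (simp add: algebra_simps power2_eq_square)
    finally show ?thesis .
  qed
  have size: "m \<le> (cmod z)\<^sup>2" "(cmod z)\<^sup>2 \<le> m * (\<beta> / \<alpha>)" "3 / 4 * m \<le> (Im z)\<^sup>2"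
    if z: "char_root \<alpha> \<beta> m z" "Im z \<noteq> 0" for z
  proof -
    obtain r where r: "char_root \<alpha> \<beta> m (of_real r)"
      "2 * Re z = - 1 / \<alpha> - r" "(cmod z)\<^sup>2 * r = - m / \<alpha>"
      using nonreal_char_root[OF z] by metis
    note b = real_char_root_bounds[OF r(1)]
    have "(cmod z)\<^sup>2 * (1 / \<beta>) \<le> (cmod z)\<^sup>2 * (- r)" using b by (intro mult_left_mono) auto
    then have "(cmod z)\<^sup>2 / \<beta> \<le> m / \<alpha>" using r(3) by simp
    then show "(cmod z)\<^sup>2 \<le> m * (\<beta> / \<alpha>)" using \<alpha> \<beta> by (simp add: pos_divide_le_eq)
    have "(cmod z)\<^sup>2 * (- r) \<le> (cmod z)\<^sup>2 * (1 / \<alpha>)" using b by (intro mult_left_mono) auto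
    then have "m / \<alpha> \<le> (cmod z)\<^sup>2 / \<alpha>" using r(3) by simp
    then show 1: "m \<le> (cmod z)\<^sup>2" using \<alpha> by (simp add: divide_le_cancel)
    have "r < 0" using b(2) \<alpha> \<beta> by (smt (verit) divide_neg_pos)
    then have "\<bar>Re z\<bar> \<le> 1 / (2 * \<alpha>)" using r(2) b by (simp add: abs_le_iff)
    then have "(Re z)\<^sup>2 \<le> (1 / (2 * \<alpha>))\<^sup>2" using \<alpha> power_mono[of "\<bar>Re z\<bar>" "1 / (2 * \<alpha>)" 2] by simp
    also have "\<dots> \<le> m / 4" using large by (simp add: power_mult_distrib power_divide)
    finally show "3 / 4 * m \<le> (Im z)\<^sup>2" using 1 by (simp add: cmod_power2)
  qed
  have "3 / 4 * m \<le> cmod ?q \<and>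
    (cmod a \<le> 1 / \<alpha> \<and> 1 / \<beta> \<le> cmod a \<or> m \<le> (cmod a)\<^sup>2 \<and> (cmod a)\<^sup>2 \<le> m * (\<beta> / \<alpha>))"
  proof (cases "Im a = 0")
    case True
    then obtain r where r: "a = of_real r" by (metis complex_is_Real_iff Reals_cases)
    note b = real_char_root_bounds[OF a[unfolded r]]
    obtain z w where zw: "vieta \<alpha> \<beta> m (of_real r) z w" "z \<in> \<real> \<and> w \<in> \<real> \<or> Im z \<noteq> 0 \<and> w = cnj z"
      using vieta_exists a r by blast
    then have z: "Im z \<noteq> 0" "w = cnj z"
      using all_real_bound large by (auto elim!: Reals_cases simp: not_less[symmetric])
    have "3 / 4 * m \<le> (Im z)\<^sup>2" using size(3)[of z] z vieta_char_root[OF zw(1)] by blast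
    also have "\<dots> \<le> (cmod (a - z))\<^sup>2" using r by (simp add: cmod_power2)
    also have "\<dots> = cmod (a - z) * cmod (a - w)"
      unfolding z(2) r power2_eq_square by (metis complex_cnj_complex_of_real complex_cnj_diff complex_mod_cnj)
    also have "\<dots> = cmod ?q" using q zw r by (simp add: norm_mult)
    finally have 1: "3 / 4 * m \<le> cmod ?q" .
    have "r < 0" using b(2) \<alpha> \<beta> by (smt (verit) divide_neg_pos)
    then have "cmod a \<le> 1 / \<alpha> \<and> 1 / \<beta> \<le> cmod a" using b r by simp
    with 1 show ?thesis by blast
  next
    case False
    obtain r where r: "vieta \<alpha> \<beta> m (of_real r) a (cnj a)"
      using nonreal_char_root[OF a False] by metis
    then have v: "vieta \<alpha> \<beta> m a (of_real r) (cnj a)" by (simp add: vieta_def algebra_simps)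
    have "3 / 4 * m \<le> \<bar>Im a\<bar> * (2 * \<bar>Im a\<bar>)"
      using size(3)[OF a False] by (simp add: power2_eq_square) (smt (verit) zero_le_square)
    also have "\<dots> \<le> cmod (a - of_real r) * cmod (a - cnj a)"
      using abs_Im_le_cmod[of "a - of_real r"] abs_Im_le_cmod[of "a - cnj a"]
      by (intro mult_mono) auto
    also have "\<dots> = cmod ?q" using q[OF v] by (simp add: norm_mult)
    finally show ?thesis using size[OF a False] by blast
  qed
  then show "3 / 4 * m \<le> cmod ?q"
    and "cmod a \<le> 1 / \<alpha> \<and> 1 / \<beta> \<le> cmod a \<or> m \<le> (cmod a)\<^sup>2 \<and> (cmod a)\<^sup>2 \<le> m * (\<beta> / \<alpha>)"
    by auto
qed

end

section \<open>The spectral bound\<close>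

context
  fixes \<alpha> \<beta> :: real and \<mu> :: "nat \<Rightarrow> real"
  assumes \<alpha>: "0 < \<alpha>" and \<beta>: "\<alpha> < \<beta>" and \<mu>: "\<And>n. 0 < \<mu> n"
begin

lemma char_root_Re_bdd_above: "bdd_above {Re z |z n. char_root \<alpha> \<beta> (\<mu> n) z}"
  using char_root_Re_bounds(2)[OF \<alpha> \<beta> \<mu>] by (intro bdd_aboveI[of _ 0]) force

lemma char_root_le_sigma_max:
  assumes "char_root \<alpha> \<beta> (\<mu> n) z"
  shows "Re z \<le> sigma_max \<alpha> \<beta> \<mu>"
  unfolding sigma_max_def using assms by (intro cSup_upper char_root_Re_bdd_above) blast

lemma char_root_real_parts_nonempty: "{Re z |z n. char_root \<alpha> \<beta> (\<mu> n) z} \<noteq> {}"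
  using real_char_root_exists[OF \<alpha> \<beta> \<mu>] by blast

lemma below_sigma_max:
  assumes "\<omega> < sigma_max \<alpha> \<beta> \<mu>"
  obtains n z where "char_root \<alpha> \<beta> (\<mu> n) z" "\<omega> < Re z"
  using assms less_cSup_iff[OF char_root_real_parts_nonempty char_root_Re_bdd_above]
  unfolding sigma_max_def by blast

text \<open>The bound on the nonreal roots decreases in \<open>\<mu> n\<close>, so the smallest eigenvalue of \<open>L\<close> decides.\<close>

lemma sigma_max_negative:
  assumes "mono \<mu>"
  shows "sigma_max \<alpha> \<beta> \<mu> < 0"
proof -
  define s where "s = (\<lambda>m. max (- 1 / \<beta>) (- (m * (\<beta> - \<alpha>) / (1 + m * \<alpha> * \<beta>) / 2)))"
  have pos: "0 < 1 + m * \<alpha> * \<beta>" if "0 < m" for m using that \<alpha> \<beta> by (simp add: add_pos_pos)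
  have "s (\<mu> 0) < 0" using \<alpha> \<beta> \<mu>[of 0] pos[of "\<mu> 0"] by (simp add: s_def)
  moreover have "sigma_max \<alpha> \<beta> \<mu> \<le> s (\<mu> 0)"
    unfolding sigma_max_def
  proof (rule cSup_least[OF char_root_real_parts_nonempty])
    fix x assume "x \<in> {Re z |z n. char_root \<alpha> \<beta> (\<mu> n) z}"
    then obtain n z where z: "x = Re z" "char_root \<alpha> \<beta> (\<mu> n) z" by blast
    have "x \<le> s (\<mu> n)" using char_root_Re_upper[OF \<alpha> \<beta> \<mu> z(2)] z(1) by (simp add: s_def)
    also have "\<mu> 0 \<le> \<mu> n" using assms by (simp add: monoD)
    then have "\<mu> 0 * (\<beta> - \<alpha>) * (1 + \<mu> n * \<alpha> * \<beta>) \<le> \<mu> n * (\<beta> - \<alpha>) * (1 + \<mu> 0 * \<alpha> * \<beta>)"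
      using \<beta> by (simp add: distrib_left mult_right_mono)
    then have "\<mu> 0 * (\<beta> - \<alpha>) / (1 + \<mu> 0 * \<alpha> * \<beta>) \<le> \<mu> n * (\<beta> - \<alpha>) / (1 + \<mu> n * \<alpha> * \<beta>)" (is "?c0 \<le> ?cn")
      using pos[OF \<mu>[of 0]] pos[OF \<mu>[of n]] by (subst frac_le_eq) (simp_all add: divide_le_0_iff)
    then have "- (?cn / 2) \<le> - (?c0 / 2)" by (intro le_imp_neg_le divide_right_mono) simp_all
    then have "s (\<mu> n) \<le> s (\<mu> 0)" unfolding s_def by (rule max.mono[OF order_refl])
    finally show "x \<le> s (\<mu> 0)" .
  qed
  ultimately show ?thesis by linarith
qed

text \<open>The real roots converge to \<open>-1/\<beta>\<close> from below as \<open>\<mu> n\<close> tends to infinity.\<close>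

lemma sigma_max_lower:
  assumes "filterlim \<mu> at_top sequentially"
  shows "- 1 / \<beta> \<le> sigma_max \<alpha> \<beta> \<mu>"
proof (rule tendsto_upperbound)
  show "(\<lambda>n. - 1 / \<beta> - 1 / (\<alpha>\<^sup>2 * \<beta>) / \<mu> n) \<longlonglongrightarrow> - 1 / \<beta>"
    using tendsto_diff[OF tendsto_const real_tendsto_divide_at_top[OF tendsto_const assms]]
    by (metis diff_zero)
  have "- 1 / \<beta> - 1 / (\<alpha>\<^sup>2 * \<beta>) / \<mu> n \<le> sigma_max \<alpha> \<beta> \<mu>" for n
  proof -
    obtain r where r: "char_root \<alpha> \<beta> (\<mu> n) (of_real r)" using real_char_root_exists[OF \<alpha> \<beta> \<mu>] by blast
    show ?thesis using real_char_root_lower[OF \<alpha> \<beta> \<mu> r] char_root_le_sigma_max[OF r] by simp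
  qed
  then show "\<forall>\<^sub>F n in sequentially. - 1 / \<beta> - 1 / (\<alpha>\<^sup>2 * \<beta>) / \<mu> n \<le> sigma_max \<alpha> \<beta> \<mu>" by simp
qed simp

end


section \<open>Linear systems of ordinary differential equations in one block\<close>

lemma norm_vector_scalar_mult: "norm (a *s x) = cmod a * norm (x :: complex ^ 'n)"
  by (simp add: norm_vec_def L2_set_def norm_mult power_mult_distrib real_sqrt_mult
      flip: sum_distrib_left)

lemma scaleR_eq_vector_scalar_mult: "r *\<^sub>R x = complex_of_real r *s (x :: complex ^ 'n)"
  by (simp add: vec_eq_iff scaleR_conv_of_real[where ?'a = complex])

lemma vector_scalar_mult_matrix: "(P :: complex ^ 'n ^ 'm) *v (a *s x) = a *s (P *v x)"
  by (simp add: vec_eq_iff matrix_vector_mult_def sum_distrib_left mult.left_commute)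

lemma bounded_linear_vector_scalar_mult: "bounded_linear (\<lambda>a. a *s (x :: complex ^ 'n))"
  by (rule bounded_linear_intro[where K = "norm x"])
    (simp_all add: vec_eq_iff distrib_right norm_vector_scalar_mult)

lemma has_vector_derivative_vec:
  fixes f :: "real \<Rightarrow> complex ^ 'n"
  assumes "\<And>k. ((\<lambda>t. f t $ k) has_vector_derivative f' $ k) (at t)"
  shows "(f has_vector_derivative f') (at t)"
proof -
  have "((\<lambda>t. \<Sum>k\<in>UNIV. f t $ k *s axis k 1) has_vector_derivative (\<Sum>k\<in>UNIV. f' $ k *s axis k 1)) (at t)"
    by (intro has_vector_derivative_sum
        bounded_linear.has_vector_derivative[OF bounded_linear_vector_scalar_mult] assms)
  then show ?thesis by (simp only: Finite_Cartesian_Product.basis_expansion)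
qed

definition solves :: "complex ^ 'n ^ 'n \<Rightarrow> (real \<Rightarrow> complex ^ 'n) \<Rightarrow> bool" where
  "solves P f \<longleftrightarrow> (\<forall>t. (f has_vector_derivative P *v f t) (at t))"

lemma bounded_linear_matrix_vector: "bounded_linear ((*v) (P :: complex ^ 'n ^ 'm))"
  by (simp add: linear_conv_bounded_linear[symmetric])

lemma solves_diff: "solves P f \<Longrightarrow> solves P g \<Longrightarrow> solves P (\<lambda>t. f t - g t)"
  by (auto simp: solves_def matrix_vector_mult_diff_distrib intro!: has_vector_derivative_diff)

lemma solves_add: "solves P f \<Longrightarrow> solves P g \<Longrightarrow> solves P (\<lambda>t. f t + g t)"
  by (auto simp: solves_def matrix_vector_right_distrib intro!: has_vector_derivative_add)

lemma bounded_linear_vector_scalar_mult_right: "bounded_linear (\<lambda>x. a *s (x :: complex ^ 'n))"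
  by (rule bounded_linear_intro[where K = "cmod a"])
    (simp_all add: vec_eq_iff distrib_left norm_vector_scalar_mult mult.commute)

lemma solves_scale: "solves P f \<Longrightarrow> solves P (\<lambda>t. a *s f t)"
  unfolding solves_def vector_scalar_mult_matrix
  by (auto intro: bounded_linear.has_vector_derivative[OF bounded_linear_vector_scalar_mult_right])

lemma solves_matrix: "solves P f \<Longrightarrow> solves P (\<lambda>t. P *v f t)"
  unfolding solves_def
  by (auto intro: bounded_linear.has_vector_derivative[OF bounded_linear_matrix_vector])

lemma solves_shift:
  assumes "solves P f" shows "solves P (\<lambda>t. f (t + s))"
  unfolding solves_def
proof
  fix t
  have "((f \<circ> (\<lambda>t. t + s)) has_vector_derivative 1 *\<^sub>R (P *v f (t + s))) (at t)"
    by (rule vector_diff_chain_at) (use assms in \<open>auto simp: solves_def intro!: derivative_eq_intros\<close>)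
  then show "((\<lambda>t. f (t + s)) has_vector_derivative P *v f (t + s)) (at t)" by (simp add: o_def)
qed

lemma solves_reflect:
  assumes "solves P f" shows "solves (- P) (\<lambda>t. f (- t))"
  unfolding solves_def
proof
  fix t
  have "((f \<circ> uminus) has_vector_derivative (- 1) *\<^sub>R (P *v f (- t))) (at t)"
    by (rule vector_diff_chain_at) (use assms in \<open>auto simp: solves_def intro!: derivative_eq_intros\<close>)
  moreover have "(- P) *v x = - (P *v x)" for x
    by (simp add: vec_eq_iff matrix_vector_mult_def sum_negf)
  ultimately show "((\<lambda>t. f (- t)) has_vector_derivative (- P) *v f (- t)) (at t)" by (simp add: o_def)
qed

text \<open>The energy estimate: the derivative of \<open>exp (-2 s t) * norm (f t) ^ 2\<close> is nonpositive.\<close>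

lemma energy_estimate:
  assumes f: "solves P f" and P: "\<And>y. inner y (P *v y) \<le> s * (norm y)\<^sup>2" and t: "0 \<le> t"
  shows "norm (f t) \<le> exp (s * t) * norm (f 0)"
proof -
  let ?g = "\<lambda>t. exp (- 2 * s * t) * inner (f t) (f t)"
  have "?g t \<le> ?g 0"
  proof (rule DERIV_nonpos_imp_nonincreasing[OF t])
    fix x
    have "((\<lambda>t. inner (f t) (f t)) has_derivative
        (\<lambda>h. inner (f x) (h *\<^sub>R (P *v f x)) + inner (h *\<^sub>R (P *v f x)) (f x))) (at x)"
      by (rule has_derivative_inner) (use f in \<open>auto simp: solves_def has_vector_derivative_def\<close>)
    moreover have "(\<lambda>h. inner (f x) (h *\<^sub>R (P *v f x)) + inner (h *\<^sub>R (P *v f x)) (f x))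
        = (*) (2 * inner (f x) (P *v f x))"
      by (auto simp: inner_commute)
    ultimately have d: "DERIV (\<lambda>t. inner (f t) (f t)) x :> 2 * inner (f x) (P *v f x)"
      by (simp add: has_field_derivative_def)
    have e: "DERIV (\<lambda>t. exp (- 2 * s * t)) x :> exp (- 2 * s * x) * (- 2 * s)"
      by (auto intro!: derivative_eq_intros)
    have "exp (- 2 * s * x) * (- 2 * s) * inner (f x) (f x) + 2 * inner (f x) (P *v f x) * exp (- 2 * s * x)
      = 2 * exp (- 2 * s * x) * (inner (f x) (P *v f x) - s * (norm (f x))\<^sup>2)"
      by (simp add: power2_norm_eq_inner algebra_simps)
    also have "\<dots> \<le> 0" using P[of "f x"] by (simp add: mult_le_0_iff)
    finally show "\<exists>y. DERIV ?g x :> y \<and> y \<le> 0" using DERIV_mult[OF e d] by blast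
  qed
  then have "exp (2 * s * t) * (exp (- 2 * s * t) * (norm (f t))\<^sup>2) \<le> exp (2 * s * t) * (norm (f 0))\<^sup>2"
    by (intro mult_left_mono) (simp_all add: power2_norm_eq_inner)
  then have "(norm (f t))\<^sup>2 \<le> exp (2 * s * t) * (norm (f 0))\<^sup>2"
    by (simp add: mult.assoc[symmetric] exp_add[symmetric])
  also have "\<dots> = (exp (s * t) * norm (f 0))\<^sup>2"
    by (simp add: power_mult_distrib exp_double[symmetric] mult.assoc)
  finally show ?thesis by (rule power2_le_imp_le) simp
qed

lemma energy_estimate_abs:
  assumes f: "solves P f" and P: "\<And>y. \<bar>inner y (P *v y)\<bar> \<le> K * (norm y)\<^sup>2"
  shows "norm (f t) \<le> exp (K * \<bar>t\<bar>) * norm (f 0)"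
proof (cases "0 \<le> t")
  case True
  then show ?thesis using energy_estimate[OF f _ True, of K] P by (simp add: abs_le_iff)
next
  case False
  have n: "(- P) *v x = - (P *v x)" for x
    by (simp add: vec_eq_iff matrix_vector_mult_def sum_negf)
  show ?thesis
    using energy_estimate[OF solves_reflect[OF f], of K "- t"] False P by (simp add: n abs_le_iff)
qed

lemma solves_unique:
  assumes "solves P f" "solves P g" "f 0 = g 0" and "\<And>y. \<bar>inner y (P *v y)\<bar> \<le> K * (norm y)\<^sup>2"
  shows "f t = g t"
  using energy_estimate_abs[OF solves_diff[OF assms(1,2)] assms(4), of t] assms(3) by simp

lemma solves_exponential:
  assumes "P *v v = a *s v"
  shows "solves P (\<lambda>t. exp (t *\<^sub>R a) *s v)"
  unfolding solves_def
proof
  fix t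
  have "((\<lambda>t. exp (t *\<^sub>R a) *s v) has_vector_derivative (exp (t *\<^sub>R a) * a) *s v) (at t)"
    by (rule bounded_linear.has_vector_derivative[OF bounded_linear_vector_scalar_mult
          exp_scaleR_has_vector_derivative_right])
  then show "((\<lambda>t. exp (t *\<^sub>R a) *s v) has_vector_derivative P *v (exp (t *\<^sub>R a) *s v)) (at t)"
    by (simp only: vector_scalar_mult_matrix assms vector_smult_assoc)
qed

lemma solves_increment:
  assumes f: "solves P f" and P: "\<And>y. \<bar>inner y (P *v y)\<bar> \<le> K * (norm y)\<^sup>2" and K: "0 \<le> K"
  shows "norm (f t - f 0) \<le> \<bar>t\<bar> * (exp (K * \<bar>t\<bar>) * norm (P *v f 0))"
proof -
  have "norm (f t - f 0) \<le> (exp (K * \<bar>t\<bar>) * norm (P *v f 0)) * norm (t - 0)"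
  proof (rule differentiable_bound[where S = "{-\<bar>t\<bar>..\<bar>t\<bar>}" and f' = "\<lambda>x h. h *\<^sub>R (P *v f x)"])
    fix x assume x: "x \<in> {-\<bar>t\<bar>..\<bar>t\<bar>}"
    show "(f has_derivative (\<lambda>h. h *\<^sub>R (P *v f x))) (at x within {-\<bar>t\<bar>..\<bar>t\<bar>})"
      using f by (auto simp: solves_def has_vector_derivative_def intro: has_derivative_at_withinI)
    have "norm (P *v f x) \<le> exp (K * \<bar>x\<bar>) * norm (P *v f 0)"
      by (rule energy_estimate_abs[OF solves_matrix[OF f] P])
    also have "\<dots> \<le> exp (K * \<bar>t\<bar>) * norm (P *v f 0)"
      using x K by (intro mult_right_mono) (auto intro!: mult_left_mono)
    finally show "onorm (\<lambda>h. h *\<^sub>R (P *v f x)) \<le> exp (K * \<bar>t\<bar>) * norm (P *v f 0)"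
      by (intro onorm_le) (simp add: mult.commute mult_left_mono)
  qed auto
  then show ?thesis by (simp add: mult.commute)
qed

text \<open>A scalar equation with entire right-hand side has an entire solution, by the variation of
  constants formula and the existence of entire primitives.\<close>

lemma entire_scalar_equation:
  assumes g: "g holomorphic_on UNIV"
  obtains z where "z 0 = z0" "\<And>t. (z has_field_derivative a * z t + g t) (at t)"
proof -
  have "(\<lambda>t. exp (- a * t) * g t) holomorphic_on UNIV" by (intro holomorphic_intros g)
  then obtain p where p: "\<And>t. t \<in> UNIV \<Longrightarrow> (p has_field_derivative exp (- a * t) * g t) (at t within UNIV)"
    by (rule holomorphic_convex_primitive'[OF convex_UNIV open_UNIV]) blast
  define z where "z t = exp (a * t) * (z0 + p t - p 0)" for t
  have "(z has_field_derivative a * z t + g t) (at t)" for t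
  proof -
    have e: "((\<lambda>t. exp (a * t)) has_field_derivative exp (a * t) * a) (at t)"
      by (auto intro!: derivative_eq_intros)
    have q: "((\<lambda>t. z0 + p t - p 0) has_field_derivative exp (- a * t) * g t) (at t)"
      using p[of t] by (auto intro!: derivative_eq_intros)
    have "exp (a * t) * a * (z0 + p t - p 0) + exp (- a * t) * g t * exp (a * t) = a * z t + g t"
      by (simp add: z_def exp_minus)
    moreover have "(z has_field_derivative
        exp (a * t) * a * (z0 + p t - p 0) + exp (- a * t) * g t * exp (a * t)) (at t)"
      unfolding z_def[abs_def] by (rule DERIV_mult[OF e q])
    ultimately show ?thesis by (simp only:)
  qed
  moreover have "z 0 = z0" by (simp add: z_def)
  ultimately show thesis by (rule that[rotated])
qed

definition bidiagonal :: "(3 \<Rightarrow> complex) \<Rightarrow> real \<Rightarrow> complex ^ 3 ^ 3" where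
  "bidiagonal l d = vector [vector [l 1, of_real d, 0], vector [0, l 2, of_real d], vector [0, 0, l 3]]"

lemma bidiagonal_mult:
  "bidiagonal l d *v y
    = vector [l 1 * y $ 1 + of_real d * y $ 2, l 2 * y $ 2 + of_real d * y $ 3, l 3 * y $ 3]"
  by (simp add: bidiagonal_def vec_eq_iff forall_3 matrix_vector_mult_def sum_3)

lemma bidiagonal_solution_exists: "\<exists>f. f 0 = y \<and> solves (bidiagonal l d) f"
proof -
  obtain z3 where z3: "z3 0 = y $ 3" "\<And>t. (z3 has_field_derivative l 3 * z3 t + 0) (at t)"
    by (rule entire_scalar_equation[of "\<lambda>_. 0" "y $ 3" "l 3"]) auto
  have "z3 holomorphic_on UNIV" using z3(2) by (auto simp: holomorphic_on_open)
  then have "(\<lambda>t. of_real d * z3 t) holomorphic_on UNIV" by (intro holomorphic_intros)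
  then obtain z2 where z2: "z2 0 = y $ 2"
      "\<And>t. (z2 has_field_derivative l 2 * z2 t + of_real d * z3 t) (at t)"
    by (rule entire_scalar_equation[of _ "y $ 2" "l 2"]) blast
  have "z2 holomorphic_on UNIV" using z2(2) by (auto simp: holomorphic_on_open)
  then have "(\<lambda>t. of_real d * z2 t) holomorphic_on UNIV" by (intro holomorphic_intros)
  then obtain z1 where z1: "z1 0 = y $ 1"
      "\<And>t. (z1 has_field_derivative l 1 * z1 t + of_real d * z2 t) (at t)"
    by (rule entire_scalar_equation[of _ "y $ 1" "l 1"]) blast
  let ?f = "\<lambda>t. vector [z1 (of_real t), z2 (of_real t), z3 (of_real t)] :: complex ^ 3"
  have "?f 0 = y" by (simp add: vec_eq_iff forall_3 z1 z2 z3)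
  moreover have "solves (bidiagonal l d) ?f"
    unfolding solves_def bidiagonal_mult
  proof
    fix t
    have r: "((\<lambda>t. z (complex_of_real t)) has_vector_derivative z') (at t)"
      if "(z has_field_derivative z') (at (of_real t))" for z z'
    proof -
      have "(complex_of_real has_vector_derivative 1) (at t)"
        using has_vector_derivative_of_real[of "\<lambda>t. t" 1] by simp
      from field_vector_diff_chain_at[OF this that] show ?thesis by (simp add: o_def)
    qed
    show "(?f has_vector_derivative
      vector [l 1 * ?f t $ 1 + of_real d * ?f t $ 2, l 2 * ?f t $ 2 + of_real d * ?f t $ 3, l 3 * ?f t $ 3]) (at t)"
    proof (rule has_vector_derivative_vec)
      fix k :: 3
      show "((\<lambda>t. ?f t $ k) has_vector_derivative
        vector [l 1 * ?f t $ 1 + of_real d * ?f t $ 2, l 2 * ?f t $ 2 + of_real d * ?f t $ 3,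
          l 3 * ?f t $ 3] $ k) (at t)"
        using exhaust_3[of k] r[OF z1(2)] r[OF z2(2)] r[OF z3(2)] by auto
    qed
  qed
  ultimately show ?thesis by (intro exI[of _ ?f] conjI)
qed

text \<open>The coupling contributes at most \<open>d\<close> to the growth bound, because
  \<open>\<bar>y1\<bar> \<bar>y2\<bar> + \<bar>y2\<bar> \<bar>y3\<bar> \<le> \<bar>y\<bar> ^ 2\<close>.\<close>

lemma bidiagonal_numerical_range:
  assumes d: "0 \<le> d" and l: "\<And>j. a \<le> Re (l j) \<and> Re (l j) \<le> b"
  shows "(a - d) * (norm y)\<^sup>2 \<le> inner y (bidiagonal l d *v y)"
    and "inner y (bidiagonal l d *v y) \<le> (b + d) * (norm y)\<^sup>2"
proof -
  have n: "(norm y)\<^sup>2 = (cmod (y $ 1))\<^sup>2 + (cmod (y $ 2))\<^sup>2 + (cmod (y $ 3))\<^sup>2"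
    by (simp add: norm_vec_def L2_set_def sum_3)
  have mul: "inner z (c * z) = Re c * (cmod z)\<^sup>2" for c z :: complex
    unfolding cmod_power2 by (simp add: inner_complex_def algebra_simps power2_eq_square)
  have e: "inner y (bidiagonal l d *v y)
      = Re (l 1) * (cmod (y $ 1))\<^sup>2 + Re (l 2) * (cmod (y $ 2))\<^sup>2 + Re (l 3) * (cmod (y $ 3))\<^sup>2
        + d * (inner (y $ 1) (y $ 2) + inner (y $ 2) (y $ 3))"
    unfolding bidiagonal_mult inner_vec_def sum_3
    by (simp add: inner_add_right mul scaleR_conv_of_real[symmetric] algebra_simps)
  have c: "\<bar>inner (y $ 1) (y $ 2) + inner (y $ 2) (y $ 3)\<bar> \<le> (norm y)\<^sup>2"
  proof -
    have "\<bar>inner (y $ 1) (y $ 2)\<bar> \<le> cmod (y $ 1) * cmod (y $ 2)"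
      "\<bar>inner (y $ 2) (y $ 3)\<bar> \<le> cmod (y $ 2) * cmod (y $ 3)"
      by (rule Cauchy_Schwarz_ineq2)+
    moreover have "2 * cmod (y $ 1) * cmod (y $ 2) \<le> (cmod (y $ 1))\<^sup>2 + (cmod (y $ 2))\<^sup>2"
      "2 * cmod (y $ 2) * cmod (y $ 3) \<le> (cmod (y $ 2))\<^sup>2 + (cmod (y $ 3))\<^sup>2"
      by (rule sum_squares_bound)+
    moreover have "0 \<le> (cmod (y $ 1))\<^sup>2" "0 \<le> (cmod (y $ 3))\<^sup>2" by simp_all
    ultimately show ?thesis unfolding n by linarith
  qed
  have "d * \<bar>inner (y $ 1) (y $ 2) + inner (y $ 2) (y $ 3)\<bar> \<le> d * (norm y)\<^sup>2"
    by (rule mult_left_mono[OF c d])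
  then have c': "\<bar>d * (inner (y $ 1) (y $ 2) + inner (y $ 2) (y $ 3))\<bar> \<le> d * (norm y)\<^sup>2"
    using d by (simp add: abs_mult)
  have "Re (l 1) * (cmod (y $ 1))\<^sup>2 + Re (l 2) * (cmod (y $ 2))\<^sup>2 + Re (l 3) * (cmod (y $ 3))\<^sup>2
      \<le> b * (norm y)\<^sup>2"
    unfolding n distrib_left by (intro add_mono mult_right_mono) (use l in auto)
  then show "inner y (bidiagonal l d *v y) \<le> (b + d) * (norm y)\<^sup>2"
    unfolding e distrib_right using c' by linarith
  have "a * (norm y)\<^sup>2 \<le>
      Re (l 1) * (cmod (y $ 1))\<^sup>2 + Re (l 2) * (cmod (y $ 2))\<^sup>2 + Re (l 3) * (cmod (y $ 3))\<^sup>2"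
    unfolding n distrib_left by (intro add_mono mult_right_mono) (use l in auto)
  then show "(a - d) * (norm y)\<^sup>2 \<le> inner y (bidiagonal l d *v y)"
    unfolding e left_diff_distrib using c' by linarith
qed


section \<open>Block diagonal operators and their groups\<close>

definition block_norm :: "(nat \<Rightarrow> 'v \<Rightarrow> complex ^ 3) \<Rightarrow> 'v \<Rightarrow> real" where
  "block_norm Z x = sqrt (\<Sum>n. (norm (Z n x))\<^sup>2)"

text \<open>The blocks \<open>Z n\<close> identify \<open>X\<close> with a space of square-summable sequences on which \<open>A\<close> acts by the
  matrices \<open>B n\<close>; the norm \<open>N\<close> is only equivalent to the one transported from the sequence space. The
  bound \<open>s\<close> on the numerical range governs the decay, the two-sided bound \<open>K\<close> makes the block flows
  bounded uniformly in \<open>n\<close> in both directions of time.\<close>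

locale block_system =
  fixes X :: "'v::complex_vector set" and N :: "'v \<Rightarrow> real" and Z :: "nat \<Rightarrow> 'v \<Rightarrow> complex ^ 3"
    and D :: "'v set" and A :: "'v \<Rightarrow> 'v" and B :: "nat \<Rightarrow> complex ^ 3 ^ 3" and s K c C :: real
  assumes X: "csubspace X"
    and Z_add: "x \<in> X \<Longrightarrow> y \<in> X \<Longrightarrow> Z n (x + y) = Z n x + Z n y"
    and Z_scaleC: "x \<in> X \<Longrightarrow> Z n (a *\<^sub>C x) = a *s Z n x"
    and Z_zero: "x \<in> X \<Longrightarrow> (\<And>n. Z n x = 0) \<Longrightarrow> x = 0"
    and Z_summable: "x \<in> X \<Longrightarrow> summable (\<lambda>n. (norm (Z n x))\<^sup>2)"
    and Z_surj: "summable (\<lambda>n. (norm (f n))\<^sup>2) \<Longrightarrow> \<exists>x\<in>X. \<forall>n. Z n x = f n"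
    and cC: "0 < c" "0 < C"
    and N_le: "x \<in> X \<Longrightarrow> c * N x \<le> block_norm Z x"
    and le_N: "x \<in> X \<Longrightarrow> block_norm Z x \<le> C * N x"
    and D_iff: "x \<in> D \<longleftrightarrow> x \<in> X \<and> summable (\<lambda>n. (norm (B n *v Z n x))\<^sup>2)"
    and A_in: "x \<in> D \<Longrightarrow> A x \<in> X"
    and Z_A: "x \<in> D \<Longrightarrow> Z n (A x) = B n *v Z n x"
    and B_upper: "inner b (B n *v b) \<le> s * (norm b)\<^sup>2"
    and B_abs: "\<bar>inner b (B n *v b)\<bar> \<le> K * (norm b)\<^sup>2"
    and B_solution: "\<exists>f. f 0 = b \<and> solves (B n) f"
begin

abbreviation E :: "'v \<Rightarrow> real" where "E \<equiv> block_norm Z"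

lemma X_closed:
  shows "0 \<in> X" "x \<in> X \<Longrightarrow> y \<in> X \<Longrightarrow> x + y \<in> X" "x \<in> X \<Longrightarrow> a *\<^sub>C x \<in> X"
    "x \<in> X \<Longrightarrow> r *\<^sub>R x \<in> X" "x \<in> X \<Longrightarrow> - x \<in> X" "x \<in> X \<Longrightarrow> y \<in> X \<Longrightarrow> x - y \<in> X"
proof -
  show 1: "0 \<in> X" and 2: "x \<in> X \<Longrightarrow> y \<in> X \<Longrightarrow> x + y \<in> X" and 3: "x \<in> X \<Longrightarrow> a *\<^sub>C x \<in> X" for x y a
    using X by (auto simp: csubspace_def)
  show "x \<in> X \<Longrightarrow> r *\<^sub>R x \<in> X" for x r using 3[of x "of_real r"] by (simp add: scaleC_of_real)
  show 4: "x \<in> X \<Longrightarrow> - x \<in> X" for x using 3[of x "-1"] by (simp add: scaleC_minus_one)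
  show "x \<in> X \<Longrightarrow> y \<in> X \<Longrightarrow> x - y \<in> X" using 2[of x "- y"] 4[of y] by simp
qed

lemma Z_simps:
  assumes "x \<in> X"
  shows "Z n (r *\<^sub>R x) = r *\<^sub>R Z n x" "Z n (- x) = - Z n x" "y \<in> X \<Longrightarrow> Z n (x - y) = Z n x - Z n y"
proof -
  have 1: "Z n (r *\<^sub>R x) = r *\<^sub>R Z n x" if "x \<in> X" for r x
    using Z_scaleC[OF that, of n "of_real r"] by (simp add: scaleC_of_real scaleR_eq_vector_scalar_mult)
  have 2: "Z n (- x) = - Z n x" if "x \<in> X" for x using 1[OF that, of "-1"] by simp
  show "Z n (r *\<^sub>R x) = r *\<^sub>R Z n x" by (rule 1[OF assms])
  show "Z n (- x) = - Z n x" by (rule 2[OF assms])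
  show "y \<in> X \<Longrightarrow> Z n (x - y) = Z n x - Z n y"
    using Z_add[OF assms X_closed(5), of y] 2 by simp
qed

lemma Z_eqI:
  assumes "x \<in> X" "y \<in> X" "\<And>n. Z n x = Z n y"
  shows "x = y"
  using Z_zero[OF X_closed(6)[OF assms(1,2)]] assms by (simp add: Z_simps)

lemma E_nonneg: "x \<in> X \<Longrightarrow> 0 \<le> E x"
  by (simp add: block_norm_def suminf_nonneg Z_summable)

lemma N_nonneg: "x \<in> X \<Longrightarrow> 0 \<le> N x"
  using le_N[of x] E_nonneg[of x] cC by (smt (verit) mult_pos_neg)

lemma E_square: "x \<in> X \<Longrightarrow> (E x)\<^sup>2 = (\<Sum>n. (norm (Z n x))\<^sup>2)"
  by (simp add: block_norm_def suminf_nonneg Z_summable)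

lemma norm_Z_le: "x \<in> X \<Longrightarrow> norm (Z n x) \<le> E x"
  unfolding block_norm_def
  by (rule real_le_rsqrt) (use sum_le_suminf[OF Z_summable, of x "{n}"] in auto)

lemma E_mono:
  assumes "x \<in> X" "y \<in> X" "0 \<le> k" "\<And>n. norm (Z n x) \<le> k * norm (Z n y)"
  shows "E x \<le> k * E y"
proof -
  have "(E x)\<^sup>2 \<le> (\<Sum>n. k\<^sup>2 * (norm (Z n y))\<^sup>2)"
    unfolding E_square[OF assms(1)]
    using power_mono[OF assms(4), of _ 2] assms
    by (intro suminf_le summable_mult Z_summable) (auto simp: power_mult_distrib)
  also have "\<dots> = (k * E y)\<^sup>2"
    using E_square[OF assms(2)] Z_summable[OF assms(2)] by (simp add: suminf_mult power_mult_distrib)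
  finally show ?thesis by (rule power2_le_imp_le) (simp add: assms E_nonneg)
qed

lemma norm_on_E: "norm_on X E"
  unfolding norm_on_def
proof (intro conjI ballI allI)
  show "csubspace X" by (rule X)
  fix x assume x: "x \<in> X"
  show "0 \<le> E x" by (rule E_nonneg[OF x])
  show "E x = 0 \<longleftrightarrow> x = 0"
  proof
    assume "E x = 0"
    then show "x = 0" using norm_Z_le[OF x] by (intro Z_zero x) (auto intro: order_antisym)
  next
    assume "x = 0"
    then have "Z n x = 0" for n using Z_scaleC[OF x, of n 0] by simp
    then show "E x = 0" by (simp add: block_norm_def)
  qed
  show "E (a *\<^sub>C x) = cmod a * E x" for a
    by (simp add: block_norm_def Z_scaleC x norm_vector_scalar_mult power_mult_distrib
        suminf_mult[OF Z_summable[OF x]] real_sqrt_mult)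
  fix y assume y: "y \<in> X"
  show "E (x + y) \<le> E x + E y"
    unfolding block_norm_def Z_add[OF x y]
    by (rule sqrt_suminf_norm_square_add) (intro Z_summable x y)+
qed

lemma equivalent_E: "equivalent_norms X N E"
  unfolding equivalent_norms_def using cC N_le le_N by blast

lemma N_tendsto_zero:
  assumes "\<And>t. x t \<in> X" "((\<lambda>t. E (x t)) \<longlongrightarrow> 0) F"
  shows "((\<lambda>t. N (x t)) \<longlongrightarrow> 0) F"
proof (rule tendsto_sandwich[OF _ _ tendsto_const])
  show "((\<lambda>t. E (x t) / c) \<longlongrightarrow> 0) F" using tendsto_divide[OF assms(2) tendsto_const, of c] cC by simp
  show "\<forall>\<^sub>F t in F. N (x t) \<le> E (x t) / c"
    using N_le[OF assms(1)] cC by (simp add: pos_le_divide_eq mult.commute)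
qed (simp add: N_nonneg assms)

lemma E_tendsto_zero_dominated:
  assumes x: "\<And>t. x t \<in> X" and y: "summable (\<lambda>n. (y n)\<^sup>2)"
    and dom: "\<forall>\<^sub>F t in F. \<forall>n. norm (Z n (x t)) \<le> y n"
    and lim: "\<And>n. ((\<lambda>t. Z n (x t)) \<longlongrightarrow> 0) F"
  shows "((\<lambda>t. E (x t)) \<longlongrightarrow> 0) F"
proof -
  have "((\<lambda>t. \<Sum>n. (norm (Z n (x t)))\<^sup>2) \<longlongrightarrow> 0) F"
  proof (rule tendsto_suminf_zero_dominated[OF y])
    show "\<forall>\<^sub>F t in F. \<forall>n. 0 \<le> (norm (Z n (x t)))\<^sup>2 \<and> (norm (Z n (x t)))\<^sup>2 \<le> (y n)\<^sup>2"
      using dom by eventually_elim (auto intro!: power_mono)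
    show "((\<lambda>t. (norm (Z n (x t)))\<^sup>2) \<longlongrightarrow> 0) F" for n
      using tendsto_power[OF tendsto_norm_zero[OF lim[of n]], of 2] by simp
  qed
  from tendsto_real_sqrt[OF this] show ?thesis by (simp add: block_norm_def)
qed

text \<open>Truncated vectors lie in the domain, which is therefore dense.\<close>

definition trunc :: "nat set \<Rightarrow> 'v \<Rightarrow> 'v" where
  "trunc S x = (SOME y. y \<in> X \<and> (\<forall>n. Z n y = (if n \<in> S then Z n x else 0)))"

lemma trunc:
  assumes "finite S"
  shows "trunc S x \<in> X" "Z n (trunc S x) = (if n \<in> S then Z n x else 0)" "trunc S x \<in> D"
proof -
  have "summable (\<lambda>n. (norm (if n \<in> S then Z n x else 0))\<^sup>2)"
    by (rule summable_finite[OF assms]) auto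
  then have "\<exists>y. y \<in> X \<and> (\<forall>n. Z n y = (if n \<in> S then Z n x else 0))"
    using Z_surj[of "\<lambda>n. if n \<in> S then Z n x else 0"] by blast
  then have *: "trunc S x \<in> X \<and> (\<forall>n. Z n (trunc S x) = (if n \<in> S then Z n x else 0))"
    unfolding trunc_def by (rule someI_ex)
  then show "trunc S x \<in> X" "Z n (trunc S x) = (if n \<in> S then Z n x else 0)" by auto
  have "summable (\<lambda>n. (norm (B n *v Z n (trunc S x)))\<^sup>2)"
    by (rule summable_finite[OF assms]) (use * in auto)
  with * show "trunc S x \<in> D" by (simp add: D_iff)
qed

lemma trunc_tendsto:
  assumes x: "x \<in> X"
  shows "(\<lambda>k. E (x - trunc {..<k} x)) \<longlonglongrightarrow> 0"
proof (rule E_tendsto_zero_dominated)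
  show "x - trunc {..<k} x \<in> X" for k by (intro X_closed x trunc) simp
  show "summable (\<lambda>n. (norm (Z n x))\<^sup>2)" by (rule Z_summable[OF x])
  show "\<forall>\<^sub>F k in sequentially. \<forall>n. norm (Z n (x - trunc {..<k} x)) \<le> norm (Z n x)"
    by (simp add: Z_simps x trunc)
  fix n
  have "\<forall>\<^sub>F k in sequentially. Z n (x - trunc {..<k} x) = 0"
    using eventually_gt_at_top[of n] by eventually_elim (simp add: Z_simps x trunc)
  then show "(\<lambda>k. Z n (x - trunc {..<k} x)) \<longlonglongrightarrow> 0" by (rule tendsto_eventually)
qed

lemma D_subset: "x \<in> D \<Longrightarrow> x \<in> X" by (simp add: D_iff)

lemma clinear_on_A: "clinear_on D A"
proof -
  have sub: "csubspace D"
    unfolding csubspace_def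
  proof (intro conjI ballI allI)
    have "Z n 0 = 0" for n using Z_scaleC[OF X_closed(1), of n 0] by simp
    then show "0 \<in> D" by (simp add: D_iff X_closed)
    fix x assume x: "x \<in> D"
    show "a *\<^sub>C x \<in> D" for a
    proof -
      have "summable (\<lambda>n. (norm (B n *v (a *s Z n x)))\<^sup>2)"
        by (rule summable_norm_square_le[where C = "cmod a" and g = "\<lambda>n. B n *v Z n x"])
          (use x in \<open>auto simp: D_iff vector_scalar_mult_matrix norm_vector_scalar_mult\<close>)
      then show ?thesis using x by (simp add: D_iff X_closed Z_scaleC)
    qed
    fix y assume y: "y \<in> D"
    show "x + y \<in> D"
      using summable_norm_square_add[of "\<lambda>n. B n *v Z n x" "\<lambda>n. B n *v Z n y"] x y
      by (simp add: D_iff X_closed Z_add matrix_vector_right_distrib)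
  qed
  show ?thesis
    unfolding clinear_on_def
  proof (intro conjI ballI allI sub)
    fix x assume x: "x \<in> D"
    show "A (a *\<^sub>C x) = a *\<^sub>C A x" for a
    proof (rule Z_eqI)
      have ax: "a *\<^sub>C x \<in> D" using sub x by (simp add: csubspace_def)
      show "A (a *\<^sub>C x) \<in> X" "a *\<^sub>C A x \<in> X" using ax x by (auto intro: A_in X_closed)
      show "Z n (A (a *\<^sub>C x)) = Z n (a *\<^sub>C A x)" for n
        using ax x by (simp add: Z_A Z_scaleC D_subset A_in vector_scalar_mult_matrix)
    qed
    fix y assume y: "y \<in> D"
    show "A (x + y) = A x + A y"
    proof (rule Z_eqI)
      have xy: "x + y \<in> D" using sub x y by (simp add: csubspace_def)
      show "A (x + y) \<in> X" "A x + A y \<in> X" using xy x y by (auto intro: A_in X_closed)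
      show "Z n (A (x + y)) = Z n (A x + A y)" for n
        using xy x y by (simp add: Z_A Z_add D_subset A_in matrix_vector_right_distrib)
    qed
  qed
qed


subsection \<open>The group\<close>

lemma K_nonneg: "0 \<le> K"
proof -
  have "0 \<le> K * (norm (axis 1 1 :: complex ^ 3))\<^sup>2"
    by (rule order_trans[OF abs_ge_zero B_abs[of "axis 1 1" 0]])
  moreover have "0 < (norm (axis 1 1 :: complex ^ 3))\<^sup>2" by (simp add: axis_eq_0_iff)
  ultimately show ?thesis by (metis zero_le_mult_iff not_less order_less_imp_le)
qed

definition flow :: "nat \<Rightarrow> real \<Rightarrow> complex ^ 3 \<Rightarrow> complex ^ 3" where
  "flow n t y = (SOME f. f 0 = y \<and> solves (B n) f) t"

lemma flow_zero [simp]: "flow n 0 y = y"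
  and flow_solves: "solves (B n) (\<lambda>t. flow n t y)"
  using someI_ex[OF B_solution[of y n]] unfolding flow_def by auto

lemma flow_unique: "solves (B n) f \<Longrightarrow> f t = flow n t (f 0)"
  by (rule solves_unique[OF _ flow_solves _ B_abs]) auto

lemma flow_add: "flow n t (x + y) = flow n t x + flow n t y"
  using flow_unique[OF solves_add[OF flow_solves[of n x] flow_solves[of n y]], of t] by simp

lemma flow_scale: "flow n t (a *s x) = a *s flow n t x"
  using flow_unique[OF solves_scale[OF flow_solves[of n x]], of a t] by simp

lemma flow_flow: "flow n (t + r) x = flow n t (flow n r x)"
  using flow_unique[OF solves_shift[OF flow_solves[of n x]], of t r] by simp

lemma norm_flow_le: "norm (flow n t x) \<le> exp (K * \<bar>t\<bar>) * norm x"
  using energy_estimate_abs[OF flow_solves[of n x] B_abs, of t] by simp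

lemma flow_increment: "norm (flow n t x - x) \<le> \<bar>t\<bar> * (exp (K * \<bar>t\<bar>) * norm (B n *v x))"
  using solves_increment[OF flow_solves[of n x] B_abs K_nonneg, of t] by simp

lemma flow_derivative: "((\<lambda>t. flow n t x) has_vector_derivative B n *v x) (at 0)"
  using flow_solves[of n x] unfolding solves_def by (metis flow_zero)

definition T :: "real \<Rightarrow> 'v \<Rightarrow> 'v" where
  "T t x = (SOME y. y \<in> X \<and> (\<forall>n. Z n y = flow n t (Z n x)))"

lemma T:
  assumes x: "x \<in> X"
  shows T_in: "T t x \<in> X" and Z_T: "Z n (T t x) = flow n t (Z n x)"
proof -
  have "summable (\<lambda>n. (norm (flow n t (Z n x)))\<^sup>2)"
    by (rule summable_norm_square_le[OF Z_summable[OF x] norm_flow_le])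
  then have "\<exists>y. y \<in> X \<and> (\<forall>n. Z n y = flow n t (Z n x))"
    using Z_surj[of "\<lambda>n. flow n t (Z n x)"] by blast
  then have "T t x \<in> X \<and> (\<forall>n. Z n (T t x) = flow n t (Z n x))"
    unfolding T_def by (rule someI_ex)
  then show "T t x \<in> X" "Z n (T t x) = flow n t (Z n x)" by auto
qed

lemma difference_quotient_tendsto:
  fixes f :: "real \<Rightarrow> 'b::real_normed_vector"
  shows "(f has_vector_derivative f') (at t) \<longleftrightarrow> ((\<lambda>h. (1 / h) *\<^sub>R (f (t + h) - f t) - f') \<longlongrightarrow> 0) (at 0)"
proof -
  have eq: "norm (f (t + h) - f t - h *\<^sub>R f') / norm h = norm ((1 / h) *\<^sub>R (f (t + h) - f t) - f')"
    if "h \<noteq> 0" for h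
  proof -
    have "(1 / h) *\<^sub>R (f (t + h) - f t) - f' = (1 / h) *\<^sub>R (f (t + h) - f t - h *\<^sub>R f')"
      using that by (simp add: scaleR_diff_right)
    then show ?thesis by (simp only: norm_scaleR) simp
  qed
  have "(f has_vector_derivative f') (at t) \<longleftrightarrow>
      ((\<lambda>h. norm (f (t + h) - f t - h *\<^sub>R f') / norm h) \<longlongrightarrow> 0) (at 0)"
    by (simp add: has_vector_derivative_def has_derivative_at bounded_linear_scaleR_left)
  also have "\<dots> \<longleftrightarrow> ((\<lambda>h. norm ((1 / h) *\<^sub>R (f (t + h) - f t) - f')) \<longlongrightarrow> 0) (at 0)"
    by (rule Lim_cong_within) (use eq in auto)
  finally show ?thesis by (simp only: tendsto_norm_zero_iff)
qed

lemma T_group: "C0_group X N T"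
  unfolding C0_group_def bounded_operator_on_def clinear_on_def
proof (intro conjI allI ballI X)
  fix x assume x: "x \<in> X"
  show "T 0 x = x" by (rule Z_eqI) (use x in \<open>auto simp: T\<close>)
  show "T (r + t) x = T r (T t x)" for r t
    by (rule Z_eqI) (use x in \<open>auto simp: T flow_flow\<close>)
  show "T t (a *\<^sub>C x) = a *\<^sub>C T t x" for t a
    by (rule Z_eqI) (use x in \<open>auto simp: T X_closed Z_scaleC flow_scale\<close>)
  show "T t (x + y) = T t x + T t y" if y: "y \<in> X" for t y
    by (rule Z_eqI) (use x y in \<open>auto simp: T X_closed Z_add flow_add\<close>)
  show "((\<lambda>t. N (T t x - x)) \<longlongrightarrow> 0) (at 0)"
  proof (rule N_tendsto_zero)
    show "T t x - x \<in> X" for t by (intro X_closed T x)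
    show "((\<lambda>t. E (T t x - x)) \<longlongrightarrow> 0) (at 0)"
    proof (rule E_tendsto_zero_dominated)
      show "T t x - x \<in> X" for t by (intro X_closed T x)
      have "summable (\<lambda>n. (exp K + 1)\<^sup>2 * (norm (Z n x))\<^sup>2)" by (intro summable_mult Z_summable x)
      then show "summable (\<lambda>n. ((exp K + 1) * norm (Z n x))\<^sup>2)" by (simp add: power_mult_distrib)
      have "\<forall>\<^sub>F t in at 0. \<bar>t::real\<bar> < 1"
        unfolding eventually_at by (rule exI[of _ 1]) (simp add: dist_real_def)
      then show "\<forall>\<^sub>F t in at 0. \<forall>n. norm (Z n (T t x - x)) \<le> (exp K + 1) * norm (Z n x)"
      proof eventually_elim
        case (elim t)
        show ?case
        proof
          fix n
          have "norm (Z n (T t x - x)) \<le> norm (flow n t (Z n x)) + norm (Z n x)"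
            by (simp add: Z_simps T x norm_triangle_ineq4)
          also have "norm (flow n t (Z n x)) \<le> exp (K * \<bar>t\<bar>) * norm (Z n x)" by (rule norm_flow_le)
          also have "\<dots> \<le> exp K * norm (Z n x)"
            using elim K_nonneg by (intro mult_right_mono) (auto simp: mult_left_le)
          finally show "norm (Z n (T t x - x)) \<le> (exp K + 1) * norm (Z n x)" by (simp add: distrib_right)
        qed
      qed
      fix n
      have "isCont (\<lambda>t. flow n t (Z n x)) 0" by (rule has_vector_derivative_continuous[OF flow_derivative])
      then have "((\<lambda>t. flow n t (Z n x)) \<longlongrightarrow> Z n x) (at 0)" by (simp add: isCont_def)
      then show "((\<lambda>t. Z n (T t x - x)) \<longlongrightarrow> 0) (at 0)" by (simp add: Z_simps T x LIM_zero)
    qed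
  qed
next
  fix t
  show "T t ` X \<subseteq> X" using T by blast
  have "N (T t x) \<le> exp (K * \<bar>t\<bar>) * C / c * N x" if x: "x \<in> X" for x
  proof -
    have "c * N (T t x) \<le> E (T t x)" by (rule N_le[OF T_in[OF x]])
    also have "\<dots> \<le> exp (K * \<bar>t\<bar>) * E x"
      by (rule E_mono) (auto simp: T x norm_flow_le)
    also have "\<dots> \<le> exp (K * \<bar>t\<bar>) * (C * N x)" by (intro mult_left_mono le_N x) simp
    finally have "N (T t x) * c \<le> exp (K * \<bar>t\<bar>) * (C * N x)" by (simp only: mult.commute)
    then have "N (T t x) \<le> exp (K * \<bar>t\<bar>) * (C * N x) / c" using cC by (simp only: pos_le_divide_eq)
    then show ?thesis by simp
  qed
  then show "\<exists>M. \<forall>x\<in>X. N (T t x) \<le> M * N x" by blast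
qed

lemma Z_tendsto:
  assumes "\<And>t. x t \<in> X" "((\<lambda>t. N (x t)) \<longlongrightarrow> 0) F"
  shows "((\<lambda>t. Z n (x t)) \<longlongrightarrow> 0) F"
proof (rule Lim_null_comparison)
  show "((\<lambda>t. C * N (x t)) \<longlongrightarrow> 0) F" using tendsto_mult[OF tendsto_const assms(2), of C] by simp
  show "\<forall>\<^sub>F t in F. norm (Z n (x t)) \<le> C * N (x t)"
    by (intro always_eventually allI order_trans[OF norm_Z_le[OF assms(1)] le_N[OF assms(1)]])
qed

text \<open>The difference quotients of an orbit are dominated blockwise by \<open>A x\<close>, so they converge if
  \<open>x\<close> is in the domain. Conversely a limit of the difference quotients has the blocks of \<open>A x\<close>,
  so these are square summable.\<close>

lemma T_generator: "generator_graph X N T = {(x, A x) |x. x \<in> D}"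
proof (intro equalityI subsetI)
  fix p assume "p \<in> generator_graph X N T"
  then obtain x y where p: "p = (x, y)" and x: "x \<in> X" and y: "y \<in> X"
    and lim: "((\<lambda>t. N ((1 / t) *\<^sub>R (T t x - x) - y)) \<longlongrightarrow> 0) (at 0)"
    by (auto simp: generator_graph_def)
  have Zy: "Z n y = B n *v Z n x" for n
  proof -
    have "((\<lambda>t. Z n ((1 / t) *\<^sub>R (T t x - x) - y)) \<longlongrightarrow> 0) (at 0)"
      by (rule Z_tendsto[OF _ lim]) (intro X_closed T x y)
    then have "((\<lambda>t. (1 / t) *\<^sub>R (flow n (0 + t) (Z n x) - flow n 0 (Z n x)) - Z n y) \<longlongrightarrow> 0) (at 0)"
      by (simp add: Z_simps T x y X_closed)
    then have "((\<lambda>t. flow n t (Z n x)) has_vector_derivative Z n y) (at 0)"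
      by (simp only: difference_quotient_tendsto)
    then show ?thesis using flow_derivative vector_derivative_unique_at by blast
  qed
  then have xD: "x \<in> D" using Z_summable[OF y] x by (simp add: D_iff)
  have "y = A x" by (rule Z_eqI) (use xD y Zy in \<open>auto simp: A_in Z_A\<close>)
  then show "p \<in> {(x, A x) |x. x \<in> D}" using p xD by blast
next
  fix p assume "p \<in> {(x, A x) |x. x \<in> D}"
  then obtain x where p: "p = (x, A x)" and xD: "x \<in> D" by blast
  note x = D_subset[OF xD]
  let ?q = "\<lambda>t. (1 / t) *\<^sub>R (T t x - x) - A x"
  have q: "?q t \<in> X" for t by (intro X_closed T x A_in xD)
  have Zq: "Z n (?q t) = (1 / t) *\<^sub>R (flow n t (Z n x) - Z n x) - B n *v Z n x" for n t
    by (simp add: Z_simps T x A_in xD X_closed Z_A)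
  have "((\<lambda>t. N (?q t)) \<longlongrightarrow> 0) (at 0)"
  proof (intro N_tendsto_zero q E_tendsto_zero_dominated)
    have "summable (\<lambda>n. (exp K + 1)\<^sup>2 * (norm (B n *v Z n x))\<^sup>2)"
      using xD by (intro summable_mult) (simp add: D_iff)
    then show "summable (\<lambda>n. ((exp K + 1) * norm (B n *v Z n x))\<^sup>2)" by (simp add: power_mult_distrib)
    have "\<forall>\<^sub>F t in at 0. \<bar>t::real\<bar> < 1 \<and> t \<noteq> 0"
      unfolding eventually_at by (rule exI[of _ 1]) (simp add: dist_real_def)
    then show "\<forall>\<^sub>F t in at 0. \<forall>n. norm (Z n (?q t)) \<le> (exp K + 1) * norm (B n *v Z n x)"
    proof eventually_elim
      case (elim t)
      show ?case
      proof
        fix n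
        have "norm (Z n (?q t)) \<le> norm ((1 / t) *\<^sub>R (flow n t (Z n x) - Z n x)) + norm (B n *v Z n x)"
          unfolding Zq by (rule norm_triangle_ineq4)
        also have "norm ((1 / t) *\<^sub>R (flow n t (Z n x) - Z n x)) = norm (flow n t (Z n x) - Z n x) / \<bar>t\<bar>"
          by simp
        also have "\<dots> \<le> exp (K * \<bar>t\<bar>) * norm (B n *v Z n x)"
          using flow_increment[of n t "Z n x"] elim by (simp add: pos_divide_le_eq mult.commute)
        also have "\<dots> \<le> exp K * norm (B n *v Z n x)"
          using elim K_nonneg by (intro mult_right_mono) (auto simp: mult_left_le)
        finally show "norm (Z n (?q t)) \<le> (exp K + 1) * norm (B n *v Z n x)" by (simp add: distrib_right)
      qed
    qed
    show "((\<lambda>t. Z n (?q t)) \<longlongrightarrow> 0) (at 0)" for n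
      using flow_derivative[of n "Z n x"] unfolding difference_quotient_tendsto Zq by simp
  qed
  then show "p \<in> generator_graph X N T" using p x A_in[OF xD] by (simp add: generator_graph_def)
qed

lemma generates_T: "generates_C0_group X N D A T"
  unfolding generates_C0_group_def by (rule conjI[OF T_group T_generator])


subsection \<open>Decay of all solutions\<close>

context
  fixes T' :: "real \<Rightarrow> 'v \<Rightarrow> 'v"
  assumes T': "generates_C0_group X N D A T'"
begin

lemma T'_group: "C0_group X N T'"
  using T' unfolding generates_C0_group_def by (rule conjunct1)

lemma T'_generator: "generator_graph X N T' = {(x, A x) |x. x \<in> D}"
  using T' unfolding generates_C0_group_def by (rule conjunct2)

lemma T'_operator: "bounded_operator_on X N (T' t)"
  using T'_group unfolding C0_group_def by (elim conjE allE)

lemma T'_zero: "x \<in> X \<Longrightarrow> T' 0 x = x"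
  using T'_group unfolding C0_group_def by (elim conjE) (rule bspec)

lemma T'_add: "x \<in> X \<Longrightarrow> T' (r + t) x = T' r (T' t x)"
  using T'_group unfolding C0_group_def by (elim conjE allE) (rule bspec)

lemma T'_bounded: "x \<in> X \<Longrightarrow> T' t x \<in> X" "\<exists>M. \<forall>x\<in>X. N (T' t x) \<le> M * N x"
  using T'_operator[of t] unfolding bounded_operator_on_def by auto

lemma T'_diff: "x \<in> X \<Longrightarrow> y \<in> X \<Longrightarrow> T' t (x - y) = T' t x - T' t y"
  and T'_scaleR: "x \<in> X \<Longrightarrow> T' t (r *\<^sub>R x) = r *\<^sub>R T' t x"
proof -
  have lin: "clinear_on X (T' t)"
    using T'_operator[of t] by (simp add: bounded_operator_on_def)
  then show sc: "T' t (r *\<^sub>R x) = r *\<^sub>R T' t x" if "x \<in> X" for r x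
    using that unfolding clinear_on_def by (metis scaleC_of_real)
  show "T' t (x - y) = T' t x - T' t y" if "x \<in> X" "y \<in> X" for x y
  proof -
    have "T' t (x + (-1) *\<^sub>R y) = T' t x + T' t ((-1) *\<^sub>R y)"
      using lin that X_closed(4)[of y "-1"] unfolding clinear_on_def by blast
    then show ?thesis using sc[OF that(2), of "-1"] by simp
  qed
qed

text \<open>The group leaves the domain invariant, so the blocks of an orbit starting in the domain solve
  their differential equations.\<close>

lemma T'_solves:
  assumes xD: "x \<in> D"
  shows "solves (B n) (\<lambda>t. Z n (T' t x))"
  unfolding solves_def
proof
  fix t
  note x = D_subset[OF xD]
  note gen = T'_generator and add = T'_add
  obtain M where M: "\<And>y. y \<in> X \<Longrightarrow> N (T' t y) \<le> M * N y" using T'_bounded(2)[of t] by blast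
  let ?q = "\<lambda>h. (1 / h) *\<^sub>R (T' h x - x) - A x"
  let ?z = "T' t x"
  have q: "?q h \<in> X" for h by (intro X_closed T'_bounded x A_in xD)
  have z: "?z \<in> X" by (rule T'_bounded(1)[OF x])
  have eq: "(1 / h) *\<^sub>R (T' h ?z - ?z) - T' t (A x) = T' t (?q h)" for h
  proof -
    have "T' h ?z = T' t (T' h x)" using add[OF x, of h t] add[OF x, of t h] by (simp add: add.commute)
    then show ?thesis
      by (simp add: T'_diff T'_scaleR X_closed T'_bounded(1) x A_in xD)
  qed
  have "(x, A x) \<in> generator_graph X N T'" using gen xD by blast
  then have lim: "((\<lambda>h. N (?q h)) \<longlongrightarrow> 0) (at 0)" by (simp add: generator_graph_def)
  have lim': "((\<lambda>h. N ((1 / h) *\<^sub>R (T' h ?z - ?z) - T' t (A x))) \<longlongrightarrow> 0) (at 0)"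
    unfolding eq
  proof (rule tendsto_sandwich[OF _ _ tendsto_const])
    show "\<forall>\<^sub>F h in at 0. 0 \<le> N (T' t (?q h))" using N_nonneg[OF T'_bounded(1)[OF q]] by simp
    show "\<forall>\<^sub>F h in at 0. N (T' t (?q h)) \<le> M * N (?q h)" using M[OF q] by simp
    show "((\<lambda>h. M * N (?q h)) \<longlongrightarrow> 0) (at 0)" using tendsto_mult[OF tendsto_const lim, of M] by simp
  qed
  then have "(?z, T' t (A x)) \<in> generator_graph X N T'"
    using z T'_bounded(1)[OF A_in[OF xD]] by (simp add: generator_graph_def)
  then have zD: "?z \<in> D" and Az: "T' t (A x) = A ?z" using gen by auto
  have "((\<lambda>h. Z n ((1 / h) *\<^sub>R (T' h ?z - ?z) - A ?z)) \<longlongrightarrow> 0) (at 0)"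
    by (rule Z_tendsto) (use lim' Az in \<open>auto intro!: X_closed T'_bounded z A_in zD\<close>)
  then have "((\<lambda>h. (1 / h) *\<^sub>R (Z n (T' (t + h) x) - Z n ?z) - B n *v Z n ?z) \<longlongrightarrow> 0) (at 0)"
    using add[OF x] by (simp add: Z_simps X_closed T'_bounded(1) z A_in zD Z_A add.commute)
  then show "((\<lambda>t. Z n (T' t x)) has_vector_derivative B n *v Z n ?z) (at t)"
    by (simp only: difference_quotient_tendsto)
qed

text \<open>The blockwise energy estimate extends from the dense domain to all initial values.\<close>

lemma decay_block:
  assumes x: "x \<in> X" and t: "0 \<le> t"
  shows "norm (Z n (T' t x)) \<le> exp (s * t) * norm (Z n x)"
proof (rule field_le_epsilon)
  fix e :: real assume e: "0 < e"
  obtain M where M: "\<And>y. y \<in> X \<Longrightarrow> N (T' t y) \<le> M * N y" using T'_bounded(2)[of t] by blast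
  \<comment> \<open>Monotonicity of multiplication by the bound requires a positive one.\<close>
  define M' where "M' = \<bar>M\<bar> + 1"
  have "((\<lambda>k. C * M' / c * E (x - trunc {..<k} x)) \<longlonglongrightarrow> C * M' / c * 0)"
    by (intro tendsto_mult tendsto_const trunc_tendsto x)
  then have "\<forall>\<^sub>F k in sequentially. C * M' / c * E (x - trunc {..<k} x) < e"
    using e by (intro order_tendstoD(2)) auto
  then obtain k where k: "C * M' / c * E (x - trunc {..<k} x) < e"
    by (auto simp: eventually_sequentially)
  let ?y = "trunc {..<k} x"
  have y: "?y \<in> D" "?y \<in> X" by (simp_all add: trunc)
  have d: "x - ?y \<in> X" by (intro X_closed x y)
  have "norm (Z n (T' t x) - Z n (T' t ?y)) = norm (Z n (T' t (x - ?y)))"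
    by (simp add: T'_diff x y T'_bounded Z_simps)
  also have "\<dots> \<le> C * N (T' t (x - ?y))"
    using norm_Z_le le_N T'_bounded(1)[OF d] by (meson order_trans)
  also have "\<dots> \<le> C * (M' * N (x - ?y))"
  proof (intro mult_left_mono)
    have "N (T' t (x - ?y)) \<le> M * N (x - ?y)" by (rule M[OF d])
    also have "\<dots> \<le> M' * N (x - ?y)" by (intro mult_right_mono N_nonneg d) (simp add: M'_def)
    finally show "N (T' t (x - ?y)) \<le> M' * N (x - ?y)" .
  qed (use cC in simp)
  also have "\<dots> \<le> C * (M' * (E (x - ?y) / c))"
    using N_le[OF d] cC by (intro mult_left_mono) (auto simp: M'_def pos_le_divide_eq mult.commute)
  also have "\<dots> < e" using k by simp
  finally have 1: "norm (Z n (T' t x) - Z n (T' t ?y)) \<le> e" by simp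
  have "norm (Z n (T' t ?y)) \<le> exp (s * t) * norm (Z n (T' 0 ?y))"
    by (rule energy_estimate[OF T'_solves[OF y(1)] B_upper t])
  also have "norm (Z n (T' 0 ?y)) \<le> norm (Z n x)" by (simp add: T'_zero y trunc)
  finally have 2: "norm (Z n (T' t ?y)) \<le> exp (s * t) * norm (Z n x)" by simp
  show "norm (Z n (T' t x)) \<le> exp (s * t) * norm (Z n x) + e"
    using 1 2 norm_triangle_ineq2[of "Z n (T' t x)" "Z n (T' t ?y)"] by linarith
qed

end

theorem solution_decay:
  assumes "solution X N D A U" "0 \<le> t"
  shows "E (U t) \<le> exp (s * t) * E (U 0)"
proof -
  obtain T' where T': "generates_C0_group X N D A T'" "U 0 \<in> X" "\<And>t. U t = T' t (U 0)"
    using assms(1) unfolding solution_def by blast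
  show ?thesis
    unfolding T'(3)[of t] using T'(2)
    by (intro E_mono decay_block[OF T'(1)] T'_bounded(1)[OF T'(1)] assms) auto
qed

text \<open>In the block of an eigenvector the solution is an explicit exponential, and a single block bounds
  the norm from below.\<close>

theorem growing_solution:
  assumes v: "B n *v v = a *s v" "v \<noteq> 0" and a: "\<omega> < Re a"
  shows "\<exists>U. solution X N D A U \<and> filterlim (\<lambda>t. E (U t) * exp (- \<omega> * t)) at_top at_top"
proof -
  have "summable (\<lambda>k. (norm (if k = n then v else 0))\<^sup>2)"
    by (rule summable_finite[of "{n}"]) auto
  then obtain x where x: "x \<in> X" "\<And>k. Z k x = (if k = n then v else 0)"
    using Z_surj[of "\<lambda>k. if k = n then v else 0"] by auto
  have "solution X N D A (\<lambda>t. T t x)"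
    unfolding solution_def
  proof (intro exI conjI allI)
    show "generates_C0_group X N D A T" by (rule generates_T)
    have "T 0 x = x" by (rule Z_eqI) (auto simp: T x(1))
    then show "T 0 x \<in> X" "T t x = T t (T 0 x)" for t using x(1) by simp_all
  qed
  moreover have "filterlim (\<lambda>t. E (T t x) * exp (- \<omega> * t)) at_top at_top"
  proof (rule filterlim_at_top_mono)
    have "filterlim (\<lambda>t. (Re a - \<omega>) * t) at_top at_top"
      using a by (intro filterlim_tendsto_pos_mult_at_top[OF tendsto_const _ filterlim_ident]) simp
    then have "filterlim (\<lambda>t. exp ((Re a - \<omega>) * t)) at_top at_top"
      by (rule filterlim_compose[OF exp_at_top])
    then show "filterlim (\<lambda>t. norm v * exp ((Re a - \<omega>) * t)) at_top at_top"
      using v(2) by (intro filterlim_tendsto_pos_mult_at_top[OF tendsto_const]) simp_all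
    have "norm v * exp ((Re a - \<omega>) * t) \<le> E (T t x) * exp (- \<omega> * t)" for t
    proof -
      have "Z n (T t x) = exp (t *\<^sub>R a) *s v"
        using flow_unique[OF solves_exponential[OF v(1)], of t] by (simp add: T x)
      then have "norm (Z n (T t x)) = exp (Re a * t) * norm v"
        by (simp add: norm_vector_scalar_mult mult.commute)
      then have "exp (Re a * t) * norm v \<le> E (T t x)" using norm_Z_le[OF T_in[OF x(1)], of n t] by simp
      then have "exp (Re a * t) * norm v * exp (- \<omega> * t) \<le> E (T t x) * exp (- \<omega> * t)"
        by (intro mult_right_mono) auto
      moreover have "exp (Re a * t) * norm v * exp (- \<omega> * t) = norm v * exp ((Re a - \<omega>) * t)"
        by (simp add: left_diff_distrib exp_diff exp_minus field_simps)
      ultimately show ?thesis by (simp only:)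
    qed
    then show "\<forall>\<^sub>F t in at_top. norm v * exp ((Re a - \<omega>) * t) \<le> E (T t x) * exp (- \<omega> * t)" by simp
  qed
  ultimately show ?thesis by blast
qed

end


section \<open>Normality\<close>

text \<open>For a normal operator, an eigenvector \<open>y\<close> with eigenvalue \<open>a\<close> is an eigenvector of the
  adjoint with eigenvalue \<open>cnj a\<close>, hence orthogonal to the range of \<open>A - a\<close>. So it cannot be the
  image of a generalized eigenvector \<open>x\<close>.\<close>

lemma normal_operator_no_jordan_block:
  assumes A: "normal_operator X ip D A"
    and D: "x \<in> D" "y \<in> D" and Ax: "A x = a *\<^sub>C x + y" and Ay: "A y = a *\<^sub>C y"
  shows "y = 0"
proof (rule ccontr)
  assume "y \<noteq> 0"
  have sp: "scalar_product_on X ip" and DX: "D \<subseteq> X"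
    and dom: "Domain (adjoint_graph X ip D A) = D"
    and nrm: "\<And>y z. (y, z) \<in> adjoint_graph X ip D A \<Longrightarrow> ip_norm ip z = ip_norm ip (A y)"
    using A unfolding normal_operator_def by auto
  note sp' = sp[unfolded scalar_product_on_def]
  note X = sp'[THEN conjunct1]
    and herm = sp'[THEN conjunct2, THEN conjunct1, rule_format]
    and add = sp'[THEN conjunct2, THEN conjunct2, THEN conjunct1, rule_format]
    and scale = sp'[THEN conjunct2, THEN conjunct2, THEN conjunct2, THEN conjunct1, rule_format]
    and pos = sp'[THEN conjunct2, THEN conjunct2, THEN conjunct2, THEN conjunct2, rule_format]
  have cl: "\<And>x y. x \<in> X \<Longrightarrow> y \<in> X \<Longrightarrow> x + y \<in> X" "\<And>a x. x \<in> X \<Longrightarrow> a *\<^sub>C x \<in> X"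
    using X unfolding csubspace_def by auto
  have xX: "x \<in> X" and yX: "y \<in> X" using D DX by auto
  obtain z where z: "(y, z) \<in> adjoint_graph X ip D A" using D(2) dom by blast
  then have zX: "z \<in> X" and zip: "\<And>x. x \<in> D \<Longrightarrow> ip y (A x) = ip z x"
    by (auto simp: adjoint_graph_def)
  have addl: "ip (x + y) z = ip x z + ip y z" if "x \<in> X" "y \<in> X" "z \<in> X" for x y z
    using herm[of "x + y" z] herm[of x z] herm[of y z] add[of z x y] that cl by simp
  have scalel: "ip (a *\<^sub>C x) z = cnj a * ip x z" if "x \<in> X" "z \<in> X" for a x z
    using herm[of "a *\<^sub>C x" z] herm[of x z] scale[of z x a] that cl by simp
  define p where "p = ip y y"
  have zy: "ip z y = a * p" using zip[OF D(2)] by (simp add: Ay scale yX p_def)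
  have pc: "cnj p = p" unfolding p_def by (rule herm[OF yX yX, symmetric])
  have yz: "ip y z = cnj a * p" using herm[OF yX zX] by (simp add: zy pc)
  have "Re (ip z z) = Re (ip (A y) (A y))" using nrm[OF z] by (simp add: ip_norm_def)
  also have "ip (A y) (A y) = a * (cnj a * p)" by (simp add: Ay scale scalel cl yX p_def)
  finally have zz: "Re (ip z z) = Re (a * (cnj a * p))" .
  define d where "d = z + (- cnj a) *\<^sub>C y"
  have dX: "d \<in> X" by (simp add: d_def cl zX yX)
  have "ip d d = ip z z - a * (cnj a * p)"
    unfolding d_def by (simp add: add addl scale scalel cl zX yX zy yz p_def[symmetric] algebra_simps)
  then have "Re (ip d d) = 0" using zz by (simp only: minus_complex.sel diff_self)
  then have "d = 0" using pos[OF dX] by force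
  then have "z = cnj a *\<^sub>C y"
    using scaleC_add_left[of "cnj a" "- cnj a" y]
    unfolding d_def by (metis add_right_cancel add.right_inverse scaleC_zero_left)
  then have "ip z x = a * ip y x" by (simp add: scalel xX yX)
  moreover have "ip y (A x) = a * ip y x + p" by (simp add: Ax add scale cl xX yX p_def)
  ultimately have "p = 0" using zip[OF D(1)] by simp
  then show False using pos[OF yX \<open>y \<noteq> 0\<close>] by (simp add: p_def)
qed

definition cdot :: "complex ^ 3 \<Rightarrow> complex ^ 3 \<Rightarrow> complex" where
  "cdot x y = (\<Sum>k\<in>UNIV. cnj (x $ k) * y $ k)"

lemma cdot_self: "cdot x x = complex_of_real ((norm x)\<^sup>2)"
proof -
  have "cnj z * z = complex_of_real ((cmod z)\<^sup>2)" for z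
    by (metis complex_norm_square mult.commute of_real_power)
  then show ?thesis by (simp add: cdot_def norm_vec_def L2_set_def sum_nonneg del: of_real_power)
qed

lemma cmod_cdot_le: "cmod (cdot x y) \<le> 3 * ((norm x)\<^sup>2 + (norm y)\<^sup>2)"
proof -
  have "cmod (cdot x y) \<le> (\<Sum>k\<in>(UNIV :: 3 set). (norm x)\<^sup>2 + (norm y)\<^sup>2)"
    unfolding cdot_def
  proof (rule sum_norm_le)
    fix k :: 3
    have "cmod (cnj (x $ k) * y $ k) \<le> norm x * norm y"
      unfolding norm_mult complex_mod_cnj
      by (intro mult_mono Finite_Cartesian_Product.norm_nth_le) auto
    also have "\<dots> \<le> (norm x)\<^sup>2 + (norm y)\<^sup>2"
    proof -
      have "0 \<le> (norm x)\<^sup>2" "0 \<le> (norm y)\<^sup>2" by simp_all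
      then show ?thesis using sum_squares_bound[of "norm x" "norm y"] by linarith
    qed
    finally show "cmod (cnj (x $ k) * y $ k) \<le> (norm x)\<^sup>2 + (norm y)\<^sup>2" .
  qed
  then show ?thesis by (simp add: algebra_simps)
qed

context block_system
begin

definition block_ip :: "'v \<Rightarrow> 'v \<Rightarrow> complex" where
  "block_ip x y = (\<Sum>n. cdot (Z n x) (Z n y))"

lemma block_ip_summable:
  assumes "x \<in> X" "y \<in> X"
  shows "summable (\<lambda>n. cdot (Z n x) (Z n y))"
proof (rule summable_comparison_test')
  show "summable (\<lambda>n. 3 * ((norm (Z n x))\<^sup>2 + (norm (Z n y))\<^sup>2))"
    by (intro summable_mult summable_add Z_summable assms)
qed (rule cmod_cdot_le)

lemma block_ip_self: "x \<in> X \<Longrightarrow> block_ip x x = complex_of_real ((E x)\<^sup>2)"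
  by (simp add: block_ip_def cdot_self E_square suminf_of_real[OF Z_summable] del: of_real_power)

lemma ip_norm_block_ip: "x \<in> X \<Longrightarrow> ip_norm block_ip x = E x"
  by (simp add: ip_norm_def block_ip_self E_nonneg del: of_real_power)

lemma scalar_product_block_ip: "scalar_product_on X block_ip"
  unfolding scalar_product_on_def
proof (intro conjI ballI allI impI X)
  fix x assume x: "x \<in> X"
  show "0 < Re (block_ip x x)" if "x \<noteq> 0"
  proof -
    have "E x \<noteq> 0" using norm_on_E x that by (simp add: norm_on_def)
    then show ?thesis using E_nonneg[OF x] by (simp add: block_ip_self x del: of_real_power)
  qed
  fix y assume y: "y \<in> X"
  show "block_ip x y = cnj (block_ip y x)"
  proof -
    have "(\<lambda>n. cnj (cdot (Z n y) (Z n x))) sums cnj (block_ip y x)"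
      unfolding block_ip_def
      by (intro bounded_linear.sums[OF bounded_linear_cnj] summable_sums block_ip_summable x y)
    moreover have "cnj (cdot a b) = cdot b a" for a b by (simp add: cdot_def mult.commute)
    ultimately show ?thesis unfolding block_ip_def by (simp add: sums_iff)
  qed
  show "block_ip x (a *\<^sub>C y) = a * block_ip x y" for a
  proof -
    have "cdot (Z n x) (Z n (a *\<^sub>C y)) = a * cdot (Z n x) (Z n y)" for n
      by (simp add: cdot_def Z_scaleC y sum_distrib_left mult.left_commute)
    then show ?thesis by (simp add: block_ip_def suminf_mult block_ip_summable x y)
  qed
  fix z assume z: "z \<in> X"
  have "cdot (Z n x) (Z n (y + z)) = cdot (Z n x) (Z n y) + cdot (Z n x) (Z n z)" for n
    by (simp add: cdot_def Z_add y z sum.distrib distrib_left)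
  then show "block_ip x (y + z) = block_ip x y + block_ip x z"
    by (simp add: block_ip_def suminf_add block_ip_summable x y z)
qed

text \<open>If all blocks are diagonal, then testing against basis vectors shows that the adjoint acts
  by the conjugate eigenvalues.\<close>

lemma normal_diagonal:
  assumes diag: "\<And>n y j. (B n *v y) $ j = l n j * y $ j"
  shows "normal_operator X block_ip D A"
proof -
  have norm_eq: "norm x = norm (B n *v y)" if "\<And>j. x $ j = cnj (l n j) * y $ j" for x y n
    by (simp add: norm_vec_def that diag norm_mult)
  have adj: "Z n z $ j = cnj (l n j) * Z n y $ j"
    if "(y, z) \<in> adjoint_graph X block_ip D A" for y z n j
  proof -
    have yz: "y \<in> X" "z \<in> X" "\<And>x. x \<in> D \<Longrightarrow> block_ip y (A x) = block_ip z x"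
      using that by (auto simp: adjoint_graph_def)
    let ?e = "\<lambda>k. if k = n then axis j 1 else 0 :: complex ^ 3"
    have "summable (\<lambda>k. (norm (?e k))\<^sup>2)" by (rule summable_finite[of "{n}"]) auto
    then obtain x where x: "x \<in> X" "\<And>k. Z k x = ?e k" using Z_surj[of ?e] by blast
    have "summable (\<lambda>k. (norm (B k *v Z k x))\<^sup>2)"
      by (rule summable_finite[of "{n}"]) (auto simp: x(2))
    then have xD: "x \<in> D" using x by (simp add: D_iff)
    have e: "cdot a (axis j 1) = cnj (a $ j)" for a
      by (simp add: cdot_def axis_def if_distrib[of "(*) _"] cong: if_cong)
    have "B n *v axis j 1 = l n j *s axis j 1"
      by (simp add: vec_eq_iff diag axis_def)
    then have "cdot (Z k y) (Z k (A x)) = (if k = n then l n j * cnj (Z n y $ j) else 0)" for k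
      by (simp add: Z_A[OF xD] x(2) cdot_def axis_def if_distrib[of "(*) _"] mult.commute cong: if_cong)
    then have 1: "block_ip y (A x) = l n j * cnj (Z n y $ j)"
      unfolding block_ip_def by (subst suminf_finite[of "{n}"]) auto
    have "cdot (Z k z) (Z k x) = (if k = n then cnj (Z n z $ j) else 0)" for k
      by (simp add: x(2) e) (simp add: cdot_def)
    then have 2: "block_ip z x = cnj (Z n z $ j)"
      unfolding block_ip_def by (subst suminf_finite[of "{n}"]) auto
    have "cnj (Z n z $ j) = l n j * cnj (Z n y $ j)" using yz(3)[OF xD] 1 2 by simp
    then show ?thesis by (metis complex_cnj_cnj complex_cnj_mult)
  qed
  show ?thesis
    unfolding normal_operator_def
  proof (intro conjI ballI allI impI scalar_product_block_ip clinear_on_A)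
    show "D \<subseteq> X" "A ` D \<subseteq> X" using D_subset A_in by auto
    show "\<exists>y\<in>D. ip_norm block_ip (x - y) < e" if x: "x \<in> X" and e: "0 < e" for x and e :: real
    proof -
      have "\<forall>\<^sub>F k in sequentially. E (x - trunc {..<k} x) < e"
        by (rule order_tendstoD(2)[OF trunc_tendsto[OF x] e])
      then obtain k where k: "E (x - trunc {..<k} x) < e" by (auto simp: eventually_sequentially)
      show ?thesis
        by (rule bexI[of _ "trunc {..<k} x"]) (use k x in \<open>auto simp: ip_norm_block_ip X_closed trunc\<close>)
    qed
    show "Domain (adjoint_graph X block_ip D A) = D"
    proof (intro equalityI subsetI)
      fix y assume "y \<in> Domain (adjoint_graph X block_ip D A)"
      then obtain z where z: "(y, z) \<in> adjoint_graph X block_ip D A" by blast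
      then have yz: "y \<in> X" "z \<in> X" by (auto simp: adjoint_graph_def)
      have "norm (Z n z) = norm (B n *v Z n y)" for n by (rule norm_eq[OF adj[OF z]])
      then show "y \<in> D" using Z_summable[OF yz(2)] yz by (simp add: D_iff)
    next
      fix y assume y: "y \<in> D"
      let ?f = "\<lambda>n. \<chi> j. cnj (l n j) * Z n y $ j"
      have "norm (?f n) = norm (B n *v Z n y)" for n by (rule norm_eq) simp
      then have "summable (\<lambda>n. (norm (?f n))\<^sup>2)" using y by (simp add: D_iff)
      then obtain z where z: "z \<in> X" "\<And>n. Z n z = ?f n" using Z_surj[of ?f] by blast
      have "block_ip y (A x) = block_ip z x" if x: "x \<in> D" for x
        unfolding block_ip_def cdot_def by (simp add: Z_A x z diag mult.assoc mult.left_commute)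
      then have "(y, z) \<in> adjoint_graph X block_ip D A"
        using D_subset[OF y] z by (simp add: adjoint_graph_def)
      then show "y \<in> Domain (adjoint_graph X block_ip D A)" by blast
    qed
    show "case p of (y, z) \<Rightarrow> ip_norm block_ip z = ip_norm block_ip (A y)"
      if p: "p \<in> adjoint_graph X block_ip D A" for p
    proof (cases p)
      case (Pair y z)
      then have pz: "(y, z) \<in> adjoint_graph X block_ip D A" using p by simp
      then have yz: "y \<in> X" "z \<in> X" by (auto simp: adjoint_graph_def)
      have n: "norm (Z n z) = norm (B n *v Z n y)" for n by (rule norm_eq[OF adj[OF pz]])
      then have yD: "y \<in> D" using Z_summable[OF yz(2)] yz by (simp add: D_iff)
      have "E z = E (A y)" by (simp add: block_norm_def n Z_A yD)
      then show ?thesis using Pair by (simp add: ip_norm_block_ip yz A_in yD)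
    qed
  qed
qed

end


section \<open>Coordinates in the phase spaces\<close>

lemma weight_O_powr:
  assumes "0 < m"
  shows "case exponents i of (p, q, r) \<Rightarrow>
    (m powr p)\<^sup>2 = weight_O i m $ 1 \<and> (m powr q)\<^sup>2 = weight_O i m $ 2 \<and> (m powr r)\<^sup>2 = weight_O i m $ 3"
proof -
  have h: "(m powr (1/2))\<^sup>2 = m" using assms by (simp add: powr_half_sqrt)
  have "(m powr (3/2))\<^sup>2 = m powr 3" by (simp add: power2_eq_square flip: powr_add)
  then have "(m powr (3/2))\<^sup>2 = m ^ 3" using assms by simp
  then show ?thesis
    using assms h by (cases i) (simp_all add: weight_O_def power2_eq_square power3_eq_cube)
qed

lemma weight_O_pos: "0 < m \<Longrightarrow> 0 < weight_O i m $ k"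
  using exhaust_3[of k] by (cases i) (auto simp: weight_O_def)

lemma weight_O_mono: "0 < m \<Longrightarrow> m \<le> m' \<Longrightarrow> weight_O i m $ k \<le> weight_O i m' $ k"
  using exhaust_3[of k] by (cases i) (auto simp: weight_O_def intro!: mult_mono power_mono)

definition weighted_norm :: "space_index \<Rightarrow> real \<Rightarrow> complex ^ 3 \<Rightarrow> real" where
  "weighted_norm i m x = sqrt (\<Sum>k\<in>UNIV. weight_O i m $ k * (cmod (x $ k))\<^sup>2)"

lemma weighted_norm_square:
  "0 < m \<Longrightarrow> (weighted_norm i m x)\<^sup>2 = (\<Sum>k\<in>UNIV. weight_O i m $ k * (cmod (x $ k))\<^sup>2)"
  unfolding weighted_norm_def
  by (rule real_sqrt_pow2) (intro sum_nonneg mult_nonneg_nonneg, simp_all add: weight_O_pos less_imp_le)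

lemma weighted_norm_nonneg: "0 < m \<Longrightarrow> 0 \<le> weighted_norm i m x"
  unfolding weighted_norm_def
  by (intro real_sqrt_ge_zero sum_nonneg mult_nonneg_nonneg) (simp_all add: weight_O_pos less_imp_le)

lemma component_le_weighted_norm:
  assumes "0 < m"
  shows "sqrt (weight_O i m $ k) * cmod (x $ k) \<le> weighted_norm i m x"
proof -
  have "weight_O i m $ k * (cmod (x $ k))\<^sup>2 \<le> (\<Sum>k\<in>UNIV. weight_O i m $ k * (cmod (x $ k))\<^sup>2)"
    by (rule member_le_sum)
      (auto intro: mult_nonneg_nonneg[OF less_imp_le[OF weight_O_pos[OF assms]] zero_le_power2])
  then have "sqrt (weight_O i m $ k * (cmod (x $ k))\<^sup>2) \<le> weighted_norm i m x"
    unfolding weighted_norm_def by (rule real_sqrt_le_mono)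
  then show ?thesis by (simp add: real_sqrt_mult)
qed

lemma weighted_norm_eq_L2_set:
  "0 < m \<Longrightarrow> weighted_norm i m x = L2_set (\<lambda>k. sqrt (weight_O i m $ k) * cmod (x $ k)) UNIV"
  using weight_O_pos[of m i] by (simp add: weighted_norm_def L2_set_def power_mult_distrib less_imp_le)

lemma weighted_norm_add:
  assumes m: "0 < m"
  shows "weighted_norm i m (x + y) \<le> weighted_norm i m x + weighted_norm i m y"
proof -
  have "weighted_norm i m (x + y) \<le> L2_set (\<lambda>k. sqrt (weight_O i m $ k) * cmod (x $ k)
      + sqrt (weight_O i m $ k) * cmod (y $ k)) UNIV"
    unfolding weighted_norm_eq_L2_set[OF m] distrib_left[symmetric] vector_add_component
    by (intro L2_set_mono mult_left_mono norm_triangle_ineq mult_nonneg_nonneg real_sqrt_ge_zero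
        less_imp_le[OF weight_O_pos[OF m]] norm_ge_zero)
  also have "\<dots> \<le> weighted_norm i m x + weighted_norm i m y"
    unfolding weighted_norm_eq_L2_set[OF m] by (rule L2_set_triangle_ineq)
  finally show ?thesis .
qed

lemma weighted_norm_scale: "weighted_norm i m (a *s x) = cmod a * weighted_norm i m x"
proof -
  have "(\<Sum>k\<in>UNIV. weight_O i m $ k * (cmod ((a *s x) $ k))\<^sup>2)
      = (cmod a)\<^sup>2 * (\<Sum>k\<in>UNIV. weight_O i m $ k * (cmod (x $ k))\<^sup>2)"
    unfolding sum_distrib_left by (simp add: norm_mult power_mult_distrib mult.left_commute)
  then show ?thesis unfolding weighted_norm_def by (simp add: real_sqrt_mult)
qed

lemma weighted_norm_le_sum:
  assumes m: "0 < m"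
  shows "weighted_norm i m x \<le> (\<Sum>k\<in>UNIV. sqrt (weight_O i m $ k) * cmod (x $ k))"
  unfolding weighted_norm_eq_L2_set[OF m]
  by (intro L2_set_le_sum mult_nonneg_nonneg real_sqrt_ge_zero less_imp_le[OF weight_O_pos[OF m]]
      norm_ge_zero)

definition companion :: "real \<Rightarrow> real \<Rightarrow> real \<Rightarrow> complex ^ 3 ^ 3" where
  "companion \<alpha> \<beta> m = vector [vector [0, 1, 0], vector [0, 0, 1],
    vector [of_real (- m / \<alpha>), of_real (- \<beta> * m / \<alpha>), of_real (- 1 / \<alpha>)]]"

lemma companion_mult:
  "companion \<alpha> \<beta> m *v x = vector [x $ 2, x $ 3,
    of_real (- m / \<alpha>) * x $ 1 + of_real (- \<beta> * m / \<alpha>) * x $ 2 + of_real (- 1 / \<alpha>) * x $ 3]"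
  by (simp add: companion_def vec_eq_iff forall_3 matrix_vector_mult_def sum_3)

lemma coords_simps [simp]:
  "coords e (u, v, w) $ 1 = cinner e u" "coords e (u, v, w) $ 2 = cinner e v" "coords e (u, v, w) $ 3 = cinner e w"
  by (simp_all add: coords_def)

lemma coords_add: "coords e (U + V) = coords e U + coords e V"
  by (cases U; cases V) (simp add: vec_eq_iff forall_3 cinner_add_right)

lemma coords_scaleC: "coords e (a *\<^sub>C U) = a *s coords e U"
  by (cases U) (simp add: vec_eq_iff forall_3 cinner_scaleC_right scaleC_prod_def)

locale phase =
  fixes \<mu> :: "nat \<Rightarrow> real" and \<phi> :: "nat \<Rightarrow> 'h::chilbert_space" and i :: space_index
  assumes onb: "orthonormal_basis \<phi>" and \<mu>: "\<And>n. 0 < \<mu> n" and mono: "mono \<mu>"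
begin

abbreviation W :: "nat \<Rightarrow> complex ^ 3 \<Rightarrow> real" where "W n \<equiv> weighted_norm i (\<mu> n)"

lemma W_square_coords:
  assumes "exponents i = (p, q, r)"
  shows "(W n (coords (\<phi> n) (u, v, w)))\<^sup>2 = (\<mu> n powr p * cmod (cinner (\<phi> n) u))\<^sup>2
    + (\<mu> n powr q * cmod (cinner (\<phi> n) v))\<^sup>2 + (\<mu> n powr r * cmod (cinner (\<phi> n) w))\<^sup>2"
  using weight_O_powr[OF \<mu>[of n], of i] assms
  by (simp add: weighted_norm_square \<mu> sum_3 power_mult_distrib)

lemma phase_space_iff:
  "U \<in> phase_space \<mu> \<phi> i \<longleftrightarrow> summable (\<lambda>n. (W n (coords (\<phi> n) U))\<^sup>2)"
proof -
  obtain p q r where e: "exponents i = (p, q, r)" by (cases "exponents i")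
  obtain u v w where U: "U = (u, v, w)" by (cases U)
  note W = W_square_coords[OF e, of _ u v w]
  show ?thesis
  proof
    assume "U \<in> phase_space \<mu> \<phi> i"
    then show "summable (\<lambda>n. (W n (coords (\<phi> n) U))\<^sup>2)"
      unfolding U W by (intro summable_add) (simp_all add: phase_space_def e dom_power_def)
  next
    assume s: "summable (\<lambda>n. (W n (coords (\<phi> n) U))\<^sup>2)"
    have "summable (\<lambda>n. (\<mu> n powr p * cmod (cinner (\<phi> n) u))\<^sup>2)"
      "summable (\<lambda>n. (\<mu> n powr q * cmod (cinner (\<phi> n) v))\<^sup>2)"
      "summable (\<lambda>n. (\<mu> n powr r * cmod (cinner (\<phi> n) w))\<^sup>2)"
      by (rule summable_comparison_test'[OF s, of 0]; simp add: U W)+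
    then show "U \<in> phase_space \<mu> \<phi> i" by (simp add: U phase_space_def e dom_power_def)
  qed
qed

lemma phase_norm_eq:
  assumes "U \<in> phase_space \<mu> \<phi> i"
  shows "phase_norm \<mu> \<phi> i U = sqrt (\<Sum>n. (W n (coords (\<phi> n) U))\<^sup>2)"
proof -
  obtain p q r where e: "exponents i = (p, q, r)" by (cases "exponents i")
  obtain u v w where U: "U = (u, v, w)" by (cases U)
  have "(\<lambda>n. (W n (coords (\<phi> n) U))\<^sup>2) sums
      ((norm (L_power \<mu> \<phi> p u))\<^sup>2 + (norm (L_power \<mu> \<phi> q v))\<^sup>2 + (norm (L_power \<mu> \<phi> r w))\<^sup>2)"
    unfolding U W_square_coords[OF e]
    by (intro sums_add norm_L_power[OF onb]) (use assms in \<open>simp_all add: U phase_space_def e\<close>)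
  then show ?thesis by (simp add: phase_norm_def U e sums_iff)
qed

lemma csubspace_phase_space: "csubspace (phase_space \<mu> \<phi> i)"
proof -
  have tri: "W n (x + y) \<le> 1 * norm (\<bar>W n x\<bar> + \<bar>W n y\<bar>)" for n x y
    using weighted_norm_add[OF \<mu>, of i n x y] by simp
  show ?thesis
    unfolding csubspace_def phase_space_iff
  proof (intro conjI ballI allI)
    have "coords e (0 :: 'h \<times> 'h \<times> 'h) = 0" for e
      using coords_scaleC[of e 0 "0 :: 'h \<times> 'h \<times> 'h"] by simp
    then show "summable (\<lambda>n. (W n (coords (\<phi> n) 0))\<^sup>2)" by (simp add: weighted_norm_def)
    fix U assume U: "U \<in> phase_space \<mu> \<phi> i"
    then have sU: "summable (\<lambda>n. (W n (coords (\<phi> n) U))\<^sup>2)" by (simp add: phase_space_iff)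
    show "summable (\<lambda>n. (W n (coords (\<phi> n) (a *\<^sub>C U)))\<^sup>2)" for a
      unfolding coords_scaleC weighted_norm_scale power_mult_distrib by (intro summable_mult sU)
    fix V assume "V \<in> phase_space \<mu> \<phi> i"
    then have sV: "summable (\<lambda>n. (W n (coords (\<phi> n) V))\<^sup>2)" by (simp add: phase_space_iff)
    have s: "summable (\<lambda>n. (norm (\<bar>W n (coords (\<phi> n) U)\<bar> + \<bar>W n (coords (\<phi> n) V)\<bar>))\<^sup>2)"
      by (rule summable_norm_square_add) (simp_all add: sU sV)
    have "summable (\<lambda>n. (norm (W n (coords (\<phi> n) (U + V))))\<^sup>2)"
      using tri weighted_norm_nonneg[OF \<mu>]
      by (intro summable_norm_square_le[OF s, of _ 1]) (simp add: coords_add)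
    then show "summable (\<lambda>n. (W n (coords (\<phi> n) (U + V)))\<^sup>2)" by simp
  qed
qed

lemma coords_zero_imp:
  assumes "\<And>n. coords (\<phi> n) U = 0"
  shows "U = 0"
proof -
  obtain u v w where U: "U = (u, v, w)" by (cases U)
  have "cinner (\<phi> n) u = 0 \<and> cinner (\<phi> n) v = 0 \<and> cinner (\<phi> n) w = 0" for n
    using assms[of n] by (simp add: U vec_eq_iff forall_3)
  then have "u = 0" "v = 0" "w = 0" by (auto intro!: basis_eqI[OF onb])
  then show ?thesis by (simp add: U zero_prod_def)
qed

lemma coords_surj:
  assumes s: "summable (\<lambda>n. (W n (x n))\<^sup>2)"
  shows "\<exists>U\<in>phase_space \<mu> \<phi> i. \<forall>n. coords (\<phi> n) U = x n"
proof -
  have c: "cinner (\<phi> n) (\<Sum>j. x j $ k *\<^sub>C \<phi> j) = x n $ k" for n k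
  proof (rule riesz_fischer[OF onb])
    let ?w = "weight_O i (\<mu> 0) $ k"
    have w: "0 < ?w" by (rule weight_O_pos[OF \<mu>])
    have "norm (x n $ k) \<le> (1 / sqrt ?w) * norm (W n (x n))" for n
    proof -
      have "\<mu> 0 \<le> \<mu> n" using mono by (simp add: monoD)
      then have "sqrt ?w * cmod (x n $ k) \<le> sqrt (weight_O i (\<mu> n) $ k) * cmod (x n $ k)"
        by (intro mult_right_mono real_sqrt_le_mono weight_O_mono \<mu>) auto
      also have "\<dots> \<le> norm (W n (x n))"
        using component_le_weighted_norm[OF \<mu>[of n], of i k "x n"] by simp
      finally show ?thesis using w by (simp add: pos_le_divide_eq mult.commute)
    qed
    then show "summable (\<lambda>n. (cmod (x n $ k))\<^sup>2)"
      by (rule summable_norm_square_le[rotated]) (simp add: s)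
  qed
  define U where "U = (\<Sum>j. x j $ 1 *\<^sub>C \<phi> j, \<Sum>j. x j $ 2 *\<^sub>C \<phi> j, \<Sum>j. x j $ 3 *\<^sub>C \<phi> j)"
  have "coords (\<phi> n) U = x n" for n by (simp add: U_def vec_eq_iff forall_3 c)
  then show ?thesis using s by (intro bexI[of _ U]) (simp_all add: phase_space_iff)
qed

lemma coords_op_A:
  assumes "u + \<beta> *\<^sub>R v \<in> dom_power \<mu> \<phi> 1"
  shows "coords (\<phi> n) (op_A \<alpha> \<beta> \<mu> \<phi> (u, v, w)) = companion \<alpha> \<beta> (\<mu> n) *v coords (\<phi> n) (u, v, w)"
  using \<mu>[of n]
  by (simp add: op_A_def companion_mult vec_eq_iff forall_3 cinner_diff_right cinner_L_power[OF onb assms]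
      cinner_add_right distrib_left add_divide_distrib)

text \<open>If \<open>A U\<close>, computed in coordinates, is square summable with the weights of the phase space,
  then so are the coefficients of \<open>L (u + \<beta> v)\<close>, since \<open>w\<close> is, and the weights are bounded below.\<close>

lemma dom_A_iff:
  assumes \<alpha>: "0 < \<alpha>"
  shows "U \<in> dom_A \<alpha> \<beta> \<mu> \<phi> i \<longleftrightarrow> U \<in> phase_space \<mu> \<phi> i \<and>
    summable (\<lambda>n. (W n (companion \<alpha> \<beta> (\<mu> n) *v coords (\<phi> n) U))\<^sup>2)"
proof -
  obtain u v w where U: "U = (u, v, w)" by (cases U)
  show ?thesis
  proof
    assume "U \<in> dom_A \<alpha> \<beta> \<mu> \<phi> i"
    then show "U \<in> phase_space \<mu> \<phi> i \<and>
        summable (\<lambda>n. (W n (companion \<alpha> \<beta> (\<mu> n) *v coords (\<phi> n) U))\<^sup>2)"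
      using phase_space_iff[of "op_A \<alpha> \<beta> \<mu> \<phi> (u, v, w)"] coords_op_A[of u \<beta> v]
      by (auto simp: U dom_A_def)
  next
    assume a: "U \<in> phase_space \<mu> \<phi> i \<and>
        summable (\<lambda>n. (W n (companion \<alpha> \<beta> (\<mu> n) *v coords (\<phi> n) U))\<^sup>2)"
    let ?x = "\<lambda>n. coords (\<phi> n) U"
    let ?y = "\<lambda>n. companion \<alpha> \<beta> (\<mu> n) *v ?x n"
    let ?w = "weight_O i (\<mu> 0) $ 3"
    have w: "0 < ?w" by (rule weight_O_pos[OF \<mu>])
    have 1: "summable (\<lambda>n. (norm (\<alpha> * W n (?y n) + W n (?x n)))\<^sup>2)"
    proof (rule summable_norm_square_add)
      show "summable (\<lambda>n. (norm (\<alpha> * W n (?y n)))\<^sup>2)"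
        using a by (simp add: power_mult_distrib summable_mult)
      show "summable (\<lambda>n. (norm (W n (?x n)))\<^sup>2)" using a by (simp add: phase_space_iff)
    qed
    have "norm (\<mu> n powr 1 * cmod (cinner (\<phi> n) (u + \<beta> *\<^sub>R v)))
      \<le> (1 / sqrt ?w) * norm (\<alpha> * W n (?y n) + W n (?x n))" for n
    proof -
      have "of_real (\<mu> n) * cinner (\<phi> n) (u + \<beta> *\<^sub>R v) = - (of_real \<alpha> * ?y n $ 3 + ?x n $ 3)"
        using \<alpha> by (simp add: companion_mult U cinner_add_right field_simps)
      then have "\<mu> n * cmod (cinner (\<phi> n) (u + \<beta> *\<^sub>R v)) = cmod (of_real \<alpha> * ?y n $ 3 + ?x n $ 3)"
        using \<mu>[of n] by (metis abs_of_pos norm_minus_cancel norm_mult norm_of_real)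
      also have "\<dots> \<le> \<alpha> * cmod (?y n $ 3) + cmod (?x n $ 3)"
        using norm_triangle_ineq[of "of_real \<alpha> * ?y n $ 3" "?x n $ 3"] \<alpha> by (simp add: norm_mult)
      finally have "sqrt ?w * (\<mu> n * cmod (cinner (\<phi> n) (u + \<beta> *\<^sub>R v)))
          \<le> sqrt ?w * (\<alpha> * cmod (?y n $ 3) + cmod (?x n $ 3))"
        using w by (intro mult_left_mono) auto
      also have "\<dots> \<le> sqrt (weight_O i (\<mu> n) $ 3) * (\<alpha> * cmod (?y n $ 3) + cmod (?x n $ 3))"
        using mono \<alpha> by (intro mult_right_mono real_sqrt_le_mono weight_O_mono \<mu>) (simp_all add: monoD)
      also have "\<dots> = \<alpha> * (sqrt (weight_O i (\<mu> n) $ 3) * cmod (?y n $ 3))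
          + sqrt (weight_O i (\<mu> n) $ 3) * cmod (?x n $ 3)" by (simp add: algebra_simps)
      also have "\<dots> \<le> \<alpha> * W n (?y n) + W n (?x n)"
        using \<alpha> by (intro add_mono mult_left_mono component_le_weighted_norm \<mu>) auto
      finally show ?thesis using w \<mu>[of n] by (simp add: pos_le_divide_eq mult.commute abs_mult)
    qed
    from summable_norm_square_le[OF 1 this]
    have d: "u + \<beta> *\<^sub>R v \<in> dom_power \<mu> \<phi> 1" by (simp add: dom_power_def)
    have "op_A \<alpha> \<beta> \<mu> \<phi> (u, v, w) \<in> phase_space \<mu> \<phi> i"
      using a by (simp add: phase_space_iff coords_op_A[OF d] U)
    with d a show "U \<in> dom_A \<alpha> \<beta> \<mu> \<phi> i" by (simp add: dom_A_def U)
  qed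
qed

lemma coords_A:
  assumes "U \<in> dom_A \<alpha> \<beta> \<mu> \<phi> i"
  shows "op_A \<alpha> \<beta> \<mu> \<phi> U \<in> phase_space \<mu> \<phi> i"
    and "coords (\<phi> n) (op_A \<alpha> \<beta> \<mu> \<phi> U) = companion \<alpha> \<beta> (\<mu> n) *v coords (\<phi> n) U"
  using assms coords_op_A by (auto simp: dom_A_def)

end


section \<open>Eigenvector coordinates of one block\<close>

definition power_vector :: "complex \<Rightarrow> complex ^ 3" where
  "power_vector z = vector [1, z, z\<^sup>2]"

lemma power_vector_simps [simp]:
  "power_vector z $ 1 = 1" "power_vector z $ 2 = z" "power_vector z $ 3 = z\<^sup>2"
  by (simp_all add: power_vector_def)

lemma weighted_norm_power_vector_pos:
  assumes "0 < m" shows "0 < weighted_norm i m (power_vector z)"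
proof -
  have "0 < sqrt (weight_O i m $ 1) * cmod (power_vector z $ 1)"
    using weight_O_pos[OF assms, of i 1] by simp
  also have "\<dots> \<le> weighted_norm i m (power_vector z)" by (rule component_le_weighted_norm[OF assms])
  finally show ?thesis .
qed

lemma eigvec_eq:
  "eigvec i m z = of_real (1 / weighted_norm i m (power_vector z)) *s power_vector z"
  by (simp add: eigvec_def weighted_norm_def Let_def vec_eq_iff power_vector_def[symmetric])

lemma vec3_norm_le: "norm (y :: complex ^ 3) \<le> cmod (y $ 1) + cmod (y $ 2) + cmod (y $ 3)"
  unfolding norm_vec_def using L2_set_le_sum[of UNIV "\<lambda>k. norm (y $ k)"] by (simp add: sum_3)

lemma matrix_vector_columns:
  "(P :: complex ^ 3 ^ 3) *v y = y $ 1 *s column 1 P + y $ 2 *s column 2 P + y $ 3 *s column 3 P"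
  by (simp add: matrix_mult_sum sum_3)

lemma invertible_inverse:
  fixes P :: "complex ^ 3 ^ 3"
  assumes "invertible P"
  shows "P *v (matrix_inv P *v x) = x" "matrix_inv P *v (P *v x) = x"
proof -
  have "P ** matrix_inv P = mat 1 \<and> matrix_inv P ** P = mat 1"
    using assms unfolding invertible_def matrix_inv_def by (rule someI_ex)
  then show "P *v (matrix_inv P *v x) = x" "matrix_inv P *v (P *v x) = x"
    by (simp_all add: matrix_vector_mul_assoc)
qed

context
  fixes \<alpha> \<beta> m :: real and i :: space_index
  assumes \<alpha>: "0 < \<alpha>" and \<beta>: "\<alpha> < \<beta>" and m: "0 < m"
begin

lemma companion_power_vector:
  assumes "char_root \<alpha> \<beta> m z"
  shows "companion \<alpha> \<beta> m *v power_vector z = z *s power_vector z"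
proof -
  have "z ^ 3 = of_real (- m / \<alpha>) + of_real (- \<beta> * m / \<alpha>) * z + of_real (- 1 / \<alpha>) * z\<^sup>2"
  proof -
    have "of_real \<alpha> * (z ^ 3 - (of_real (- m / \<alpha>) + of_real (- \<beta> * m / \<alpha>) * z + of_real (- 1 / \<alpha>) * z\<^sup>2))
        = of_real \<alpha> * z ^ 3 + z ^ 2 + of_real (\<beta> * m) * z + of_real m"
      using \<alpha> by (simp add: algebra_simps)
    also have "\<dots> = 0" using assms by (simp add: char_root_def)
    finally show ?thesis using \<alpha> by simp
  qed
  from this[symmetric] show ?thesis
    by (simp add: companion_mult vec_eq_iff forall_3 power2_eq_square power3_eq_cube mult.assoc)
qed

text \<open>Up to normalization, the left eigenvector of the companion matrix for the eigenvalue \<open>a\<close>: the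
  coefficients of the cubic divided by \<open>z - a\<close>. It annihilates the eigenvectors of the other
  eigenvalues.\<close>

definition left_eigenform :: "complex \<Rightarrow> complex ^ 3 \<Rightarrow> complex" where
  "left_eigenform a x = x $ 3 + (of_real (1 / \<alpha>) + a) * x $ 2
    + (a\<^sup>2 + of_real (1 / \<alpha>) * a + of_real (\<beta> * m / \<alpha>)) * x $ 1"

definition root_derivative :: "complex \<Rightarrow> complex" where
  "root_derivative a = 3 * a\<^sup>2 + of_real (2 / \<alpha>) * a + of_real (\<beta> * m / \<alpha>)"

lemma left_eigenform_linear:
  "left_eigenform a (x + y) = left_eigenform a x + left_eigenform a y"
  "left_eigenform a (c *s x) = c * left_eigenform a x"
  by (simp_all add: left_eigenform_def algebra_simps add_divide_distrib)

lemma left_eigenform_self: "left_eigenform a (power_vector a) = root_derivative a"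
  by (simp add: left_eigenform_def root_derivative_def algebra_simps power2_eq_square)

lemma left_eigenform_other:
  assumes a: "char_root \<alpha> \<beta> m a" and b: "char_root \<alpha> \<beta> m b" and ab: "a \<noteq> b"
  shows "left_eigenform a (power_vector b) = 0"
proof -
  have "of_real \<alpha> * (b - a) * left_eigenform a (power_vector b)
      = (of_real \<alpha> * b ^ 3 + b ^ 2 + of_real (\<beta> * m) * b + of_real m)
        - (of_real \<alpha> * a ^ 3 + a ^ 2 + of_real (\<beta> * m) * a + of_real m)"
    using \<alpha> by (simp add: left_eigenform_def field_simps power2_eq_square power3_eq_cube)
  also have "\<dots> = 0" using a b by (simp add: char_root_def)
  finally show ?thesis using \<alpha> ab by simp
qed

lemma distinct_roots:
  assumes d: "of_real m \<noteq> const_m1 \<alpha> \<beta>" "of_real m \<noteq> const_m2 \<alpha> \<beta>"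
  shows roots_enum_inj: "inj (roots_enum \<alpha> \<beta> m)"
    and roots_enum_range: "range (roots_enum \<alpha> \<beta> m) = {z. char_root \<alpha> \<beta> m z}"
    and root_derivative_nonzero: "char_root \<alpha> \<beta> m a \<Longrightarrow> root_derivative a \<noteq> 0"
proof -
  obtain r where r: "char_root \<alpha> \<beta> m (of_real r)" using real_char_root_exists[OF \<alpha> \<beta> m] by blast
  obtain z w where v: "vieta \<alpha> \<beta> m (of_real r) z w" using vieta_exists[OF \<alpha> \<beta> m r] by blast
  have ne: "of_real r \<noteq> z \<and> of_real r \<noteq> w \<and> z \<noteq> w" using vieta_distinct_iff[OF \<alpha> \<beta> m v] d by blast
  let ?l = "\<lambda>j::3. if j = 1 then of_real r else if j = 2 then z else w"
  have "inj ?l"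
  proof (rule injI)
    fix j k :: 3 assume "?l j = ?l k"
    then show "j = k" using ne exhaust_3[of j] exhaust_3[of k] by auto
  qed
  moreover have "range ?l = {z. char_root \<alpha> \<beta> m z}"
    unfolding UNIV_3 vieta_char_root[OF \<alpha> \<beta> m v] by auto
  ultimately have "\<exists>l :: 3 \<Rightarrow> complex. inj l \<and> range l = {z. char_root \<alpha> \<beta> m z}" by (intro exI[of _ ?l] conjI)
  then have "inj (roots_enum \<alpha> \<beta> m) \<and> range (roots_enum \<alpha> \<beta> m) = {z. char_root \<alpha> \<beta> m z}"
    unfolding roots_enum_def by (rule someI_ex)
  then show "inj (roots_enum \<alpha> \<beta> m)" "range (roots_enum \<alpha> \<beta> m) = {z. char_root \<alpha> \<beta> m z}" by auto
  have q: "root_derivative a = 3 * a\<^sup>2 - 2 * (of_real r + z + w) * a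
      + (of_real r * z + of_real r * w + z * w)" for a
    using v by (simp add: root_derivative_def vieta_def)
  assume "char_root \<alpha> \<beta> m a"
  then have "a = of_real r \<or> a = z \<or> a = w" by (simp add: vieta_char_root[OF \<alpha> \<beta> m v])
  moreover have "root_derivative (of_real r) = (of_real r - z) * (of_real r - w)"
    "root_derivative z = (z - of_real r) * (z - w)" "root_derivative w = (w - of_real r) * (w - z)"
    unfolding q by (simp_all add: algebra_simps power2_eq_square)
  ultimately show "root_derivative a \<noteq> 0" using ne by auto
qed

context
  assumes d: "of_real m \<noteq> const_m1 \<alpha> \<beta>" "of_real m \<noteq> const_m2 \<alpha> \<beta>"
begin

lemma roots_enum_root: "char_root \<alpha> \<beta> m (roots_enum \<alpha> \<beta> m j)"
  using roots_enum_range[OF d] by blast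

lemma mat_C_column: "column j (mat_C \<alpha> \<beta> i m) = of_real (1 / weighted_norm i m (power_vector (roots_enum \<alpha> \<beta> m j))) *s power_vector (roots_enum \<alpha> \<beta> m j)"
  by (simp add: column_def mat_C_def eigvec_eq vec_eq_iff)

lemma left_eigenform_column:
  "left_eigenform (roots_enum \<alpha> \<beta> m j) (column k (mat_C \<alpha> \<beta> i m)) = (if j = k then root_derivative (roots_enum \<alpha> \<beta> m j) / of_real (weighted_norm i m (power_vector (roots_enum \<alpha> \<beta> m j))) else 0)"
proof (cases "j = k")
  case True
  then show ?thesis
    by (simp add: mat_C_column left_eigenform_linear left_eigenform_self)
next
  case False
  then have "roots_enum \<alpha> \<beta> m j \<noteq> roots_enum \<alpha> \<beta> m k" using roots_enum_inj[OF d] by (simp add: inj_eq)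
  then show ?thesis
    using False by (simp add: mat_C_column left_eigenform_linear left_eigenform_other roots_enum_root)
qed

lemma eigen_coordinate:
  "y $ j = of_real (weighted_norm i m (power_vector (roots_enum \<alpha> \<beta> m j))) * left_eigenform (roots_enum \<alpha> \<beta> m j) ((mat_C \<alpha> \<beta> i m) *v y) / root_derivative (roots_enum \<alpha> \<beta> m j)"
proof -
  have "left_eigenform (roots_enum \<alpha> \<beta> m j) ((mat_C \<alpha> \<beta> i m) *v y) = y $ j * (root_derivative (roots_enum \<alpha> \<beta> m j) / of_real (weighted_norm i m (power_vector (roots_enum \<alpha> \<beta> m j))))"
    unfolding matrix_vector_columns left_eigenform_linear left_eigenform_column
    using exhaust_3[of j] by auto
  moreover have "weighted_norm i m (power_vector (roots_enum \<alpha> \<beta> m j)) \<noteq> 0" using weighted_norm_power_vector_pos[OF m, of i "(roots_enum \<alpha> \<beta> m) j"] by simp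
  moreover have "root_derivative (roots_enum \<alpha> \<beta> m j) \<noteq> 0" by (rule root_derivative_nonzero[OF d roots_enum_root])
  ultimately show ?thesis by simp
qed

lemma mat_C_invertible: "invertible (mat_C \<alpha> \<beta> i m)"
proof -
  have "inj ((*v) (mat_C \<alpha> \<beta> i m))"
  proof (rule injI)
    fix x y assume "(mat_C \<alpha> \<beta> i m) *v x = (mat_C \<alpha> \<beta> i m) *v y"
    then have "x $ j = y $ j" for j using eigen_coordinate[of x j] eigen_coordinate[of y j] by simp
    then show "x = y" by (simp add: vec_eq_iff)
  qed
  then show ?thesis by (simp add: invertible_left_inverse matrix_left_invertible_injective)
qed

lemma companion_mat_C: "companion \<alpha> \<beta> m *v ((mat_C \<alpha> \<beta> i m) *v y) = (mat_C \<alpha> \<beta> i m) *v (bidiagonal (roots_enum \<alpha> \<beta> m) 0 *v y)"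
  unfolding matrix_vector_columns[of "mat_C \<alpha> \<beta> i m"] matrix_vector_right_distrib vector_scalar_mult_matrix
    mat_C_column companion_power_vector[OF roots_enum_root]
  by (simp add: bidiagonal_mult vec_eq_iff algebra_simps)

lemma eigen_coordinates_companion:
  "matrix_inv (mat_C \<alpha> \<beta> i m) *v (companion \<alpha> \<beta> m *v x) = bidiagonal (roots_enum \<alpha> \<beta> m) 0 *v (matrix_inv (mat_C \<alpha> \<beta> i m) *v x)"
  using companion_mat_C[of "matrix_inv (mat_C \<alpha> \<beta> i m) *v x"] by (metis invertible_inverse mat_C_invertible)

lemma weighted_norm_le_eigen_coordinates: "weighted_norm i m x \<le> 3 * norm (matrix_inv (mat_C \<alpha> \<beta> i m) *v x)"
proof -
  let ?y = "matrix_inv (mat_C \<alpha> \<beta> i m) *v x"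
  have n: "weighted_norm i m (column j (mat_C \<alpha> \<beta> i m)) = 1" for j
    using weighted_norm_power_vector_pos[OF m, of i "(roots_enum \<alpha> \<beta> m) j"]
    by (simp add: mat_C_column weighted_norm_scale norm_divide)
  have "weighted_norm i m x = weighted_norm i m ((mat_C \<alpha> \<beta> i m) *v ?y)" by (simp add: invertible_inverse mat_C_invertible)
  also have "\<dots> \<le> weighted_norm i m (?y $ 1 *s column 1 (mat_C \<alpha> \<beta> i m)) + weighted_norm i m (?y $ 2 *s column 2 (mat_C \<alpha> \<beta> i m))
      + weighted_norm i m (?y $ 3 *s column 3 (mat_C \<alpha> \<beta> i m))"
    unfolding matrix_vector_columns[of "mat_C \<alpha> \<beta> i m"]
    using weighted_norm_add[OF m] by (meson add_right_mono order_trans)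
  also have "\<dots> = cmod (?y $ 1) + cmod (?y $ 2) + cmod (?y $ 3)" by (simp add: weighted_norm_scale n)
  also have "\<dots> \<le> norm ?y + norm ?y + norm ?y"
    by (intro add_mono Finite_Cartesian_Product.norm_nth_le)
  finally show ?thesis by simp
qed

end

text \<open>For large \<open>m\<close> the eigenvector coordinates are bounded by the weighted norm, uniformly in \<open>m\<close>: the
  norms of the eigenvector and of the left eigenform have a product of size at most \<open>m\<close>, which is also the
  size of the derivative of the cubic at the root. The four phase spaces are treated at once: up to a common
  factor the square roots of the weights are \<open>p\<close>, \<open>sqrt m\<close> and \<open>1\<close>, where \<open>p\<close> is \<open>sqrt m\<close> or \<open>m\<close>.\<close>

lemma weight_O_form:
  assumes "1 \<le> m"
  obtains s p where "0 < s" "sqrt m \<le> p" "p \<le> m"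
    "sqrt (weight_O i m $ 1) = s * p" "sqrt (weight_O i m $ 2) = s * sqrt m" "sqrt (weight_O i m $ 3) = s"
proof -
  have 1: "1 \<le> sqrt m" using assms by simp
  have 2: "sqrt m \<le> m"
  proof -
    have "sqrt m * 1 \<le> sqrt m * sqrt m" using 1 by (intro mult_left_mono) auto
    then show ?thesis using m by simp
  qed
  show thesis
  proof (cases i)
    case H1
    show thesis by (rule that[of 1 "sqrt m"]) (use H1 2 in \<open>simp_all add: weight_O_def\<close>)
  next
    case H2
    show thesis
      by (rule that[of "sqrt m" "sqrt m"]) (use H2 m 2 in \<open>simp_all add: weight_O_def real_sqrt_mult\<close>)
  next
    case H3
    show thesis by (rule that[of 1 m]) (use H3 m 2 in \<open>simp_all add: weight_O_def\<close>)
  next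
    case H4
    show thesis
      by (rule that[of "sqrt m" m]) (use H4 m 2 in \<open>simp_all add: weight_O_def real_sqrt_mult\<close>)
  qed
qed

lemma eigen_coordinate_bound:
  assumes m1: "1 \<le> m" and large: "1 / \<alpha>\<^sup>2 \<le> m" and a: "char_root \<alpha> \<beta> m a"
  shows "weighted_norm i m (power_vector a) * cmod (left_eigenform a x) / cmod (root_derivative a)
    \<le> 4 / 3 * (1 + 1/\<alpha> + (1/\<alpha>)\<^sup>2 + 2 * (\<beta>/\<alpha>)) * (1 + 2/\<alpha> + \<beta>/\<alpha>) * weighted_norm i m x"
proof -
  define A where "A = 1 / \<alpha>"
  define g where "g = \<beta> / \<alpha>"
  define t where "t = sqrt m"
  define W where "W = weighted_norm i m x"
  obtain s p where sp: "0 < s" "t \<le> p" "p \<le> m"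
    "sqrt (weight_O i m $ 1) = s * p" "sqrt (weight_O i m $ 2) = s * t" "sqrt (weight_O i m $ 3) = s"
    using weight_O_form[OF m1] unfolding t_def by metis
  have A: "0 < A" using \<alpha> by (simp add: A_def)
  have g: "1 < g" using \<alpha> \<beta> by (simp add: g_def)
  have t: "1 \<le> t" "t * t = m" using m1 by (simp_all add: t_def)
  have p: "0 < p" "1 \<le> p" using t sp by linarith+
  have W0: "0 \<le> W" by (simp add: W_def weighted_norm_nonneg m)
  note comp = component_le_weighted_norm[OF m, of i _ x, folded W_def]
  have x1: "cmod (x $ 1) \<le> W / s / p"
    using comp[of 1] sp p by (simp add: pos_le_divide_eq mult.commute mult.left_commute)
  have x2: "cmod (x $ 2) \<le> W / s / t"
    using comp[of 2] sp t by (simp add: pos_le_divide_eq mult.commute mult.left_commute)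
  have x3: "cmod (x $ 3) \<le> W / s"
    using comp[of 3] sp by (simp add: pos_le_divide_eq mult.commute)
  have "a \<noteq> 0"
  proof
    assume "a = 0"
    then have "of_real m = (0 :: complex)" using a by (simp add: char_root_def)
    then show False using m by simp
  qed
  then have a0: "0 < cmod a" by simp
  have "of_real \<alpha> * a * (a\<^sup>2 + of_real (1 / \<alpha>) * a + of_real (\<beta> * m / \<alpha>)) = - of_real m"
  proof -
    have "of_real \<alpha> * a * (a\<^sup>2 + of_real (1 / \<alpha>) * a + of_real (\<beta> * m / \<alpha>))
        = (of_real \<alpha> * a ^ 3 + a ^ 2 + of_real (\<beta> * m) * a + of_real m) - of_real m"
      using \<alpha> by (simp add: algebra_simps power2_eq_square power3_eq_cube)
    then show ?thesis using a unfolding char_root_def by (simp only: diff_0)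
  qed
  then have "cmod (of_real \<alpha> * a * (a\<^sup>2 + of_real (1 / \<alpha>) * a + of_real (\<beta> * m / \<alpha>))) = m"
    using m by (metis abs_of_pos norm_minus_cancel norm_of_real)
  then have e2: "cmod (a\<^sup>2 + of_real (1 / \<alpha>) * a + of_real (\<beta> * m / \<alpha>)) = A * m / cmod a"
  proof -
    define q where "q = a\<^sup>2 + of_real (1 / \<alpha>) * a + of_real (\<beta> * m / \<alpha>)"
    assume "cmod (of_real \<alpha> * a * (a\<^sup>2 + of_real (1 / \<alpha>) * a + of_real (\<beta> * m / \<alpha>))) = m"
    then have "\<alpha> * cmod a * cmod q = m" using \<alpha> unfolding q_def[symmetric] by (simp add: norm_mult)
    then have "cmod q = A * m / cmod a" using \<alpha> a0 by (auto simp: A_def)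
    then show ?thesis unfolding q_def .
  qed
  have "cmod (left_eigenform a x) \<le> cmod (x $ 3) + cmod (of_real (1 / \<alpha>) + a) * cmod (x $ 2)
      + A * m / cmod a * cmod (x $ 1)"
    unfolding left_eigenform_def e2[symmetric] norm_mult[symmetric]
    by (intro order_trans[OF norm_triangle_ineq] add_mono norm_triangle_ineq order_refl)
  also have "\<dots> \<le> W / s + (A + cmod a) * (W / s / t) + A * m / cmod a * (W / s / p)"
  proof (intro add_mono mult_mono x1 x2 x3)
    show "cmod (of_real (1 / \<alpha>) + a) \<le> A + cmod a"
      using norm_triangle_ineq[of "of_real (1 / \<alpha>)" a] \<alpha> by (simp add: A_def norm_divide)
  qed (use A a0 m t p sp W0 in \<open>auto intro!: mult_nonneg_nonneg divide_nonneg_nonneg\<close>)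
  also have "\<dots> = W / s * (1 + (A + cmod a) / t + A * m / cmod a / p)"
    by (simp add: distrib_left add_divide_distrib distrib_right mult.commute mult.left_commute)
  finally have form: "cmod (left_eigenform a x) \<le> W / s * (1 + (A + cmod a) / t + A * m / cmod a / p)" .
  have vec: "weighted_norm i m (power_vector a) \<le> s * (p + t * cmod a + (cmod a)\<^sup>2)"
    using weighted_norm_le_sum[OF m, of i "power_vector a"] sp
    by (simp add: sum_3 norm_power distrib_left mult.assoc)
  have pos: "0 \<le> (A + cmod a) / t" "0 \<le> A * m / cmod a / p" using A a0 m t p by auto
  have prod: "weighted_norm i m (power_vector a) * cmod (left_eigenform a x)
      \<le> W * ((p + t * cmod a + (cmod a)\<^sup>2) * (1 + (A + cmod a) / t + A * m / cmod a / p))"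
  proof -
    have "weighted_norm i m (power_vector a) * cmod (left_eigenform a x)
      \<le> (s * (p + t * cmod a + (cmod a)\<^sup>2)) * (W / s * (1 + (A + cmod a) / t + A * m / cmod a / p))"
      using sp(1) p t a0 by (intro mult_mono vec form) auto
    also have "\<dots> = W * ((p + t * cmod a + (cmod a)\<^sup>2) * (1 + (A + cmod a) / t + A * m / cmod a / p))"
      using sp(1) by simp
    finally show ?thesis .
  qed
  have main: "(p + t * cmod a + (cmod a)\<^sup>2) * (1 + (A + cmod a) / t + A * m / cmod a / p)
      \<le> (1 + A + A\<^sup>2 + 2 * g) * (1 + 2 * A + g) * m"
    using large_root(2)[OF \<alpha> \<beta> m large a]
  proof
    assume "cmod a \<le> 1 / \<alpha> \<and> 1 / \<beta> \<le> cmod a"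
    then have b: "cmod a \<le> A" "1 / \<beta> \<le> cmod a" by (simp_all add: A_def)
    have "p + t * cmod a + (cmod a)\<^sup>2 \<le> p + p * A + p * A\<^sup>2"
    proof (intro add_mono order_refl)
      show "t * cmod a \<le> p * A" using b sp t p by (intro mult_mono) auto
      have "(cmod a)\<^sup>2 \<le> 1 * A\<^sup>2" using b by (simp add: power_mono)
      also have "\<dots> \<le> p * A\<^sup>2" using p by (intro mult_right_mono) auto
      finally show "(cmod a)\<^sup>2 \<le> p * A\<^sup>2" .
    qed
    also have "\<dots> = (1 + A + A\<^sup>2) * p" by (simp add: algebra_simps)
    finally have 1: "p + t * cmod a + (cmod a)\<^sup>2 \<le> (1 + A + A\<^sup>2) * p" .
    have "(A + cmod a) / t \<le> (A + A) / 1" using b A t by (intro frac_le) auto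
    moreover have "A * m / cmod a \<le> g * m"
    proof -
      have "1 / cmod a \<le> \<beta>" using b(2) a0 \<alpha> \<beta> by (simp add: field_simps)
      then have "A * m * (1 / cmod a) \<le> A * m * \<beta>" using A m by (intro mult_left_mono) auto
      then show ?thesis by (simp add: A_def g_def mult.commute)
    qed
    then have "A * m / cmod a / p \<le> g * m / p" using p by (intro divide_right_mono) auto
    ultimately have 2: "1 + (A + cmod a) / t + A * m / cmod a / p \<le> 1 + 2 * A + g * m / p" by simp
    have "(p + t * cmod a + (cmod a)\<^sup>2) * (1 + (A + cmod a) / t + A * m / cmod a / p)
        \<le> ((1 + A + A\<^sup>2) * p) * (1 + 2 * A + g * m / p)"
      using 1 2 A p pos by (intro mult_mono) auto
    also have "\<dots> = (1 + A + A\<^sup>2) * ((1 + 2 * A) * p + g * m)"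
    proof -
      have "p * (1 + 2 * A + g * m / p) = (1 + 2 * A) * p + g * m" using p by (simp add: algebra_simps)
      then show ?thesis by (simp only: mult.assoc)
    qed
    also have "\<dots> \<le> (1 + A + A\<^sup>2) * ((1 + 2 * A) * m + g * m)"
      using A sp(3) by (intro mult_left_mono add_mono order_refl) auto
    also have "\<dots> = (1 + A + A\<^sup>2) * ((1 + 2 * A + g) * m)" by (simp add: distrib_right)
    also have "\<dots> \<le> (1 + A + A\<^sup>2 + 2 * g) * ((1 + 2 * A + g) * m)"
      using A g m by (intro mult_right_mono) auto
    finally show ?thesis by (simp only: mult.assoc)
  next
    assume "m \<le> (cmod a)\<^sup>2 \<and> (cmod a)\<^sup>2 \<le> m * (\<beta> / \<alpha>)"
    then have b: "m \<le> (cmod a)\<^sup>2" "(cmod a)\<^sup>2 \<le> m * g" by (simp_all add: g_def)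
    have lo: "t \<le> cmod a" unfolding t_def using b(1) by (intro real_le_lsqrt) auto
    have "(cmod a)\<^sup>2 \<le> m * g * 1" using b(2) by simp
    also have "\<dots> \<le> m * g * g" using g m by (intro mult_left_mono) auto
    also have "\<dots> = (t * g)\<^sup>2" by (simp add: power2_eq_square t(2)[symmetric] mult.commute mult.left_commute)
    finally have hi: "cmod a \<le> t * g" by (rule power2_le_imp_le) (use t g in simp)
    have "t * cmod a \<le> t * (t * g)" using hi t by (intro mult_left_mono) auto
    also have "\<dots> = m * g" by (simp add: t(2)[symmetric] mult.assoc)
    finally have "p + t * cmod a + (cmod a)\<^sup>2 \<le> m + m * g + m * g" using b sp by linarith
    also have "\<dots> = (1 + 2 * g) * m" by (simp add: algebra_simps)
    also have "\<dots> \<le> (1 + A + A\<^sup>2 + 2 * g) * m" using A m by (intro mult_right_mono) auto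
    finally have 1: "p + t * cmod a + (cmod a)\<^sup>2 \<le> (1 + A + A\<^sup>2 + 2 * g) * m" .
    have "A / t \<le> A / 1" using A t by (intro divide_left_mono) auto
    moreover have "cmod a / t \<le> g" using hi t by (simp add: pos_divide_le_eq mult.commute)
    ultimately have "(A + cmod a) / t \<le> A + g" by (simp add: add_divide_distrib)
    moreover have "A * m / cmod a / p \<le> A"
    proof -
      have "m \<le> cmod a * p" unfolding t(2)[symmetric] using lo sp t by (intro mult_mono) auto
      then have "A * m \<le> A * (cmod a * p)" using A by (intro mult_left_mono) auto
      then show ?thesis using a0 p by (simp add: divide_divide_eq_left pos_divide_le_eq)
    qed
    ultimately have 2: "1 + (A + cmod a) / t + A * m / cmod a / p \<le> 1 + 2 * A + g" by simp
    have "(p + t * cmod a + (cmod a)\<^sup>2) * (1 + (A + cmod a) / t + A * m / cmod a / p)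
        \<le> ((1 + A + A\<^sup>2 + 2 * g) * m) * (1 + 2 * A + g)"
      using 1 2 A g m pos by (intro mult_mono) auto
    then show ?thesis by (simp only: mult.commute mult.left_commute)
  qed
  have q: "3 / 4 * m \<le> cmod (root_derivative a)"
    unfolding root_derivative_def by (rule large_root(1)[OF \<alpha> \<beta> m large a])
  define k where "k = (1 + A + A\<^sup>2 + 2 * g) * (1 + 2 * A + g)"
  have k: "0 \<le> k" using A g by (simp add: k_def)
  have "weighted_norm i m (power_vector a) * cmod (left_eigenform a x) \<le> W * (k * m)"
    using order_trans[OF prod mult_left_mono[OF main W0]] by (simp only: k_def)
  then have "weighted_norm i m (power_vector a) * cmod (left_eigenform a x) / cmod (root_derivative a)
      \<le> W * (k * m) / (3 / 4 * m)"
    using q m W0 k by (intro frac_le) auto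
  also have "\<dots> = 4 / 3 * k * W" using m by simp
  finally show ?thesis
    unfolding k_def A_def g_def W_def by (simp only: mult.assoc times_divide_eq_right mult_1_right)
qed

lemma eigen_coordinates_bound:
  assumes m1: "1 \<le> m" and large: "1 / \<alpha>\<^sup>2 \<le> m"
    and d: "of_real m \<noteq> const_m1 \<alpha> \<beta>" "of_real m \<noteq> const_m2 \<alpha> \<beta>"
  shows "norm (matrix_inv (mat_C \<alpha> \<beta> i m) *v x)
    \<le> 3 * (4 / 3 * (1 + 1/\<alpha> + (1/\<alpha>)\<^sup>2 + 2 * (\<beta>/\<alpha>)) * (1 + 2/\<alpha> + \<beta>/\<alpha>)) * weighted_norm i m x"
proof -
  let ?y = "matrix_inv (mat_C \<alpha> \<beta> i m) *v x"
  define k where "k = 4 / 3 * (1 + 1/\<alpha> + (1/\<alpha>)\<^sup>2 + 2 * (\<beta>/\<alpha>)) * (1 + 2/\<alpha> + \<beta>/\<alpha>)"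
  have "cmod (?y $ j) \<le> k * weighted_norm i m x" for j
  proof -
    have "cmod (?y $ j) = weighted_norm i m (power_vector (roots_enum \<alpha> \<beta> m j))
        * cmod (left_eigenform (roots_enum \<alpha> \<beta> m j) x) / cmod (root_derivative (roots_enum \<alpha> \<beta> m j))"
      using weighted_norm_nonneg[OF m]
      by (subst eigen_coordinate[OF d])
        (simp add: invertible_inverse mat_C_invertible[OF d] norm_mult norm_divide)
    also have "\<dots> \<le> k * weighted_norm i m x"
      unfolding k_def by (rule eigen_coordinate_bound[OF m1 large roots_enum_root[OF d]])
    finally show ?thesis .
  qed
  from this[of 1] this[of 2] this[of 3] have "norm ?y \<le> 3 * k * weighted_norm i m x"
    using vec3_norm_le[of ?y] by linarith
  then show ?thesis unfolding k_def .
qed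


section \<open>Newton coordinates of a block with a repeated root\<close>

text \<open>Let \<open>A\<close> be the companion matrix. The first components of \<open>x\<close>, \<open>(A - a) x\<close> and \<open>(A - a)\<^sup>2 x\<close> satisfy a bidiagonal system; dividing by powers of \<open>e\<close> makes the coupling equal to \<open>e\<close>.\<close>

lemma newton_coordinates:
  assumes v: "vieta \<alpha> \<beta> m a a b" and e: "0 < e"
  obtains Q where "invertible Q"
    "\<And>x. Q *v (companion \<alpha> \<beta> m *v x)
      = bidiagonal (\<lambda>j. if j = 3 then b else a) e *v (Q *v x)"
proof -
  define Q :: "complex ^ 3 ^ 3" where "Q = vector [vector [1, 0, 0],
    vector [- a / of_real e, 1 / of_real e, 0],
    vector [a\<^sup>2 / of_real (e\<^sup>2), - 2 * a / of_real (e\<^sup>2), 1 / of_real (e\<^sup>2)]]"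
  have Q: "Q *v x = vector [x $ 1, (x $ 2 - a * x $ 1) / of_real e,
      (x $ 3 - 2 * a * x $ 2 + a\<^sup>2 * x $ 1) / of_real (e\<^sup>2)]" for x
    by (simp add: Q_def vec_eq_iff forall_3 matrix_vector_mult_def sum_3 diff_divide_distrib add_divide_distrib)
  have c: "companion \<alpha> \<beta> m *v x = vector [x $ 2, x $ 3,
      (a * a * b) * x $ 1 - (a * a + a * b + a * b) * x $ 2 + (a + a + b) * x $ 3]" for x
    using v by (simp add: companion_mult vieta_def)
  have e0: "complex_of_real e \<noteq> 0" using e by simp
  have "Q *v (companion \<alpha> \<beta> m *v x) = bidiagonal (\<lambda>j. if j = 3 then b else a) e *v (Q *v x)" for x
    unfolding c Q bidiagonal_mult using e0
    by (simp add: vec_eq_iff forall_3 field_simps power2_eq_square)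
  moreover have "inj ((*v) Q)"
  proof (rule injI)
    fix x y assume eq: "Q *v x = Q *v y"
    have 1: "x $ 1 = y $ 1" using arg_cong[OF eq, of "\<lambda>v. v $ 1"] by (simp add: Q)
    have 2: "x $ 2 = y $ 2" using arg_cong[OF eq, of "\<lambda>v. v $ 2"] 1 e0 by (simp add: Q)
    have "x $ 3 = y $ 3" using arg_cong[OF eq, of "\<lambda>v. v $ 3"] 1 2 e0 by (simp add: Q)
    with 1 2 show "x = y" by (simp add: vec_eq_iff forall_3)
  qed
  then have "invertible Q" by (simp add: invertible_left_inverse matrix_left_invertible_injective)
  ultimately show thesis using that by blast
qed

end


section \<open>The operator as a block system\<close>

text \<open>In a single block all norms are equivalent; only for large \<open>n\<close> is uniformity at stake.\<close>

lemma single_block_bounds: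
  assumes m: "0 < m" and Q: "invertible (Q :: complex ^ 3 ^ 3)"
  obtains c C where "0 < c" "0 < C" "\<And>x. c * weighted_norm i m x \<le> norm (Q *v x)"
    "\<And>x. norm (Q *v x) \<le> C * weighted_norm i m x"
proof -
  let ?w = "\<lambda>k. sqrt (weight_O i m $ k)"
  have w: "0 < ?w k" for k using weight_O_pos[OF m, of i k] by simp
  obtain K1 where K1: "0 < K1" "\<And>x. norm (Q *v x) \<le> norm x * K1"
    using bounded_linear.pos_bounded[OF bounded_linear_matrix_vector[of Q]] by blast
  obtain K2 where K2: "0 < K2" "\<And>x. norm (matrix_inv Q *v x) \<le> norm x * K2"
    using bounded_linear.pos_bounded[OF bounded_linear_matrix_vector[of "matrix_inv Q"]] by blast
  define a where "a = 1 / ?w 1 + 1 / ?w 2 + 1 / ?w 3"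
  define b where "b = ?w 1 + ?w 2 + ?w 3"
  have ab: "0 < a" "0 < b" using w by (simp_all add: a_def b_def add_pos_pos)
  have 1: "norm (Q *v x) \<le> (K1 * a) * weighted_norm i m x" for x
  proof -
    have "cmod (x $ k) \<le> 1 / ?w k * weighted_norm i m x" for k
      using component_le_weighted_norm[OF m, of i k x] w[of k] by (simp add: pos_le_divide_eq mult.commute)
    from this[of 1] this[of 2] this[of 3] have "norm x \<le> a * weighted_norm i m x"
      using vec3_norm_le[of x] unfolding a_def distrib_right by linarith
    then have "norm x * K1 \<le> a * weighted_norm i m x * K1" using K1(1) by (intro mult_right_mono) auto
    also have "\<dots> = (K1 * a) * weighted_norm i m x" by simp
    finally show ?thesis using K1(2)[of x] by linarith
  qed
  have 2: "1 / (b * K2) * weighted_norm i m x \<le> norm (Q *v x)" for x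
  proof -
    have "weighted_norm i m x \<le> (\<Sum>k\<in>UNIV. ?w k * cmod (x $ k))" by (rule weighted_norm_le_sum[OF m])
    also have "\<dots> \<le> (\<Sum>k\<in>UNIV. ?w k * norm x)"
      using w by (intro sum_mono mult_left_mono Finite_Cartesian_Product.norm_nth_le) (simp add: less_imp_le)
    also have "\<dots> = b * norm x" by (simp add: b_def sum_3 distrib_right)
    also have "norm x = norm (matrix_inv Q *v (Q *v x))" by (simp add: invertible_inverse Q)
    also have "b * \<dots> \<le> b * (norm (Q *v x) * K2)" using ab by (intro mult_left_mono K2) auto
    finally have "weighted_norm i m x \<le> norm (Q *v x) * (b * K2)" by (simp only: mult.commute mult.left_commute)
    then show ?thesis using ab K2 by (simp add: pos_divide_le_eq)
  qed
  show thesis by (rule that[OF _ _ 2 1]) (use ab K1 K2 in auto)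
qed

text \<open>If the characteristic roots are distinct, the block is diagonal in eigenvector coordinates.
  Otherwise all its roots are real and smaller than \<open>-1/\<beta>\<close>, hence strictly smaller than the spectral
  bound, and the gap leaves room for the coupling of the Newton coordinates.\<close>

lemma block_exists:
  fixes n :: nat
  assumes \<alpha>: "0 < \<alpha>" and \<beta>: "\<alpha> < \<beta>" and \<mu>: "\<And>n. 0 < \<mu> n"
    and lim: "filterlim \<mu> at_top sequentially" and mono: "mono \<mu>"
  shows "\<exists>Q P. invertible Q \<and> (\<forall>x. Q *v (companion \<alpha> \<beta> (\<mu> n) *v x) = P *v (Q *v x)) \<and>
    (\<forall>y. inner y (P *v y) \<le> sigma_max \<alpha> \<beta> \<mu> * (norm y)\<^sup>2) \<and>
    (\<forall>y. \<bar>inner y (P *v y)\<bar> \<le> (1/\<alpha> + 1) * (norm y)\<^sup>2) \<and>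
    (\<forall>y. \<exists>f. f 0 = y \<and> solves P f) \<and>
    (of_real (\<mu> n) \<noteq> const_m1 \<alpha> \<beta> \<and> of_real (\<mu> n) \<noteq> const_m2 \<alpha> \<beta> \<longrightarrow>
      Q = matrix_inv (mat_C \<alpha> \<beta> i (\<mu> n)) \<and> P = bidiagonal (roots_enum \<alpha> \<beta> (\<mu> n)) 0)"
proof -
  let ?s = "sigma_max \<alpha> \<beta> \<mu>"
  note m = \<mu>[of n]
  have s: "?s < 0" by (rule sigma_max_negative[OF \<alpha> \<beta> \<mu> mono])
  have range: "(\<forall>y. inner y (bidiagonal l e *v y) \<le> ?s * (norm y)\<^sup>2) \<and>
      (\<forall>y. \<bar>inner y (bidiagonal l e *v y)\<bar> \<le> (1/\<alpha> + 1) * (norm y)\<^sup>2)"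
    if e: "0 \<le> e" "e \<le> 1" and l: "\<And>j. - 1/\<alpha> \<le> Re (l j) \<and> Re (l j) \<le> ?s - e" for l e
  proof (intro conjI allI)
    fix y
    note r = bidiagonal_numerical_range[of e "- 1/\<alpha>" l "?s - e" y, OF e(1) l]
    show 1: "inner y (bidiagonal l e *v y) \<le> ?s * (norm y)\<^sup>2" using r(2) by simp
    have "0 \<le> (1/\<alpha> + 1) * (norm y)\<^sup>2" using \<alpha> by simp
    moreover have "?s * (norm y)\<^sup>2 \<le> 0" using s by (simp add: mult_le_0_iff)
    moreover have "- ((1/\<alpha> + 1) * (norm y)\<^sup>2) \<le> (- 1/\<alpha> - e) * (norm y)\<^sup>2"
      unfolding mult_minus_left[symmetric] using e by (intro mult_right_mono) auto
    ultimately show "\<bar>inner y (bidiagonal l e *v y)\<bar> \<le> (1/\<alpha> + 1) * (norm y)\<^sup>2"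
      using 1 r(1) by (simp only: abs_le_iff) linarith
  qed
  show ?thesis
  proof (cases "of_real (\<mu> n) \<noteq> const_m1 \<alpha> \<beta> \<and> of_real (\<mu> n) \<noteq> const_m2 \<alpha> \<beta>")
    case True
    then have d: "of_real (\<mu> n) \<noteq> const_m1 \<alpha> \<beta>" "of_real (\<mu> n) \<noteq> const_m2 \<alpha> \<beta>" by auto
    let ?C = "mat_C \<alpha> \<beta> i (\<mu> n)" and ?l = "roots_enum \<alpha> \<beta> (\<mu> n)"
    have inv: "invertible (matrix_inv ?C)"
      using invertible_inverse[OF mat_C_invertible[OF \<alpha> \<beta> m d]]
      unfolding invertible_left_inverse matrix_left_invertible_injective
      by (intro inj_on_inverseI[of _ "(*v) ?C"]) simp
    have root: "char_root \<alpha> \<beta> (\<mu> n) (?l j)" for j by (rule roots_enum_root[OF \<alpha> \<beta> m d])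
    have "- 1/\<alpha> \<le> Re (?l j) \<and> Re (?l j) \<le> ?s - 0" for j
      using char_root_Re_bounds(1)[OF \<alpha> \<beta> m root] char_root_le_sigma_max[where \<mu> = \<mu> and n = n, OF \<alpha> \<beta> \<mu> root]
      by (simp add: less_imp_le)
    note r = range[where l = ?l, OF order_refl zero_le_one this]
    show ?thesis
      by (intro exI[of _ "matrix_inv ?C"] exI[of _ "bidiagonal ?l 0"])
        (simp add: r[THEN conjunct1, rule_format] r[THEN conjunct2, rule_format] inv
          eigen_coordinates_companion[OF \<alpha> \<beta> m d] bidiagonal_solution_exists)
  next
    case False
    then have "of_real (\<mu> n) = const_m1 \<alpha> \<beta> \<or> of_real (\<mu> n) = const_m2 \<alpha> \<beta>" by blast
    then obtain a b where v: "vieta \<alpha> \<beta> (\<mu> n) (of_real a) (of_real a) (of_real b)"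
      by (rule double_root_real[OF \<alpha> \<beta> m])
    have r: "char_root \<alpha> \<beta> (\<mu> n) (of_real a)" "char_root \<alpha> \<beta> (\<mu> n) (of_real b)"
      using vieta_char_root[OF \<alpha> \<beta> m v] by auto
    note ab = real_char_root_bounds[OF \<alpha> \<beta> m r(1)] real_char_root_bounds[OF \<alpha> \<beta> m r(2)]
    have low: "- 1/\<beta> \<le> ?s" by (rule sigma_max_lower[OF \<alpha> \<beta> \<mu> lim])
    \<comment> \<open>The coupling fits into the gap; it is also at most 1, so that one constant \<open>K\<close> serves all blocks.\<close>
    define e where "e = min 1 (min (?s - a) (?s - b))"
    have e: "0 < e" "e \<le> 1" "a \<le> ?s - e" "b \<le> ?s - e" using ab low by (auto simp: e_def)
    obtain Q where Q: "invertible Q" "\<And>x. Q *v (companion \<alpha> \<beta> (\<mu> n) *v x)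
        = bidiagonal (\<lambda>j. if j = 3 then of_real b else of_real a) e *v (Q *v x)"
      using newton_coordinates[OF \<alpha> \<beta> m v e(1)] by blast
    let ?l = "\<lambda>j::3. if j = 3 then of_real b else complex_of_real a"
    have "- 1/\<alpha> \<le> Re (?l j) \<and> Re (?l j) \<le> ?s - e" for j using ab e by auto
    note r = range[where l = ?l, OF less_imp_le[OF e(1)] e(2) this]
    show ?thesis
      by (intro exI[of _ Q] exI[of _ "bidiagonal ?l e"] conjI)
        (use r Q bidiagonal_solution_exists False in \<open>simp_all only: simp_thms\<close>)
  qed
qed

context phase
begin

lemma block_system_phase:
  fixes Q B :: "nat \<Rightarrow> complex ^ 3 ^ 3"
  assumes \<alpha>: "0 < \<alpha>"
    and Q: "\<And>n. invertible (Q n)"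
    and conj: "\<And>n x. Q n *v (companion \<alpha> \<beta> (\<mu> n) *v x) = B n *v (Q n *v x)"
    and upper: "\<And>n y. inner y (B n *v y) \<le> s * (norm y)\<^sup>2"
    and abs: "\<And>n y. \<bar>inner y (B n *v y)\<bar> \<le> K * (norm y)\<^sup>2"
    and sol: "\<And>n y. \<exists>f. f 0 = y \<and> solves (B n) f"
    and cC: "0 < c" "0 < C" and lower_bound: "\<And>n x. c * W n x \<le> norm (Q n *v x)"
    and upper_bound: "\<And>n x. norm (Q n *v x) \<le> C * W n x"
  shows "block_system (phase_space \<mu> \<phi> i) (phase_norm \<mu> \<phi> i) (\<lambda>n U. Q n *v coords (\<phi> n) U)
    (dom_A \<alpha> \<beta> \<mu> \<phi> i) (op_A \<alpha> \<beta> \<mu> \<phi>) B s K c C"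
proof -
  have W0: "0 \<le> W n x" for n x by (rule weighted_norm_nonneg[OF \<mu>])
  have sQ: "summable (\<lambda>n. (norm (Q n *v x n))\<^sup>2) \<longleftrightarrow> summable (\<lambda>n. (W n (x n))\<^sup>2)" for x
  proof
    assume "summable (\<lambda>n. (norm (Q n *v x n))\<^sup>2)"
    then have "summable (\<lambda>n. (norm (W n (x n)))\<^sup>2)"
      by (rule summable_norm_square_le[where C = "1 / c"])
        (use lower_bound cC W0 in \<open>simp add: pos_le_divide_eq mult.commute\<close>)
    then show "summable (\<lambda>n. (W n (x n))\<^sup>2)" by simp
  next
    assume s: "summable (\<lambda>n. (W n (x n))\<^sup>2)"
    show "summable (\<lambda>n. (norm (Q n *v x n))\<^sup>2)"
      by (rule summable_norm_square_le[where g = "\<lambda>n. W n (x n)" and C = C])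
        (use s upper_bound W0 in simp_all)
  qed
  let ?X = "phase_space \<mu> \<phi> i" and ?x = "\<lambda>U n. coords (\<phi> n) U"
  have sums: "summable (\<lambda>n. (W n (?x U n))\<^sup>2)" "summable (\<lambda>n. (norm (Q n *v ?x U n))\<^sup>2)"
    if "U \<in> ?X" for U
    using that sQ[of "?x U"] by (simp_all add: phase_space_iff)
  show ?thesis
  proof
    show "csubspace ?X" by (rule csubspace_phase_space)
    show "Q n *v ?x (U + V) n = Q n *v ?x U n + Q n *v ?x V n" for U V n
      by (simp add: coords_add matrix_vector_right_distrib)
    show "Q n *v ?x (a *\<^sub>C U) n = a *s (Q n *v ?x U n)" for U n a
      by (simp add: coords_scaleC vector_scalar_mult_matrix)
    show "U = 0" if "\<And>n. Q n *v ?x U n = 0" for U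
    proof (rule coords_zero_imp)
      show "?x U n = 0" for n using invertible_inverse(2)[OF Q, of n "?x U n"] that[of n] by simp
    qed
    show "summable (\<lambda>n. (norm (Q n *v ?x U n))\<^sup>2)" if "U \<in> ?X" for U using sums that by blast
    show "\<exists>U\<in>?X. \<forall>n. Q n *v ?x U n = f n" if f: "summable (\<lambda>n. (norm (f n))\<^sup>2)" for f
    proof -
      have "summable (\<lambda>n. (W n (matrix_inv (Q n) *v f n))\<^sup>2)"
        using f sQ[of "\<lambda>n. matrix_inv (Q n) *v f n"] by (simp add: invertible_inverse Q)
      from coords_surj[OF this] obtain U where "U \<in> ?X" "\<And>n. ?x U n = matrix_inv (Q n) *v f n" by blast
      then show ?thesis by (intro bexI[of _ U]) (simp_all add: invertible_inverse Q)
    qed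
    show "0 < c" "0 < C" by (rule cC)+
    show "c * phase_norm \<mu> \<phi> i U \<le> block_norm (\<lambda>n U. Q n *v ?x U n) U" if U: "U \<in> ?X" for U
    proof -
      have "c * phase_norm \<mu> \<phi> i U = sqrt (\<Sum>n. (c * W n (?x U n))\<^sup>2)"
        using cC sums[OF U] by (simp add: phase_norm_eq[OF U] power_mult_distrib suminf_mult real_sqrt_mult)
      also have "\<dots> \<le> sqrt (\<Sum>n. (norm (Q n *v ?x U n))\<^sup>2)"
        using cC W0 sums[OF U]
        by (intro real_sqrt_le_mono suminf_le power_mono lower_bound)
          (simp_all add: power_mult_distrib summable_mult)
      finally show ?thesis by (simp add: block_norm_def)
    qed
    show "block_norm (\<lambda>n U. Q n *v ?x U n) U \<le> C * phase_norm \<mu> \<phi> i U" if U: "U \<in> ?X" for U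
    proof -
      have "sqrt (\<Sum>n. (norm (Q n *v ?x U n))\<^sup>2) \<le> sqrt (\<Sum>n. (C * W n (?x U n))\<^sup>2)"
        using sums[OF U]
        by (intro real_sqrt_le_mono suminf_le power_mono upper_bound)
          (simp_all add: power_mult_distrib summable_mult)
      also have "\<dots> = C * phase_norm \<mu> \<phi> i U"
        using cC sums[OF U] by (simp add: phase_norm_eq[OF U] power_mult_distrib suminf_mult real_sqrt_mult)
      finally show ?thesis by (simp add: block_norm_def)
    qed
    show "U \<in> dom_A \<alpha> \<beta> \<mu> \<phi> i \<longleftrightarrow> U \<in> ?X \<and> summable (\<lambda>n. (norm (B n *v (Q n *v ?x U n)))\<^sup>2)" for U
      using dom_A_iff[OF \<alpha>, of U \<beta>] sQ[of "\<lambda>n. companion \<alpha> \<beta> (\<mu> n) *v ?x U n"] by (simp add: conj)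
    show "op_A \<alpha> \<beta> \<mu> \<phi> U \<in> ?X" if "U \<in> dom_A \<alpha> \<beta> \<mu> \<phi> i" for U
      by (rule coords_A(1)[OF that])
    show "Q n *v ?x (op_A \<alpha> \<beta> \<mu> \<phi> U) n = B n *v (Q n *v ?x U n)" if "U \<in> dom_A \<alpha> \<beta> \<mu> \<phi> i" for U n
      by (simp add: coords_A(2)[OF that] conj)
    show "inner b (B n *v b) \<le> s * (norm b)\<^sup>2" for b n by (rule upper)
    show "\<bar>inner b (B n *v b)\<bar> \<le> K * (norm b)\<^sup>2" for b n by (rule abs)
    show "\<exists>f. f 0 = b \<and> solves (B n) f" for b n by (rule sol)
  qed
qed

text \<open>For large \<open>n\<close> the roots are distinct and the bounds in eigenvector coordinates are uniform; the
  finitely many remaining blocks only change the constants.\<close>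

lemma uniform_block_bounds:
  fixes Q :: "nat \<Rightarrow> complex ^ 3 ^ 3"
  assumes \<alpha>: "0 < \<alpha>" and \<beta>: "\<alpha> < \<beta>" and lim: "filterlim \<mu> at_top sequentially"
    and Q: "\<And>n. invertible (Q n)"
    and eig: "\<And>n. of_real (\<mu> n) \<noteq> const_m1 \<alpha> \<beta> \<Longrightarrow> of_real (\<mu> n) \<noteq> const_m2 \<alpha> \<beta> \<Longrightarrow>
      Q n = matrix_inv (mat_C \<alpha> \<beta> i (\<mu> n))"
  obtains c C where "0 < c" "0 < C" "\<And>n x. c * W n x \<le> norm (Q n *v x)"
    "\<And>n x. norm (Q n *v x) \<le> C * W n x"
proof -
  define k where "k = 3 * (4 / 3 * (1 + 1/\<alpha> + (1/\<alpha>)\<^sup>2 + 2 * (\<beta>/\<alpha>)) * (1 + 2/\<alpha> + \<beta>/\<alpha>))"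
  have k: "0 < k" using \<alpha> \<beta> by (simp add: k_def add_pos_pos)
  have W0: "0 \<le> W n x" for n x by (rule weighted_norm_nonneg[OF \<mu>])
  have "\<forall>\<^sub>F n in sequentially. max 1 (1 / \<alpha>\<^sup>2) \<le> \<mu> n"
    using lim unfolding filterlim_at_top by blast
  then obtain N where N: "\<And>n. N \<le> n \<Longrightarrow> max 1 (1 / \<alpha>\<^sup>2) \<le> \<mu> n"
    unfolding eventually_sequentially by blast
  have large: "1/3 * W n x \<le> norm (Q n *v x) \<and> norm (Q n *v x) \<le> k * W n x" if "N \<le> n" for n x
  proof -
    have m: "1 \<le> \<mu> n" "1 / \<alpha>\<^sup>2 \<le> \<mu> n" using N[OF that] by auto
    have d: "of_real (\<mu> n) \<noteq> const_m1 \<alpha> \<beta>" "of_real (\<mu> n) \<noteq> const_m2 \<alpha> \<beta>"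
      using double_root_real[OF \<alpha> \<beta> \<mu>[of n]] all_real_bound[OF \<alpha> \<beta> \<mu>[of n]] m(2)
      by (metis linorder_not_less)+
    show ?thesis
      using weighted_norm_le_eigen_coordinates[OF \<alpha> \<beta> \<mu> d, of i x]
        eigen_coordinates_bound[OF \<alpha> \<beta> \<mu> m d, of i x]
      unfolding eig[OF d] k_def by simp
  qed
  have "\<exists>c C. 0 < c \<and> 0 < C \<and> (\<forall>x. c * W n x \<le> norm (Q n *v x) \<and> norm (Q n *v x) \<le> C * W n x)" for n
    using single_block_bounds[OF \<mu> Q, of i n n] by metis
  then obtain c C where cC: "\<And>n. 0 < c n" "\<And>n. 0 < C n"
    "\<And>n x. c n * W n x \<le> norm (Q n *v x)" "\<And>n x. norm (Q n *v x) \<le> C n * W n x"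
    by metis
  define c' where "c' = Min (insert (1/3) (c ` {..<N}))"
  define C' where "C' = Max (insert k (C ` {..<N}))"
  show thesis
  proof
    show "0 < c'" unfolding c'_def by (subst Min_gr_iff) (use cC in auto)
    show "0 < C'" unfolding C'_def by (rule less_le_trans[OF k Max_ge]) simp_all
    fix n x
    show "c' * W n x \<le> norm (Q n *v x)"
    proof (cases "N \<le> n")
      case True
      have "c' * W n x \<le> 1/3 * W n x" unfolding c'_def by (intro mult_right_mono W0 Min_le) auto
      then show ?thesis using large[OF True, of x] by linarith
    next
      case False
      then have "c' * W n x \<le> c n * W n x" unfolding c'_def by (intro mult_right_mono W0 Min_le) auto
      then show ?thesis using cC(3)[of n x] by linarith
    qed
    show "norm (Q n *v x) \<le> C' * W n x"
    proof (cases "N \<le> n")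
      case True
      have "k * W n x \<le> C' * W n x" unfolding C'_def by (intro mult_right_mono W0 Max_ge) auto
      then show ?thesis using large[OF True, of x] by linarith
    next
      case False
      then have "C n * W n x \<le> C' * W n x" unfolding C'_def by (intro mult_right_mono W0 Max_ge) auto
      then show ?thesis using cC(4)[of n x] by linarith
    qed
  qed
qed

text \<open>The derivative \<open>(0, 1, 2 a)\<close> of the eigenvector \<open>(1, a, a\<^sup>2)\<close> with respect to \<open>a\<close> is a generalized
  eigenvector, because the derivative of the cubic vanishes at a double root.\<close>

lemma not_normal_at_double_root:
  assumes \<alpha>: "0 < \<alpha>" and \<beta>: "\<alpha> < \<beta>"
    and m: "of_real (\<mu> n) = const_m1 \<alpha> \<beta> \<or> of_real (\<mu> n) = const_m2 \<alpha> \<beta>"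
  shows "\<not> normal_A \<alpha> \<beta> \<mu> \<phi> i ip"
proof
  assume nrm: "normal_A \<alpha> \<beta> \<mu> \<phi> i ip"
  obtain r b where v: "vieta \<alpha> \<beta> (\<mu> n) (of_real r) (of_real r) (of_real b)"
    using double_root_real[OF \<alpha> \<beta> \<mu> m] by blast
  define a where "a = complex_of_real r"
  have root: "char_root \<alpha> \<beta> (\<mu> n) a" using vieta_char_root[OF \<alpha> \<beta> \<mu> v] by (simp add: a_def)
  define g :: "complex ^ 3" where "g = vector [0, 1, 2 * a]"
  have e1: "of_real (- 1 / \<alpha>) = a + a + of_real b" and e2: "of_real (\<beta> * \<mu> n / \<alpha>) = a * a + a * of_real b + a * of_real b"
    using v by (simp_all only: vieta_def a_def)
  have "of_real (- \<beta> * \<mu> n / \<alpha>) = - complex_of_real (\<beta> * \<mu> n / \<alpha>)" by simp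
  then have g: "companion \<alpha> \<beta> (\<mu> n) *v g = a *s g + power_vector a"
    unfolding companion_mult e1 e2 by (simp add: g_def vec_eq_iff forall_3 algebra_simps power2_eq_square e2)
  have ex: "\<exists>U\<in>dom_A \<alpha> \<beta> \<mu> \<phi> i. \<forall>k. coords (\<phi> k) U = (if k = n then x else 0)" for x
  proof -
    have z: "W k (companion \<alpha> \<beta> (\<mu> k) *v 0) = 0" "W k 0 = 0" for k by (simp_all add: weighted_norm_def)
    have "summable (\<lambda>k. (W k (if k = n then x else 0))\<^sup>2)"
      by (rule summable_finite[of "{n}"]) (auto simp: z)
    from coords_surj[OF this] obtain U where U: "U \<in> phase_space \<mu> \<phi> i"
      "\<And>k. coords (\<phi> k) U = (if k = n then x else 0)" by blast
    have "summable (\<lambda>k. (W k (companion \<alpha> \<beta> (\<mu> k) *v coords (\<phi> k) U))\<^sup>2)"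
      by (rule summable_finite[of "{n}"]) (auto simp: U z)
    then show ?thesis using U dom_A_iff[OF \<alpha>, of U \<beta>] by blast
  qed
  have eqI: "U = V" if "\<And>k. coords (\<phi> k) U = coords (\<phi> k) V" for U V :: "'h \<times> 'h \<times> 'h"
  proof -
    have "coords (\<phi> k) (U + (-1) *\<^sub>C V) = 0" for k using that[of k] by (simp add: coords_add coords_scaleC)
    then have "U + (-1) *\<^sub>C V = 0" by (rule coords_zero_imp)
    then show ?thesis by (simp add: scaleC_minus_one)
  qed
  obtain x where x: "x \<in> dom_A \<alpha> \<beta> \<mu> \<phi> i" "\<And>k. coords (\<phi> k) x = (if k = n then g else 0)"
    using ex[of g] by blast
  obtain y where y: "y \<in> dom_A \<alpha> \<beta> \<mu> \<phi> i" "\<And>k. coords (\<phi> k) y = (if k = n then power_vector a else 0)"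
    using ex[of "power_vector a"] by blast
  have "op_A \<alpha> \<beta> \<mu> \<phi> x = a *\<^sub>C x + y"
    by (rule eqI) (simp add: coords_A(2)[OF x(1)] coords_add coords_scaleC x(2) y(2) g)
  moreover have "op_A \<alpha> \<beta> \<mu> \<phi> y = a *\<^sub>C y"
    by (rule eqI) (simp add: coords_A(2)[OF y(1)] coords_scaleC y(2) companion_power_vector[OF \<alpha> \<beta> \<mu> root])
  ultimately have "y = 0" by (rule normal_operator_no_jordan_block[OF nrm x(1) y(1)])
  then have "coords (\<phi> n) y = 0" using coords_scaleC[of "\<phi> n" 0 y] by simp
  then have "power_vector a $ 1 = 0" using y(2)[of n] by simp
  then show False by simp
qed

end

lemma sum_mat_G:
  "(\<Sum>k\<in>UNIV. cnj (x $ k) * (mat_G \<alpha> \<beta> i m *v y) $ k)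
    = cdot (matrix_inv (mat_C \<alpha> \<beta> i m) *v x) (matrix_inv (mat_C \<alpha> \<beta> i m) *v y)"
  unfolding mat_G_def Let_def matrix_vector_mul_assoc[symmetric] cdot_def
  by (simp add: matrix_vector_mult_def transpose_def sum_3 algebra_simps)


section \<open>Optimal decay\<close>

theorem theorem2:
  fixes D\<^sub>L :: "'h::chilbert_space set" and L :: "'h \<Rightarrow> 'h"
    and \<mu> :: "nat \<Rightarrow> real" and \<phi> :: "nat \<Rightarrow> 'h"
    and \<alpha> \<beta> :: real and i :: space_index
  assumes "0 < \<alpha>" and "\<alpha> < \<beta>"
    and "self_adjoint D\<^sub>L L" and "strictly_positive D\<^sub>L L" and "compact_resolvent D\<^sub>L L"
    and "orthonormal_basis \<phi>"
    and "\<And>n. \<phi> n \<in> D\<^sub>L" and "\<And>n. L (\<phi> n) = \<mu> n *\<^sub>R \<phi> n"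
    and "\<And>n. 0 < \<mu> n" and "mono \<mu>" and "filterlim \<mu> at_top sequentially"
  shows "sigma_max \<alpha> \<beta> \<mu> < 0 \<and>
    ((\<forall>n. complex_of_real (\<mu> n) \<noteq> const_m1 \<alpha> \<beta> \<and> complex_of_real (\<mu> n) \<noteq> const_m2 \<alpha> \<beta>) \<longrightarrow>
      normal_A \<alpha> \<beta> \<mu> \<phi> i (ip_G \<alpha> \<beta> \<mu> \<phi> i) \<and>
      equivalent_norms (phase_space \<mu> \<phi> i) (phase_norm \<mu> \<phi> i) (norm_G \<alpha> \<beta> \<mu> \<phi> i) \<and>
      (\<forall>U. solution_A \<alpha> \<beta> \<mu> \<phi> i U \<longrightarrow>
        (\<forall>t\<ge>0. norm_G \<alpha> \<beta> \<mu> \<phi> i (U t)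
          \<le> exp (sigma_max \<alpha> \<beta> \<mu> * t) * norm_G \<alpha> \<beta> \<mu> \<phi> i (U 0))) \<and>
      (\<forall>\<omega> < sigma_max \<alpha> \<beta> \<mu>. \<exists>U. solution_A \<alpha> \<beta> \<mu> \<phi> i U \<and>
        filterlim (\<lambda>t. norm_G \<alpha> \<beta> \<mu> \<phi> i (U t) * exp (- \<omega> * t)) at_top at_top)) \<and>
    ((\<exists>n. complex_of_real (\<mu> n) = const_m1 \<alpha> \<beta> \<or> complex_of_real (\<mu> n) = const_m2 \<alpha> \<beta>) \<longrightarrow>
      (\<nexists>ip. normal_A \<alpha> \<beta> \<mu> \<phi> i ip) \<and>
      (\<exists>N. norm_on (phase_space \<mu> \<phi> i) N \<and>
        equivalent_norms (phase_space \<mu> \<phi> i) (phase_norm \<mu> \<phi> i) N \<and>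
        (\<forall>U. solution_A \<alpha> \<beta> \<mu> \<phi> i U \<longrightarrow>
          (\<forall>t\<ge>0. N (U t) \<le> exp (sigma_max \<alpha> \<beta> \<mu> * t) * N (U 0))) \<and>
        (\<forall>\<omega> < sigma_max \<alpha> \<beta> \<mu>. \<exists>U. solution_A \<alpha> \<beta> \<mu> \<phi> i U \<and>
          filterlim (\<lambda>t. N (U t) * exp (- \<omega> * t)) at_top at_top)))"
proof -
  note \<alpha> = assms(1) and \<beta> = assms(2) and \<mu> = assms(9) and mono = assms(10) and lim = assms(11)
  interpret phase \<mu> \<phi> i using assms by unfold_locales
  let ?s = "sigma_max \<alpha> \<beta> \<mu>" and ?X = "phase_space \<mu> \<phi> i"
  let ?nondef = "\<lambda>n. complex_of_real (\<mu> n) \<noteq> const_m1 \<alpha> \<beta> \<and> complex_of_real (\<mu> n) \<noteq> const_m2 \<alpha> \<beta>"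
  obtain Q B where QB: "\<And>n. invertible (Q n)"
    "\<And>n x. Q n *v (companion \<alpha> \<beta> (\<mu> n) *v x) = B n *v (Q n *v x)"
    "\<And>n y. inner y (B n *v y) \<le> ?s * (norm y)\<^sup>2"
    "\<And>n y. \<bar>inner y (B n *v y)\<bar> \<le> (1/\<alpha> + 1) * (norm y)\<^sup>2"
    "\<And>n y. \<exists>f. f 0 = y \<and> solves (B n) f"
    "\<And>n. ?nondef n \<Longrightarrow> Q n = matrix_inv (mat_C \<alpha> \<beta> i (\<mu> n)) \<and> B n = bidiagonal (roots_enum \<alpha> \<beta> (\<mu> n)) 0"
    using block_exists[OF \<alpha> \<beta> \<mu> lim mono, of _ i] by metis
  obtain c C where cC: "0 < c" "0 < C" "\<And>n x. c * W n x \<le> norm (Q n *v x)"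
    "\<And>n x. norm (Q n *v x) \<le> C * W n x"
    by (rule uniform_block_bounds[OF \<alpha> \<beta> lim, of Q]) (use QB(1,6) in auto)
  let ?Z = "\<lambda>n U. Q n *v coords (\<phi> n) U"
  interpret block_system ?X "phase_norm \<mu> \<phi> i" ?Z "dom_A \<alpha> \<beta> \<mu> \<phi> i" "op_A \<alpha> \<beta> \<mu> \<phi>" B ?s "1/\<alpha> + 1" c C
    by (rule block_system_phase[OF \<alpha> QB(1-5) cC])
  have growth: "\<exists>U. solution_A \<alpha> \<beta> \<mu> \<phi> i U \<and> filterlim (\<lambda>t. E (U t) * exp (- \<omega> * t)) at_top at_top"
    if \<omega>: "\<omega> < ?s" for \<omega>
  proof -
    obtain n z where z: "char_root \<alpha> \<beta> (\<mu> n) z" "\<omega> < Re z" by (rule below_sigma_max[OF \<alpha> \<beta> \<mu> \<omega>])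
    show ?thesis
    proof (rule growing_solution)
      show "B n *v (Q n *v power_vector z) = z *s (Q n *v power_vector z)"
        by (simp add: QB(2)[symmetric] companion_power_vector[OF \<alpha> \<beta> \<mu> z(1)] vector_scalar_mult_matrix)
      have "power_vector z \<noteq> 0" by (metis power_vector_simps(1) zero_index zero_neq_one)
      then show "Q n *v power_vector z \<noteq> 0"
        using invertible_inverse(2)[OF QB(1), of n "power_vector z"] by auto
      show "\<omega> < Re z" by (rule z(2))
    qed
  qed
  have solution_in: "U t \<in> ?X" if "solution_A \<alpha> \<beta> \<mu> \<phi> i U" for U t
    using that T'_bounded(1) unfolding solution_def by metis
  have part1: "normal_A \<alpha> \<beta> \<mu> \<phi> i (ip_G \<alpha> \<beta> \<mu> \<phi> i) \<and>
      (\<forall>U\<in>?X. norm_G \<alpha> \<beta> \<mu> \<phi> i U = E U)" if nd: "\<forall>n. ?nondef n"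
  proof -
    have ip: "ip_G \<alpha> \<beta> \<mu> \<phi> i = block_ip"
      unfolding fun_eq_iff ip_G_def block_ip_def sum_mat_G using QB(6) nd by simp
    have "normal_A \<alpha> \<beta> \<mu> \<phi> i block_ip"
    proof (rule normal_diagonal)
      show "(B n *v y) $ j = roots_enum \<alpha> \<beta> (\<mu> n) j * y $ j" for n y j
        using QB(6)[of n] nd exhaust_3[of j] by (auto simp: bidiagonal_mult)
    qed
    then show ?thesis using ip_norm_block_ip by (simp add: ip)
  qed
  show ?thesis
  proof (intro conjI impI)
    show "?s < 0" by (rule sigma_max_negative[OF \<alpha> \<beta> \<mu> mono])
    assume nd: "\<forall>n. ?nondef n"
    have G: "norm_G \<alpha> \<beta> \<mu> \<phi> i U = E U" if "U \<in> ?X" for U using part1[OF nd] that by blast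
    show "normal_A \<alpha> \<beta> \<mu> \<phi> i (ip_G \<alpha> \<beta> \<mu> \<phi> i)" using part1[OF nd] by blast
    show "equivalent_norms ?X (phase_norm \<mu> \<phi> i) (norm_G \<alpha> \<beta> \<mu> \<phi> i)"
      using equivalent_E by (simp add: equivalent_norms_def G)
    show "\<forall>U. solution_A \<alpha> \<beta> \<mu> \<phi> i U \<longrightarrow> (\<forall>t\<ge>0. norm_G \<alpha> \<beta> \<mu> \<phi> i (U t)
          \<le> exp (?s * t) * norm_G \<alpha> \<beta> \<mu> \<phi> i (U 0))"
      using solution_decay by (simp add: G solution_in)
    show "\<forall>\<omega> < ?s. \<exists>U. solution_A \<alpha> \<beta> \<mu> \<phi> i U \<and>
        filterlim (\<lambda>t. norm_G \<alpha> \<beta> \<mu> \<phi> i (U t) * exp (- \<omega> * t)) at_top at_top"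
    proof (intro allI impI)
      fix \<omega> assume "\<omega> < ?s"
      then obtain U where U: "solution_A \<alpha> \<beta> \<mu> \<phi> i U"
        "filterlim (\<lambda>t. E (U t) * exp (- \<omega> * t)) at_top at_top" using growth by blast
      then show "\<exists>U. solution_A \<alpha> \<beta> \<mu> \<phi> i U \<and>
          filterlim (\<lambda>t. norm_G \<alpha> \<beta> \<mu> \<phi> i (U t) * exp (- \<omega> * t)) at_top at_top"
        by (intro exI[of _ U]) (simp add: G solution_in[OF U(1)])
    qed
  next
    assume "\<exists>n. complex_of_real (\<mu> n) = const_m1 \<alpha> \<beta> \<or> complex_of_real (\<mu> n) = const_m2 \<alpha> \<beta>"
    then show "\<nexists>ip. normal_A \<alpha> \<beta> \<mu> \<phi> i ip" using not_normal_at_double_root[OF \<alpha> \<beta>] by blast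
    show "\<exists>N. norm_on ?X N \<and> equivalent_norms ?X (phase_norm \<mu> \<phi> i) N \<and>
        (\<forall>U. solution_A \<alpha> \<beta> \<mu> \<phi> i U \<longrightarrow> (\<forall>t\<ge>0. N (U t) \<le> exp (?s * t) * N (U 0))) \<and>
        (\<forall>\<omega> < ?s. \<exists>U. solution_A \<alpha> \<beta> \<mu> \<phi> i U \<and>
          filterlim (\<lambda>t. N (U t) * exp (- \<omega> * t)) at_top at_top)"
    proof (intro exI[of _ E] conjI allI impI)
      show "norm_on ?X E" by (rule norm_on_E)
      show "equivalent_norms ?X (phase_norm \<mu> \<phi> i) E" by (rule equivalent_E)
      show "E (U t) \<le> exp (?s * t) * E (U 0)" if "solution_A \<alpha> \<beta> \<mu> \<phi> i U" "0 \<le> t" for U t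
        by (rule solution_decay[OF that])
      show "\<exists>U. solution_A \<alpha> \<beta> \<mu> \<phi> i U \<and> filterlim (\<lambda>t. E (U t) * exp (- \<omega> * t)) at_top at_top"
        if "\<omega> < ?s" for \<omega> by (rule growth[OF that])
    qed
  qed
qed

end
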